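(* The following decision problem is NP-complete, and it remains NP-complete even when restricted to instances in which every initial tile has number $1$: given a ZHED puzzle, decide whether there is a sequence of moves after which the target square is filled.
   Context: A ZHED puzzle is played on an $n\times n$ square grid. One square is designated as the target. Some of the other squares are filled by tiles, each initial tile carrying an integer number between $1$ and $n-1$. A move consists of selecting one of the remaining numbered tiles and a direction (up, down, left or right); if the selected tile has number $k$, the move replaces it with a blank tile (the square stays filled but the tile no longer carries a number, so it cannot be selected again) and fills, with blank tiles, the $k$ closest unfilled squares in the chosen direction from that tile. The puzzle is solvable if some sequence of moves fills the target square. *)

theory Defs
  imports "HOL-Computational_Algebra.Polynomial"
begin

section \<open>Deterministic multi-tape Turing machines\<close>

text \<open>
  Tapes are infinite in both directions; symbol 0 is the blank, 1 and 2 stand for the bits 0 and 1.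
  The control states are the numbers below \<open>num_states\<close>, the initial state is 0, and the number
  \<open>num_states\<close> itself is the halting state. Tape 0 holds the input, tape 1 the output. Only the
  finitely many values of \<open>trans\<close> constrained by \<open>wf_tm\<close> are ever used in a computation.
\<close>

datatype shift = Shift_Left | Stay | Shift_Right

record tm =
  num_tapes :: nat
  num_symbols :: nat
  num_states :: nat
  trans :: "nat \<Rightarrow> nat list \<Rightarrow> nat \<times> (nat \<times> shift) list"

definition wf_tm :: "tm \<Rightarrow> bool" where
  "wf_tm M \<longleftrightarrow> num_tapes M \<ge> 2 \<and> num_symbols M \<ge> 3 \<and>
     (\<forall>q ss. q < num_states M \<and> length ss = num_tapes M \<and> set ss \<subseteq> {..<num_symbols M} \<longrightarrow>
        (case trans M q ss of (q', as) \<Rightarrow>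
           q' \<le> num_states M \<and> length as = num_tapes M \<and> fst ` set as \<subseteq> {..<num_symbols M}))"

type_synonym tape = "int \<times> (int \<Rightarrow> nat)" \<comment> \<open>head position and contents\<close>
type_synonym config = "nat \<times> tape list"

definition read_tape :: "tape \<Rightarrow> nat" where
  "read_tape T = snd T (fst T)"

fun shift_amount :: "shift \<Rightarrow> int" where
  "shift_amount Shift_Left = -1"
| "shift_amount Stay = 0"
| "shift_amount Shift_Right = 1"

fun act_tape :: "nat \<times> shift \<Rightarrow> tape \<Rightarrow> tape" where
  "act_tape (s, m) (h, w) = (h + shift_amount m, w(h := s))"

fun step_tm :: "tm \<Rightarrow> config \<Rightarrow> config" where
  "step_tm M (q, ts) =
     (if q = num_states M then (q, ts)
      else (case trans M q (map read_tape ts) of (q', as) \<Rightarrow> (q', map2 act_tape as ts)))"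

definition tape_word :: "bool list \<Rightarrow> int \<Rightarrow> nat" where
  "tape_word x i = (if 0 \<le> i \<and> i < int (length x) then (if x ! nat i then 2 else 1) else 0)"

definition init_config :: "tm \<Rightarrow> bool list \<Rightarrow> config" where
  "init_config M x = (0, (0, tape_word x) # replicate (num_tapes M - 1) (0, tape_word []))"

text \<open>
  Halting configurations are fixed points of \<open>step_tm\<close>, so the following says that on every input
  \<open>x\<close> the machine halts after at most \<open>T |x|\<close> steps with \<open>f x\<close> on the output tape.
\<close>

definition computes_in_time :: "tm \<Rightarrow> (bool list \<Rightarrow> bool list) \<Rightarrow> (nat \<Rightarrow> nat) \<Rightarrow> bool" where
  "computes_in_time M f T \<longleftrightarrow> wf_tm M \<and>
     (\<forall>x. case (step_tm M ^^ T (length x)) (init_config M x) of (q, ts) \<Rightarrow>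
        q = num_states M \<and> snd (ts ! 1) = tape_word (f x))"


section \<open>Polynomial time and NP-completeness\<close>

type_synonym language = "bool list set"

definition polytime_computable :: "(bool list \<Rightarrow> bool list) \<Rightarrow> bool" where
  "polytime_computable f \<longleftrightarrow> (\<exists>M (p :: nat poly). computes_in_time M f (poly p))"

definition polytime_decidable :: "language \<Rightarrow> bool" where
  "polytime_decidable A \<longleftrightarrow> polytime_computable (\<lambda>x. [x \<in> A])"

text \<open>Self-delimiting pairing: each bit of \<open>x\<close> is preceded by a 1, and a 0 marks the end of \<open>x\<close>.\<close>

definition pair_word :: "bool list \<Rightarrow> bool list \<Rightarrow> bool list" where
  "pair_word x u = concat (map (\<lambda>b. [True, b]) x) @ False # u"

definition in_NP :: "language \<Rightarrow> bool" where
  "in_NP A \<longleftrightarrow> (\<exists>R (p :: nat poly). polytime_decidable R \<and>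
     (\<forall>x. x \<in> A \<longleftrightarrow> (\<exists>u. length u \<le> poly p (length x) \<and> pair_word x u \<in> R)))"

definition polytime_reducible :: "language \<Rightarrow> language \<Rightarrow> bool" where
  "polytime_reducible A B \<longleftrightarrow> (\<exists>f. polytime_computable f \<and> (\<forall>x. x \<in> A \<longleftrightarrow> f x \<in> B))"

definition NP_hard :: "language \<Rightarrow> bool" where
  "NP_hard B \<longleftrightarrow> (\<forall>A. in_NP A \<longrightarrow> polytime_reducible A B)"

definition NP_complete :: "language \<Rightarrow> bool" where
  "NP_complete B \<longleftrightarrow> in_NP B \<and> NP_hard B"


section \<open>ZHED puzzles\<close>

type_synonym square = "nat \<times> nat" \<comment> \<open>row (counted from the top) and column\<close>

definition board :: "nat \<Rightarrow> square set" where
  "board n = {..<n} \<times> {..<n}"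

record zhed =
  side :: nat
  target :: square
  tiles :: "square \<Rightarrow> nat option"

definition wf_zhed :: "zhed \<Rightarrow> bool" where
  "wf_zhed P \<longleftrightarrow> target P \<in> board (side P) \<and>
     (\<forall>s k. tiles P s = Some k \<longrightarrow>
        s \<in> board (side P) \<and> s \<noteq> target P \<and> 1 \<le> k \<and> k \<le> side P - 1)"

datatype cell = Unfilled | Blank | Numbered nat

type_synonym grid = "square \<Rightarrow> cell"

definition initial_grid :: "zhed \<Rightarrow> grid" where
  "initial_grid P s = (case tiles P s of None \<Rightarrow> Unfilled | Some k \<Rightarrow> Numbered k)"

datatype direction = Up | Down | Left | Right

text \<open>The squares lying in the given direction from a square, in order of increasing distance.\<close>

fun ray :: "nat \<Rightarrow> square \<Rightarrow> direction \<Rightarrow> square list" where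
  "ray n (r, c) Up = map (\<lambda>i. (i, c)) (rev [0..<r])"
| "ray n (r, c) Down = map (\<lambda>i. (i, c)) [Suc r..<n]"
| "ray n (r, c) Left = map (\<lambda>j. (r, j)) (rev [0..<c])"
| "ray n (r, c) Right = map (\<lambda>j. (r, j)) [Suc c..<n]"

text \<open>If fewer than \<open>k\<close> unfilled squares remain in the chosen direction, all of them are filled.\<close>

definition closest_unfilled :: "nat \<Rightarrow> grid \<Rightarrow> square \<Rightarrow> direction \<Rightarrow> nat \<Rightarrow> square set" where
  "closest_unfilled n g s d k = set (take k (filter (\<lambda>t. g t = Unfilled) (ray n s d)))"

inductive zhed_move :: "nat \<Rightarrow> grid \<Rightarrow> grid \<Rightarrow> bool" for n :: nat where
  "s \<in> board n \<Longrightarrow> g s = Numbered k \<Longrightarrow>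
     zhed_move n g (\<lambda>t. if t = s \<or> t \<in> closest_unfilled n g s d k then Blank else g t)"

definition solvable :: "zhed \<Rightarrow> bool" where
  "solvable P \<longleftrightarrow>
     (\<exists>g. (zhed_move (side P))\<^sup>*\<^sup>* (initial_grid P) g \<and> g (target P) \<noteq> Unfilled)"


section \<open>The decision problems\<close>

text \<open>
  A puzzle is written as its side length, the target coordinates and the row-major list of all cells
  (0 for a cell without a tile). Since all these numbers are at most the side length \<open>n\<close> and the cells
  alone take at least \<open>n * n\<close> bits, writing them in unary costs only a polynomial factor.
\<close>

definition unary :: "nat \<Rightarrow> bool list" where
  "unary k = replicate k True @ [False]"

definition cell_code :: "nat option \<Rightarrow> nat" where
  "cell_code t = (case t of None \<Rightarrow> 0 | Some k \<Rightarrow> k)"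

definition encode_zhed :: "zhed \<Rightarrow> bool list" where
  "encode_zhed P = concat (map unary
     ([side P, fst (target P), snd (target P)] @
      map (\<lambda>s. cell_code (tiles P s)) (List.product [0..<side P] [0..<side P])))"

definition ZHED :: language where
  "ZHED = {encode_zhed P | P. wf_zhed P \<and> solvable P}"

definition ZHED_ones :: language where
  "ZHED_ones = {encode_zhed P | P. wf_zhed P \<and> ran (tiles P) \<subseteq> {1} \<and> solvable P}"

lemma unary_append_inject: "unary a @ x = unary b @ y \<longleftrightarrow> a = b \<and> x = y"
proof (induction a arbitrary: b)
  case 0
  show ?case by (cases b) (auto simp: unary_def)
next
  case (Suc a)
  then show ?case by (cases b) (auto simp: unary_def)
qed

lemma concat_unary_inject: "concat (map unary xs) = concat (map unary ys) \<longleftrightarrow> xs = ys"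
proof (induction xs arbitrary: ys)
  case Nil
  show ?case by (cases ys) (auto simp: unary_def)
next
  case (Cons x xs)
  show ?case
  proof (cases ys)
    case Nil
    then show ?thesis by (simp add: unary_def)
  next
    case (Cons y ys')
    then show ?thesis using Cons.IH by (simp add: unary_append_inject)
  qed
qed

lemma inj_on_encode_zhed: "inj_on encode_zhed {P :: zhed. wf_zhed P}"
proof (rule inj_onI)
  fix P Q :: zhed
  assume "P \<in> {P. wf_zhed P}" and "Q \<in> {P. wf_zhed P}"
  then have P: "wf_zhed P" and Q: "wf_zhed Q" by simp_all
  assume eq: "encode_zhed P = encode_zhed Q"
  have l: "side P = side Q" "target P = target Q"
    and m: "map (\<lambda>s. cell_code (tiles P s)) (List.product [0..<side P] [0..<side P]) =
      map (\<lambda>s. cell_code (tiles Q s)) (List.product [0..<side Q] [0..<side Q])"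
    using eq unfolding encode_zhed_def concat_unary_inject by (auto intro: prod_eqI)
  have "tiles P s = tiles Q s" for s
  proof (cases "s \<in> board (side P)")
    case True
    then have "cell_code (tiles P s) = cell_code (tiles Q s)"
      using m l(1) by (auto simp: board_def)
    moreover have "tiles P s \<noteq> Some 0" "tiles Q s \<noteq> Some 0"
      using P Q unfolding wf_zhed_def by (metis not_one_le_zero)+
    ultimately show ?thesis
      by (auto simp: cell_code_def split: option.splits)
  next
    case False
    then show ?thesis
      using P Q l(1) unfolding wf_zhed_def by (metis option.exhaust)
  qed
  then show "P = Q"
    using l by (intro zhed.equality) auto
qed

end

theory Submission imports Defs "HOL-Library.Countable" begin

text \<open>
  Membership: a history of the grid is a certificate of polynomial length, since every move uses up
  a tile. All polynomial-time claims are reduced to one closure result: functions given by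
  bounded sums over positions of the input word are computed by machines whose head positions
  serve as unary counters.

  Hardness: the runs of a polynomial-time verifier are described by clauses, which become an instance
  of the hitting set problem (choose one literal per variable so that every clause is hit), and this
  becomes a puzzle with tiles of number 1 only. There every filled square is charged to a
  different tile in its row or column, with no unfilled square between the two. Each line of
  the puzzle lacks as many tiles on its left margin as the columns have to contribute, so a count of
  the charges forces every run of tiles in a column to be used either upwards or downwards,
  consistently along the column. The columns used downwards form the hitting set.
\<close>

section \<open>Structured tape programs\<close>

text \<open>Both directions of the hardness proof rest on forgetting something. Of a solution only
  the static charging is kept; the order of the moves is dropped, and time matters only where a
  solution is built. Of a run only implications are kept: no clause says that the state or the
  contents of a cell is unique. An assignment may thus contain spurious facts, but it contains all
  facts of the run, and acceptance is tested by forbidding every wrong output symbol. The obstacle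
  on the board is that a column is one long line: a run may help out bands far away, and spare tiles
  might be saved for a middle line. Against this stand the zones, the empty stretches of about
  \<open>2 * d\<close> squares above and below each run. A run has at most two tiles more than a
  zone and one line square take, so the surplus of a whole column is at most \<open>2 * m\<close>,
  while a charge that crosses a zone fills all of it. The choice \<open>d = m + 2\<close> makes a
  zone too expensive for this surplus. Hitting set suits the board because a demand for at least one
  contribution is a stack with one missing tile.\<close>

datatype com =
    Skip
  | Act nat "nat option" shift
  | Seq com com
  | Cond nat nat com com
  | Loop nat nat com

fun com_len :: "com \<Rightarrow> nat" where
  "com_len Skip = 0"
| "com_len (Act r so sh) = 1"
| "com_len (Seq a b) = com_len a + com_len b"
| "com_len (Cond r s a b) = com_len a + com_len b + 2"
| "com_len (Loop r s a) = com_len a + 2"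

text \<open>The tape looked at, and a map from the symbol read to the symbol written, the shift and
  the next address. Addresses are the control states of the machine.\<close>

type_synonym instr = "nat \<times> (nat \<Rightarrow> nat \<times> shift \<times> nat)"

text \<open>Jumps carry absolute addresses, hence the parameter \<open>q\<close>, the address of the
  first instruction. The unconditional jumps after a branch or a loop body look at tape 0 and write
  back what they read.\<close>

fun instrs :: "com \<Rightarrow> nat \<Rightarrow> instr list" where
  "instrs Skip q = []"
| "instrs (Act r so sh) q = [(r, \<lambda>x. (case so of None \<Rightarrow> x | Some s \<Rightarrow> s, sh, Suc q))]"
| "instrs (Seq a b) q = instrs a q @ instrs b (q + com_len a)"
| "instrs (Cond r s a b) q =
     (r, \<lambda>x. (x, Stay, if x = s then Suc q else q + com_len a + 2)) # instrs a (Suc q) @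
     (0, \<lambda>x. (x, Stay, q + com_len a + com_len b + 2)) # instrs b (q + com_len a + 2)"
| "instrs (Loop r s a) q =
     (r, \<lambda>x. (x, Stay, if x = s then q + com_len a + 2 else Suc q)) # instrs a (Suc q) @
     [(0, \<lambda>x. (x, Stay, q))]"

fun wf_com :: "nat \<Rightarrow> com \<Rightarrow> bool" where
  "wf_com K Skip = True"
| "wf_com K (Act r so sh) = (r < K \<and> (\<forall>s. so = Some s \<longrightarrow> s < 3))"
| "wf_com K (Seq a b) = (wf_com K a \<and> wf_com K b)"
| "wf_com K (Cond r s a b) = (r < K \<and> wf_com K a \<and> wf_com K b)"
| "wf_com K (Loop r s a) = (r < K \<and> wf_com K a)"

definition machine :: "nat \<Rightarrow> instr list \<Rightarrow> tm" where
  "machine K cs = \<lparr>num_tapes = K, num_symbols = 3, num_states = length cs,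
     trans = \<lambda>q ss. case cs ! q of (r, f) \<Rightarrow> (case f (ss ! r) of (s, m, q') \<Rightarrow>
       (q', map (\<lambda>i. if i = r then (s, m) else (ss ! i, Stay)) [0..<K]))\<rparr>"

text \<open>The step counts are those of the compiled code: the 2 in \<open>CondT\<close> is the
  test and the jump over the other branch, the 2 in \<open>LoopStep\<close> is the test and the jump
  back. A loop ends when \<open>s\<close> is read.\<close>

inductive exec :: "com \<Rightarrow> tape list \<Rightarrow> nat \<Rightarrow> tape list \<Rightarrow> bool" where
  Skip: "exec Skip ts 0 ts"
| Act: "exec (Act r so sh) ts 1
    (ts[r := act_tape (case so of None \<Rightarrow> read_tape (ts ! r) | Some s \<Rightarrow> s, sh) (ts ! r)])"
| Seq: "exec a ts t ts1 \<Longrightarrow> exec b ts1 t' ts2 \<Longrightarrow> exec (Seq a b) ts (t + t') ts2"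
| CondT: "read_tape (ts ! r) = s \<Longrightarrow> exec a ts t ts' \<Longrightarrow> exec (Cond r s a b) ts (t + 2) ts'"
| CondF: "read_tape (ts ! r) \<noteq> s \<Longrightarrow> exec b ts t ts' \<Longrightarrow> exec (Cond r s a b) ts (t + 1) ts'"
| LoopEnd: "read_tape (ts ! r) = s \<Longrightarrow> exec (Loop r s a) ts 1 ts"
| LoopStep: "read_tape (ts ! r) \<noteq> s \<Longrightarrow> exec a ts t ts1 \<Longrightarrow> exec (Loop r s a) ts1 t' ts2 \<Longrightarrow>
    exec (Loop r s a) ts (t + t' + 2) ts2"

lemma length_instrs [simp]: "length (instrs c q) = com_len c"
  by (induction c arbitrary: q) auto

lemma exec_length: "exec c ts t ts' \<Longrightarrow> length ts' = length ts"
  by (induction rule: exec.induct) auto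

text \<open>A target may equal \<open>q + com_len c\<close>, the address just behind the code; for
  the whole program this is the halting state.\<close>

lemma instrs_wf:
  assumes "(r, f) \<in> set (instrs c q)" "wf_com K c" "0 < K"
  shows "r < K \<and> (\<forall>x<3. fst (f x) < 3 \<and> snd (snd (f x)) \<le> q + com_len c)"
  using assms
proof (induction c arbitrary: q)
  case (Act r so sh)
  then show ?case by (auto split: option.splits)
next
  case (Seq a b)
  then show ?case by fastforce
next
  case (Cond r s a b)
  then show ?case by fastforce
next
  case (Loop r s a)
  then show ?case by fastforce
qed auto

lemma wf_machine:
  assumes "wf_com K c" "2 \<le> K"
  shows "wf_tm (machine K (instrs c 0))"
  unfolding wf_tm_def
proof (intro conjI allI impI)
  fix q ss
  assume A: "q < num_states (machine K (instrs c 0)) \<and> length ss = num_tapes (machine K (instrs c 0)) \<and>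
    set ss \<subseteq> {..<num_symbols (machine K (instrs c 0))}"
  obtain r f where rf: "instrs c 0 ! q = (r, f)" by fastforce
  then have "(r, f) \<in> set (instrs c 0)"
    using A nth_mem[of q "instrs c 0"] by (simp add: machine_def)
  from instrs_wf[OF this assms(1)] assms(2)
  have r: "r < K" and f: "\<And>x. x < 3 \<Longrightarrow> fst (f x) < 3 \<and> snd (snd (f x)) \<le> com_len c"
    by auto
  have ss: "ss ! i < 3" if "i < K" for i
    using A that nth_mem[of i ss] by (auto simp: machine_def subset_iff)
  show "case trans (machine K (instrs c 0)) q ss of (q', as) \<Rightarrow>
       q' \<le> num_states (machine K (instrs c 0)) \<and> length as = num_tapes (machine K (instrs c 0)) \<and>
       fst ` set as \<subseteq> {..<num_symbols (machine K (instrs c 0))}"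
    using f[OF ss[OF r]] ss by (auto simp: machine_def rf split: prod.splits)
qed (use assms in \<open>auto simp: machine_def\<close>)

lemma act_tape_stay [simp]: "act_tape (read_tape T, Stay) T = T"
  by (cases T) (simp add: read_tape_def)

lemma step_machine:
  assumes "q < length cs" "cs ! q = (r, f)" "r < K" "length ts = K"
    "f (read_tape (ts ! r)) = (s, m, q')"
  shows "step_tm (machine K cs) (q, ts) = (q', ts[r := act_tape (s, m) (ts ! r)])"
proof -
  have "map2 act_tape (map (\<lambda>i. if i = r then (s, m) else (map read_tape ts ! i, Stay)) [0..<K]) ts
      = ts[r := act_tape (s, m) (ts ! r)]"
    using assms by (intro nth_equalityI) (auto simp: nth_list_update)
  then show ?thesis
    using assms by (simp add: machine_def)
qed

declare step_tm.simps [simp del]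

lemma step_machine_test:
  assumes "q < length cs" "cs ! q = (r, f)" "r < K" "length ts = K"
    "f (read_tape (ts ! r)) = (read_tape (ts ! r), Stay, q')"
  shows "step_tm (machine K cs) (q, ts) = (q', ts)"
  using step_machine[OF assms] by simp

lemma funpow_trans: "(f ^^ m) x = y \<Longrightarrow> (f ^^ n) y = z \<Longrightarrow> (f ^^ (m + n)) x = z"
  by (simp add: add.commute[of m n] funpow_add)

text \<open>A subprogram sits somewhere inside the whole list, so the code around it must be
  arbitrary for the induction. After the jump back, a loop is executed again at the same address,
  with the same \<open>pre\<close>.\<close>

lemma exec_machine:
  assumes "exec c ts t ts'" "wf_com K c" "0 < K" "length ts = K"
    "cs = pre @ instrs c (length pre) @ post"
  shows "(step_tm (machine K cs) ^^ t) (length pre, ts) = (length pre + com_len c, ts')"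
  using assms
proof (induction arbitrary: pre post rule: exec.induct)
  case (Skip ts)
  then show ?case by simp
next
  case (Act r so sh ts)
  then show ?case
    by (subst One_nat_def, simp only: funpow.simps o_apply id_apply,
        subst step_machine) (auto simp: nth_append)
next
  case (Seq a ts t ts1 b t' ts2)
  have 1: "(step_tm (machine K cs) ^^ t) (length pre, ts) = (length pre + com_len a, ts1)"
    using Seq.prems by (intro Seq.IH(1)) auto
  have 2: "(step_tm (machine K cs) ^^ t') (length (pre @ instrs a (length pre)), ts1) =
      (length (pre @ instrs a (length pre)) + com_len b, ts2)"
    using Seq.prems Seq.hyps exec_length by (intro Seq.IH(2)[where post = post]) auto
  show ?case
    using funpow_trans[OF 1] 2 by (simp add: add.assoc)
next
  case (CondT ts r s a t ts' b)
  let ?M = "machine K cs"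
  have 1: "(step_tm ?M ^^ 1) (length pre, ts) = (Suc (length pre), ts)"
    using CondT by (simp add: step_machine_test nth_append)
  have 2: "(step_tm ?M ^^ t) (length (pre @ [instrs (Cond r s a b) (length pre) ! 0]), ts) =
      (length (pre @ [instrs (Cond r s a b) (length pre) ! 0]) + com_len a, ts')"
    using CondT.prems by (intro CondT.IH) auto
  have 3: "(step_tm ?M ^^ 1) (Suc (length pre) + com_len a, ts') =
      (length pre + com_len (Cond r s a b), ts')"
    using CondT.prems exec_length[OF CondT.hyps(2)]
    by (simp, subst step_machine_test) (auto simp: nth_append)
  show ?case
    using funpow_trans[OF funpow_trans[OF 1] 3] 2 by simp
next
  case (CondF ts r s b t ts' a)
  let ?M = "machine K cs"
  have 1: "(step_tm ?M ^^ 1) (length pre, ts) = (length pre + com_len a + 2, ts)"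
    using CondF by (simp add: step_machine_test nth_append)
  let ?pre = "pre @ (r, \<lambda>x. (x, Stay, if x = s then Suc (length pre) else length pre + com_len a + 2)) #
      instrs a (Suc (length pre)) @ [(0, \<lambda>x. (x, Stay, length pre + com_len a + com_len b + 2))]"
  have 2: "(step_tm ?M ^^ t) (length ?pre, ts) = (length ?pre + com_len b, ts')"
    using CondF.prems by (intro CondF.IH[where post = post]) auto
  show ?case
    using funpow_trans[OF 1] 2 by (simp add: algebra_simps)
next
  case (LoopEnd ts r s a)
  then show ?case by (simp add: step_machine_test nth_append)
next
  case (LoopStep ts r s a t ts1 t' ts2)
  let ?M = "machine K cs"
  have 1: "(step_tm ?M ^^ 1) (length pre, ts) = (Suc (length pre), ts)"
    using LoopStep by (simp add: step_machine_test nth_append)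
  have 2: "(step_tm ?M ^^ t) (length (pre @ [instrs (Loop r s a) (length pre) ! 0]), ts) =
      (length (pre @ [instrs (Loop r s a) (length pre) ! 0]) + com_len a, ts1)"
    using LoopStep.prems by (intro LoopStep.IH(1)) auto
  have 3: "(step_tm ?M ^^ 1) (Suc (length pre) + com_len a, ts1) = (length pre, ts1)"
    using LoopStep.prems exec_length[OF LoopStep.hyps(2)]
    by (simp, subst step_machine_test) (auto simp: nth_append)
  have 4: "(step_tm ?M ^^ t') (length pre, ts1) = (length pre + com_len (Loop r s a), ts2)"
    using LoopStep.prems exec_length[OF LoopStep.hyps(2)] by (intro LoopStep.IH(2)) auto
  show ?case
    using funpow_trans[OF funpow_trans[OF funpow_trans[OF 1] 3] 4] 2 by simp
qed

section \<open>Counter programs\<close>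

text \<open>
  A counter is the head position of a tape whose only nonblank cell is a mark at position 0, so that
  the test for zero is the test for the mark. The input head, tape 0, is treated as a counter, too.
\<close>

definition mark_tape :: "int \<Rightarrow> nat" where
  "mark_tape = (\<lambda>_. 0)(0 := 1)"

text \<open>The only tapes that occur between the instructions of a counter program: the output head
  stands right behind the bits written so far, and the contents of all other tapes never
  change.\<close>

definition counter_tapes :: "bool list \<Rightarrow> nat \<Rightarrow> (nat \<Rightarrow> nat) \<times> bool list \<Rightarrow> tape list" where
  "counter_tapes w K st = map (\<lambda>r.
     if r = 0 then (int (fst st 0), tape_word w)
     else if r = 1 then (int (length (snd st)), tape_word (snd st))
     else (int (fst st r), mark_tape)) [0..<K]"

definition runs :: "bool list \<Rightarrow> nat \<Rightarrow> com \<Rightarrow> (nat \<Rightarrow> nat) \<times> bool list \<Rightarrow> nat \<Rightarrow> (nat \<Rightarrow> nat) \<times> bool list \<Rightarrow> bool" where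
  "runs w K c st n st' \<longleftrightarrow> (\<exists>t\<le>n. exec c (counter_tapes w K st) t (counter_tapes w K st'))"

abbreviation inc :: "nat \<Rightarrow> com" where "inc r \<equiv> Act r None Shift_Right"
abbreviation dec :: "nat \<Rightarrow> com" where "dec r \<equiv> Act r None Shift_Left"
abbreviation emit :: "bool \<Rightarrow> com" where "emit b \<equiv> Act 1 (Some (if b then 2 else 1)) Shift_Right"
abbreviation countdown :: "nat \<Rightarrow> com \<Rightarrow> com" where "countdown r c \<equiv> Loop r 1 (Seq (dec r) c)"

lemma read_counter [simp]:
  assumes "r < K"
  shows "read_tape (counter_tapes w K st ! r) =
    (if r = 0 then tape_word w (int (fst st 0)) else if r = 1 then 0 else if fst st r = 0 then 1 else 0)"
  using assms by (auto simp: counter_tapes_def read_tape_def mark_tape_def tape_word_def)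

lemma runs_mono: "runs w K c st n st' \<Longrightarrow> n \<le> n' \<Longrightarrow> runs w K c st n' st'"
  unfolding runs_def by (meson le_trans)

lemma runs_Skip: "runs w K Skip st n st"
  unfolding runs_def by (auto intro: exec.Skip)

lemma runs_Seq: "runs w K a st n st1 \<Longrightarrow> runs w K b st1 n' st2 \<Longrightarrow> runs w K (Seq a b) st (n + n') st2"
  unfolding runs_def by (meson add_mono exec.Seq)

lemma runs_inc: "r < K \<Longrightarrow> r \<noteq> 1 \<Longrightarrow> runs w K (inc r) (\<sigma>, out) 1 (\<sigma>(r := Suc (\<sigma> r)), out)"
proof -
  assume r: "r < K" "r \<noteq> 1"
  have "(counter_tapes w K (\<sigma>, out))[r := act_tape (read_tape (counter_tapes w K (\<sigma>, out) ! r), Shift_Right)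
      (counter_tapes w K (\<sigma>, out) ! r)] = counter_tapes w K (\<sigma>(r := Suc (\<sigma> r)), out)"
    using r by (intro nth_equalityI) (auto simp: counter_tapes_def nth_list_update read_tape_def)
  then show ?thesis
    unfolding runs_def using exec.Act[of r None Shift_Right "counter_tapes w K (\<sigma>, out)"] by auto
qed

lemma runs_dec: "r < K \<Longrightarrow> r \<noteq> 1 \<Longrightarrow> 0 < \<sigma> r \<Longrightarrow> runs w K (dec r) (\<sigma>, out) 1 (\<sigma>(r := \<sigma> r - 1), out)"
proof -
  assume r: "r < K" "r \<noteq> 1" "0 < \<sigma> r"
  have "(counter_tapes w K (\<sigma>, out))[r := act_tape (read_tape (counter_tapes w K (\<sigma>, out) ! r), Shift_Left)
      (counter_tapes w K (\<sigma>, out) ! r)] = counter_tapes w K (\<sigma>(r := \<sigma> r - 1), out)"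
    using r by (intro nth_equalityI) (auto simp: counter_tapes_def nth_list_update read_tape_def)
  then show ?thesis
    unfolding runs_def using exec.Act[of r None Shift_Left "counter_tapes w K (\<sigma>, out)"] by auto
qed

lemma tape_word_snoc: "(tape_word xs)(int (length xs) := (if b then 2 else 1)) = tape_word (xs @ [b])"
  by (rule ext) (auto simp: tape_word_def nth_append)

lemma runs_emit: "1 < K \<Longrightarrow> runs w K (emit b) (\<sigma>, out) 1 (\<sigma>, out @ [b])"
proof -
  assume r: "1 < K"
  have "(counter_tapes w K (\<sigma>, out))[1 := act_tape ((if b then 2 else 1), Shift_Right)
      (counter_tapes w K (\<sigma>, out) ! 1)] = counter_tapes w K (\<sigma>, out @ [b])"
    using r by (intro nth_equalityI)
      (auto simp: counter_tapes_def nth_list_update tape_word_snoc[of out True, simplified]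
        tape_word_snoc[of out False, simplified])
  then show ?thesis
    unfolding runs_def
    using exec.Act[of 1 "Some (if b then 2 else 1)" Shift_Right "counter_tapes w K (\<sigma>, out)"] by auto
qed

lemma runs_CondT:
  "read_tape (counter_tapes w K st ! r) = s \<Longrightarrow> runs w K a st n st' \<Longrightarrow> runs w K (Cond r s a b) st (n + 2) st'"
  unfolding runs_def by (meson add_le_mono exec.CondT le_refl)

lemma runs_CondF:
  "read_tape (counter_tapes w K st ! r) \<noteq> s \<Longrightarrow> runs w K b st n st' \<Longrightarrow> runs w K (Cond r s a b) st (n + 1) st'"
  unfolding runs_def by (meson add_le_mono exec.CondF le_refl)

lemma runs_LoopEnd: "read_tape (counter_tapes w K st ! r) = s \<Longrightarrow> runs w K (Loop r s a) st 1 st"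
  unfolding runs_def using exec.LoopEnd by blast

lemma runs_LoopStep:
  "read_tape (counter_tapes w K st ! r) \<noteq> s \<Longrightarrow> runs w K a st n st1 \<Longrightarrow> runs w K (Loop r s a) st1 n' st2 \<Longrightarrow>
    runs w K (Loop r s a) st (n + n' + 2) st2"
  unfolding runs_def by (meson add_mono exec.LoopStep le_refl)

text \<open>\<open>g i\<close> and \<open>ou i\<close> describe counters and output after
  \<open>i\<close> rounds, with counter \<open>r\<close> overridden. The body sees \<open>r\<close>
  already decremented, hence \<open>k - Suc i\<close> on both sides. A round costs the body, one
  decrement and two steps of loop control; leaving costs one test.\<close>

lemma runs_countdown_aux:
  assumes "2 \<le> r" "r < K"
    "\<And>i. i < k \<Longrightarrow> runs w K c ((g i)(r := k - Suc i), ou i) n ((g (Suc i))(r := k - Suc i), ou (Suc i))"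
  shows "runs w K (countdown r c) ((g 0)(r := k), ou 0) (k * (n + 3) + 1) ((g k)(r := 0), ou k)"
  using assms(3)
proof (induction k arbitrary: g ou)
  case 0
  then show ?case using assms runs_LoopEnd[of w K "((g 0)(r := 0), ou 0)" r 1] by (simp add: fun_upd_def)
next
  case (Suc k)
  have 1: "runs w K (dec r) ((g 0)(r := Suc k), ou 0) 1 ((g 0)(r := k), ou 0)"
    using runs_dec[of r K "(g 0)(r := Suc k)" w "ou 0"] assms by simp
  have 2: "runs w K c ((g 0)(r := k), ou 0) n ((g (Suc 0))(r := k), ou (Suc 0))"
    using Suc.prems[of 0] by (simp add: fun_upd_def)
  have 3: "runs w K (countdown r c) ((g (Suc 0))(r := k), ou (Suc 0)) (k * (n + 3) + 1)
      ((g (Suc k))(r := 0), ou (Suc k))"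
  proof (rule Suc.IH[of "\<lambda>i. g (Suc i)" "\<lambda>i. ou (Suc i)"])
    fix i assume "i < k"
    then show "runs w K c ((g (Suc i))(r := k - Suc i), ou (Suc i)) n
        ((g (Suc (Suc i)))(r := k - Suc i), ou (Suc (Suc i)))"
      using Suc.prems[of "Suc i"] by (simp add: fun_upd_def)
  qed
  show ?case
    by (rule runs_mono[OF runs_LoopStep[OF _ runs_Seq[OF 1 2] 3]]) (use assms in auto)
qed

lemma runs_countdown:
  assumes "2 \<le> r" "r < K"
    "\<And>i. i < k \<Longrightarrow> runs w K c ((g i)(r := k - Suc i), ou i) n ((g (Suc i))(r := k - Suc i), ou (Suc i))"
    "st = ((g 0)(r := k), ou 0)" "st' = ((g k)(r := 0), ou k)" "k * (n + 3) + 1 \<le> n'"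
  shows "runs w K (countdown r c) st n' st'"
  using runs_mono[OF runs_countdown_aux[of r K k w c g ou n]] assms by blast

section \<open>Terms with bounded sums\<close>

text \<open>
  The values of these terms are polynomially bounded in the length of the input word and in the
  variables, so they can be computed with unary counters in polynomial time. Variables are de Bruijn
  indices: \<^term>\<open>Var\<close> is the innermost one, and \<^term>\<open>Weak\<close> skips it.
\<close>

datatype trm =
    Const nat
  | Var
  | Weak trm
  | Add trm trm
  | Sub trm trm
  | Sum trm trm
  | Sym trm
  | Len

primrec eval :: "trm \<Rightarrow> bool list \<Rightarrow> (nat \<Rightarrow> nat) \<Rightarrow> nat" where
  "eval (Const k) w e = k"
| "eval Var w e = e 0"
| "eval (Weak t) w e = eval t w (\<lambda>i. e (Suc i))"
| "eval (Add a b) w e = eval a w e + eval b w e"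
| "eval (Sub a b) w e = eval a w e - eval b w e"
| "eval (Sum a b) w e = (\<Sum>i<eval a w e. eval b w (case_nat i e))"
| "eval (Sym a) w e = tape_word w (int (eval a w e))"
| "eval Len w e = length w"

text \<open>
  \<^term>\<open>compile t d n \<rho>\<close> adds the value of \<^term>\<open>t\<close> to counter \<^term>\<open>d\<close>, where variable \<^term>\<open>i\<close>
  lives in counter \<^term>\<open>\<rho> i\<close> and the counters from \<^term>\<open>n\<close> on are zero before and afterwards.
\<close>

primrec compile :: "trm \<Rightarrow> nat \<Rightarrow> nat \<Rightarrow> (nat \<Rightarrow> nat) \<Rightarrow> com" where
  "compile (Const k) d n \<rho> = ((Seq (inc d)) ^^ k) Skip"
| "compile Var d n \<rho> = Seq (countdown (\<rho> 0) (Seq (inc d) (inc n))) (countdown n (inc (\<rho> 0)))"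
| "compile (Weak t) d n \<rho> = compile t d n (\<lambda>i. \<rho> (Suc i))"
| "compile (Add a b) d n \<rho> = Seq (compile a d n \<rho>) (compile b d n \<rho>)"
| "compile (Sub a b) d n \<rho> = Seq (compile a n (n + 1) \<rho>) (Seq (compile b (n + 1) (n + 2) \<rho>)
     (Seq (countdown (n + 1) (Cond n 1 Skip (dec n))) (countdown n (inc d))))"
| "compile (Sum a b) d n \<rho> = Seq (compile a n (n + 1) \<rho>)
     (Seq (countdown n (Seq (compile b d (n + 2) (case_nat (n + 1) \<rho>)) (inc (n + 1)))) (countdown (n + 1) Skip))"
| "compile (Sym a) d n \<rho> = Seq (compile a n (n + 1) \<rho>) (Seq (countdown n (Seq (inc (n + 1)) (inc 0)))
     (Seq (Cond 0 1 (inc d) (Cond 0 2 (Seq (inc d) (inc d)) Skip)) (countdown (n + 1) (dec 0))))"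
| "compile Len d n \<rho> = Seq (Loop 0 0 (Seq (inc 0) (Seq (inc n) (inc d)))) (countdown n (dec 0))"

primrec regs :: "trm \<Rightarrow> nat" where
  "regs (Const k) = 0"
| "regs Var = 1"
| "regs (Weak t) = regs t"
| "regs (Add a b) = max (regs a) (regs b)"
| "regs (Sub a b) = max (regs a) (regs b) + 2"
| "regs (Sum a b) = max (regs a) (regs b) + 2"
| "regs (Sym a) = regs a + 2"
| "regs Len = 1"

text \<open>Bounds in a single number that dominates the word length and all variables. The index of
  a sum may exceed this number \<open>s\<close>, but not \<open>s\<close> plus the bound of the
  upper limit; this is the reason for the composition with
  \<open>[:0, 1:] + val_bound a\<close>.\<close>

primrec val_bound :: "trm \<Rightarrow> nat poly" where
  "val_bound (Const k) = [:k:]"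
| "val_bound Var = [:0, 1:]"
| "val_bound (Weak t) = val_bound t"
| "val_bound (Add a b) = val_bound a + val_bound b"
| "val_bound (Sub a b) = val_bound a"
| "val_bound (Sum a b) = val_bound a * pcompose (val_bound b) ([:0, 1:] + val_bound a)"
| "val_bound (Sym a) = [:2:]"
| "val_bound Len = [:0, 1:]"

primrec time_bound :: "trm \<Rightarrow> nat poly" where
  "time_bound (Const k) = [:k:]"
| "time_bound Var = [:2, 9:]"
| "time_bound (Weak t) = time_bound t"
| "time_bound (Add a b) = time_bound a + time_bound b"
| "time_bound (Sub a b) = time_bound a + time_bound b + [:5:] * val_bound b + [:4:] * val_bound a + [:2:]"
| "time_bound (Sum a b) = time_bound a +
     val_bound a * (pcompose (time_bound b) ([:0, 1:] + val_bound a) + [:7:]) + [:2:]"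
| "time_bound (Sym a) = time_bound a + [:9:] * val_bound a + [:7:]"
| "time_bound Len = [:2, 9:]"

text \<open>Natural coefficients make every polynomial monotone, so bounds may be applied to
  overestimates.\<close>

lemma poly_nat_mono: "(x::nat) \<le> y \<Longrightarrow> poly p x \<le> poly p y"
  by (induction p) (auto intro!: add_mono mult_mono)

lemma eval_le:
  "length w \<le> s \<Longrightarrow> (\<forall>i. e i \<le> s) \<Longrightarrow> eval t w e \<le> poly (val_bound t) s"
proof (induction t arbitrary: s e)
  case (Sub a b)
  then show ?case by (simp add: diff_le_mono2) (meson Sub.IH(1) diff_le_self le_trans)
next
  case (Sum a b)
  let ?A = "poly (val_bound a) s"
  have a: "eval a w e \<le> ?A" using Sum by blast
  have "eval b w (case_nat i e) \<le> poly (val_bound b) (s + ?A)" if "i < eval a w e" for i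
    using Sum.prems that a
    by (intro Sum.IH(2)) (auto split: nat.splits simp: trans_le_add1 intro: order_trans less_imp_le)
  then have "eval (Sum a b) w e \<le> (\<Sum>i<eval a w e. poly (val_bound b) (s + ?A))"
    by (simp only: eval.simps) (rule sum_mono, simp)
  also have "\<dots> \<le> ?A * poly (val_bound b) (s + ?A)" using a by simp
  finally show ?case by (simp add: poly_pcompose)
next
  case (Sym a)
  then show ?case by (simp add: tape_word_def)
next
  case (Add a b)
  then show ?case by (simp add: add_mono)
qed auto

lemma runs_const:
  assumes "2 \<le> d" "d < K"
  shows "runs w K ((Seq (inc d) ^^ k) Skip) (\<sigma>, out) k (\<sigma>(d := \<sigma> d + k), out)"
proof (induction k arbitrary: \<sigma>)
  case 0
  then show ?case by (simp add: runs_Skip)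
next
  case (Suc k)
  have "runs w K (inc d) (\<sigma>, out) 1 (\<sigma>(d := Suc (\<sigma> d)), out)"
    using assms by (intro runs_inc) auto
  from runs_Seq[OF this Suc] show ?case by (simp add: fun_upd_def cong: if_cong)
qed

lemma runs_inc':
  "r < K \<Longrightarrow> r \<noteq> 1 \<Longrightarrow> \<sigma>' = \<sigma>(r := Suc (\<sigma> r)) \<Longrightarrow> runs w K (inc r) (\<sigma>, out) 1 (\<sigma>', out)"
  using runs_inc by blast

lemma runs_dec':
  "r < K \<Longrightarrow> r \<noteq> 1 \<Longrightarrow> 0 < \<sigma> r \<Longrightarrow> \<sigma>' = \<sigma>(r := \<sigma> r - 1) \<Longrightarrow> runs w K (dec r) (\<sigma>, out) 1 (\<sigma>', out)"
  using runs_dec by blast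

text \<open>Counting a counter down destroys it. Its value is therefore moved to \<open>d\<close>
  and to the scratch counter \<open>n\<close> at once, and restored from \<open>n\<close>.\<close>

lemma runs_copy:
  assumes "2 \<le> d" "d < n" "2 \<le> r" "r < n" "r \<noteq> d" "n < K" "\<sigma> n = 0" "\<sigma> r \<le> s"
  shows "runs w K (Seq (countdown r (Seq (inc d) (inc n))) (countdown n (inc r))) (\<sigma>, out) (9 * s + 2)
    (\<sigma>(d := \<sigma> d + \<sigma> r), out)"
proof -
  have 1: "runs w K (countdown r (Seq (inc d) (inc n))) (\<sigma>, out) (5 * s + 1)
      (\<sigma>(d := \<sigma> d + \<sigma> r, n := \<sigma> r, r := 0), out)"
  proof (rule runs_countdown[where g = "\<lambda>i. \<sigma>(d := \<sigma> d + i, n := i)" and ou = "\<lambda>_. out" and k = "\<sigma> r" and n = "1 + 1"])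
    fix i
    show "runs w K (Seq (inc d) (inc n)) ((\<sigma>(d := \<sigma> d + i, n := i))(r := \<sigma> r - Suc i), out) (1 + 1)
        ((\<sigma>(d := \<sigma> d + Suc i, n := Suc i))(r := \<sigma> r - Suc i), out)"
      by (rule runs_Seq[OF runs_inc runs_inc']) (use assms in \<open>auto simp: fun_eq_iff\<close>)
  qed (use assms in \<open>auto simp: fun_eq_iff\<close>)
  have 2: "runs w K (countdown n (inc r)) (\<sigma>(d := \<sigma> d + \<sigma> r, n := \<sigma> r, r := 0), out) (4 * s + 1)
      (\<sigma>(d := \<sigma> d + \<sigma> r), out)"
  proof (rule runs_countdown[where g = "\<lambda>i. \<sigma>(d := \<sigma> d + \<sigma> r, r := i)" and ou = "\<lambda>_. out" and k = "\<sigma> r" and n = 1])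
    fix i
    show "runs w K (inc r) ((\<sigma>(d := \<sigma> d + \<sigma> r, r := i))(n := \<sigma> r - Suc i), out) 1
        ((\<sigma>(d := \<sigma> d + \<sigma> r, r := Suc i))(n := \<sigma> r - Suc i), out)"
      by (rule runs_inc') (use assms in \<open>auto simp: fun_eq_iff\<close>)
  qed (use assms in \<open>auto simp: fun_eq_iff\<close>)
  show ?thesis
    by (rule runs_mono[OF runs_Seq[OF 1 2]]) simp
qed

text \<open>Skipping the decrement once counter \<open>n\<close> is zero gives precisely the
  truncated subtraction of \<open>nat\<close>.\<close>

lemma runs_monus:
  assumes "2 \<le> d" "d < n" "n + 1 < K" "\<sigma> n = a" "\<sigma> (n + 1) = b" "a \<le> A" "b \<le> B"
  shows "runs w K (Seq (countdown (n + 1) (Cond n 1 Skip (dec n))) (countdown n (inc d))) (\<sigma>, out)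
    (5 * B + 4 * A + 2) (\<sigma>(d := \<sigma> d + (a - b), n := 0, n + 1 := 0), out)"
proof -
  have 1: "runs w K (countdown (n + 1) (Cond n 1 Skip (dec n))) (\<sigma>, out) (5 * B + 1)
      (\<sigma>(n := a - b, n + 1 := 0), out)"
  proof (rule runs_countdown[where g = "\<lambda>i. \<sigma>(n := a - i)" and ou = "\<lambda>_. out" and k = b and n = "2"])
    fix i
    show "runs w K (Cond n 1 Skip (dec n)) ((\<sigma>(n := a - i))(n + 1 := b - Suc i), out) 2
        ((\<sigma>(n := a - Suc i))(n + 1 := b - Suc i), out)"
    proof (cases "a - i = 0")
      case True
      then have "a - Suc i = a - i" by simp
      then show ?thesis
        using True assms runs_CondT[of w K _ n 1 Skip 0, OF _ runs_Skip] by (simp add: numeral_2_eq_2)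
    next
      case False
      have "runs w K (dec n) ((\<sigma>(n := a - i))(n + 1 := b - Suc i), out) 1
        ((\<sigma>(n := a - Suc i))(n + 1 := b - Suc i), out)"
        by (rule runs_dec') (use assms False in \<open>auto simp: fun_eq_iff\<close>)
      from runs_CondF[OF _ this, of n 1 Skip] show ?thesis
        using False assms by (simp add: numeral_2_eq_2)
    qed
  qed (use assms in \<open>auto simp: fun_eq_iff\<close>)
  have 2: "runs w K (countdown n (inc d)) (\<sigma>(n := a - b, n + 1 := 0), out) (4 * A + 1)
      (\<sigma>(d := \<sigma> d + (a - b), n := 0, n + 1 := 0), out)"
  proof (rule runs_countdown[where g = "\<lambda>i. \<sigma>(d := \<sigma> d + i, n + 1 := 0)" and ou = "\<lambda>_. out" and k = "a - b" and n = 1])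
    fix i
    show "runs w K (inc d) ((\<sigma>(d := \<sigma> d + i, n + 1 := 0))(n := a - b - Suc i), out) 1
        ((\<sigma>(d := \<sigma> d + Suc i, n + 1 := 0))(n := a - b - Suc i), out)"
      by (rule runs_inc') (use assms in \<open>auto simp: fun_eq_iff\<close>)
  qed (use assms in \<open>auto simp: fun_eq_iff\<close>)
  show ?thesis
    by (rule runs_mono[OF runs_Seq[OF 1 2]]) simp
qed

text \<open>The input head itself moves \<open>a\<close> cells to the right, and counter
  \<open>n + 1\<close> remembers how far it must go back. Beyond the word it reads a blank, in
  accordance with \<open>tape_word\<close>.\<close>

lemma runs_symbol:
  assumes "2 \<le> d" "d < n" "n + 1 < K" "\<sigma> n = a" "\<sigma> (n + 1) = 0" "\<sigma> 0 = 0" "a \<le> A"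
  shows "runs w K (Seq (countdown n (Seq (inc (n + 1)) (inc 0)))
     (Seq (Cond 0 1 (inc d) (Cond 0 2 (Seq (inc d) (inc d)) Skip)) (countdown (n + 1) (dec 0)))) (\<sigma>, out)
    (9 * A + 7) (\<sigma>(d := \<sigma> d + tape_word w (int a), n := 0), out)"
proof -
  have 1: "runs w K (countdown n (Seq (inc (n + 1)) (inc 0))) (\<sigma>, out) (5 * A + 1)
      (\<sigma>(n := 0, n + 1 := a, 0 := a), out)"
  proof (rule runs_countdown[where g = "\<lambda>i. \<sigma>(n + 1 := i, 0 := i)" and ou = "\<lambda>_. out" and k = a and n = "1 + 1"])
    fix i
    show "runs w K (Seq (inc (n + 1)) (inc 0)) ((\<sigma>(n + 1 := i, 0 := i))(n := a - Suc i), out) (1 + 1)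
        ((\<sigma>(n + 1 := Suc i, 0 := Suc i))(n := a - Suc i), out)"
      by (rule runs_Seq[OF runs_inc runs_inc']) (use assms in \<open>auto simp: fun_eq_iff\<close>)
  qed (use assms in \<open>auto simp: fun_eq_iff\<close>)
  let ?s = "\<sigma>(n := 0, n + 1 := a, 0 := a)"
  let ?s' = "?s(d := \<sigma> d + tape_word w (int a))"
  have 2: "runs w K (Cond 0 1 (inc d) (Cond 0 2 (Seq (inc d) (inc d)) Skip)) (?s, out) 5 (?s', out)"
  proof -
    consider (0) "tape_word w (int a) = 0" | (1) "tape_word w (int a) = 1" | (2) "tape_word w (int a) = 2"
      using that by (fastforce simp: tape_word_def split: if_splits)
    then show ?thesis
    proof cases
      case 0
      then have eq: "?s' = ?s" using assms by (auto simp: fun_eq_iff)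
      have "runs w K (Cond 0 1 (inc d) (Cond 0 2 (Seq (inc d) (inc d)) Skip)) (?s, out) (0 + 1 + 1) (?s, out)"
        by (intro runs_CondF runs_Skip) (use assms 0 in auto)
      then show ?thesis unfolding eq by (rule runs_mono) simp
    next
      case 1
      have "runs w K (Cond 0 1 (inc d) (Cond 0 2 (Seq (inc d) (inc d)) Skip)) (?s, out) (1 + 2) (?s', out)"
        by (intro runs_CondT runs_inc') (use assms 1 in \<open>auto simp: fun_eq_iff\<close>)
      then show ?thesis by (rule runs_mono) simp
    next
      case 2
      have "runs w K (Cond 0 1 (inc d) (Cond 0 2 (Seq (inc d) (inc d)) Skip)) (?s, out) (1 + 1 + 2 + 1) (?s', out)"
        by (intro runs_CondF runs_CondT runs_Seq[OF runs_inc runs_inc'])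
          (use assms 2 in \<open>auto simp: fun_eq_iff\<close>)
      then show ?thesis by (rule runs_mono) simp
    qed
  qed
  have 3: "runs w K (countdown (n + 1) (dec 0)) (?s', out) (4 * A + 1)
      (\<sigma>(d := \<sigma> d + tape_word w (int a), n := 0), out)"
  proof (rule runs_countdown[where g = "\<lambda>i. ?s'(0 := a - i)" and ou = "\<lambda>_. out" and k = a and n = 1])
    fix i assume "i < a"
    then show "runs w K (dec 0) ((?s'(0 := a - i))(n + 1 := a - Suc i), out) 1
        ((?s'(0 := a - Suc i))(n + 1 := a - Suc i), out)"
      by (intro runs_dec') (use assms in \<open>auto simp: fun_eq_iff\<close>)
  qed (use assms in \<open>auto simp: fun_eq_iff\<close>)
  show ?thesis
    by (rule runs_mono[OF runs_Seq[OF 1 runs_Seq[OF 2 3]]]) simp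
qed

lemma runs_length:
  assumes "2 \<le> d" "d < n" "n < K" "\<sigma> n = 0" "\<sigma> 0 = 0" "length w \<le> s"
  shows "runs w K (Seq (Loop 0 0 (Seq (inc 0) (Seq (inc n) (inc d)))) (countdown n (dec 0))) (\<sigma>, out)
    (9 * s + 2) (\<sigma>(d := \<sigma> d + length w), out)"
proof -
  let ?c = "Seq (inc 0) (Seq (inc n) (inc d))"
  let ?g = "\<lambda>i. \<sigma>(0 := i, n := i, d := \<sigma> d + i)"
  have "runs w K (Loop 0 0 ?c) (?g (length w - j), out) (5 * j + 1) (?g (length w), out)" if "j \<le> length w" for j
    using that
  proof (induction j)
    case 0
    have "runs w K (Loop 0 0 ?c) (?g (length w), out) 1 (?g (length w), out)"
      by (rule runs_LoopEnd) (use assms in \<open>auto simp: tape_word_def\<close>)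
    then show ?case by (simp add: fun_upd_def)
  next
    case (Suc j)
    have "runs w K ?c (?g (length w - Suc j), out) (1 + (1 + 1)) (?g (length w - j), out)"
      by (rule runs_Seq[OF runs_inc runs_Seq[OF runs_inc runs_inc']])
        (use assms Suc.prems in \<open>auto simp: fun_eq_iff\<close>)
    moreover have "runs w K (Loop 0 0 ?c) (?g (length w - j), out) (5 * j + 1) (?g (length w), out)"
      by (rule Suc.IH[OF Suc_leD[OF Suc.prems]])
    ultimately have "runs w K (Loop 0 0 ?c) (?g (length w - Suc j), out) (1 + (1 + 1) + (5 * j + 1) + 2) (?g (length w), out)"
      by (rule runs_LoopStep[rotated]) (use Suc.prems assms in \<open>simp add: tape_word_def\<close>)
    then show ?case by (rule runs_mono) simp
  qed
  from this[of "length w"]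
  have 1: "runs w K (Loop 0 0 ?c) (\<sigma>, out) (5 * length w + 1) (?g (length w), out)"
    using assms by (simp add: fun_upd_idem)
  have 2: "runs w K (countdown n (dec 0)) (?g (length w), out) (4 * s + 1) (\<sigma>(d := \<sigma> d + length w), out)"
  proof (rule runs_countdown[where g = "\<lambda>i. (?g (length w))(0 := length w - i)" and ou = "\<lambda>_. out" and k = "length w" and n = 1])
    fix i assume "i < length w"
    then show "runs w K (dec 0) (((?g (length w))(0 := length w - i))(n := length w - Suc i), out) 1
        (((?g (length w))(0 := length w - Suc i))(n := length w - Suc i), out)"
      by (intro runs_dec') (use assms in \<open>auto simp: fun_eq_iff\<close>)
  qed (use assms in \<open>auto simp: fun_eq_iff\<close>)
  show ?thesis
    by (rule runs_mono[OF runs_Seq[OF 1 2]]) (use assms in simp)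
qed

text \<open>Composability is the point: the input head is at 0 and the counters from
  \<open>n\<close> on are zero, both before and after. Only \<open>d\<close> changes, and since no
  variable lives there, a second operand is evaluated in the same environment.\<close>

lemma runs_compile:
  assumes "2 \<le> d" "d < n" "\<forall>i. 2 \<le> \<rho> i \<and> \<rho> i < n \<and> \<rho> i \<noteq> d" "n + regs t \<le> K" "\<sigma> 0 = 0"
    "\<forall>r\<ge>n. \<sigma> r = 0" "length w \<le> s" "\<forall>i. \<sigma> (\<rho> i) \<le> s"
  shows "runs w K (compile t d n \<rho>) (\<sigma>, out) (poly (time_bound t) s)
    (\<sigma>(d := \<sigma> d + eval t w (\<lambda>i. \<sigma> (\<rho> i))), out)"
  using assms
proof (induction t arbitrary: d n \<rho> \<sigma> s)
  case (Const k)
  then show ?case using runs_const[of d K w k \<sigma> out] by (simp add: fun_upd_def)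
next
  case Var
  then show ?case
    using runs_copy[of d n "\<rho> 0" K \<sigma> s w out] by (simp add: algebra_simps fun_upd_def)
next
  case (Weak t)
  then show ?case
    using Weak.IH[of d n "\<lambda>i. \<rho> (Suc i)" \<sigma> s] by (simp add: fun_upd_def)
next
  case (Add a b)
  let ?A = "eval a w (\<lambda>i. \<sigma> (\<rho> i))" and ?B = "eval b w (\<lambda>i. \<sigma> (\<rho> i))"
  have 1: "runs w K (compile a d n \<rho>) (\<sigma>, out) (poly (time_bound a) s) (\<sigma>(d := \<sigma> d + ?A), out)"
    by (rule Add.IH(1)) (use Add.prems in auto)
  have "runs w K (compile b d n \<rho>) (\<sigma>(d := \<sigma> d + ?A), out) (poly (time_bound b) s)
      ((\<sigma>(d := \<sigma> d + ?A))(d := (\<sigma>(d := \<sigma> d + ?A)) d + eval b w (\<lambda>i. (\<sigma>(d := \<sigma> d + ?A)) (\<rho> i))), out)"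
    by (rule Add.IH(2)) (use Add.prems in auto)
  moreover have "(\<lambda>i. (\<sigma>(d := \<sigma> d + ?A)) (\<rho> i)) = (\<lambda>i. \<sigma> (\<rho> i))"
    using Add.prems by (auto simp: fun_eq_iff)
  ultimately have 2: "runs w K (compile b d n \<rho>) (\<sigma>(d := \<sigma> d + ?A), out) (poly (time_bound b) s)
      (\<sigma>(d := \<sigma> d + (?A + ?B)), out)"
    by (simp add: add.assoc)
  show ?case using runs_Seq[OF 1 2] by (simp add: fun_upd_def)
next
  case (Sub a b)
  let ?A = "eval a w (\<lambda>i. \<sigma> (\<rho> i))" and ?B = "eval b w (\<lambda>i. \<sigma> (\<rho> i))"
  have r: "2 \<le> \<rho> i" "\<rho> i < n" "\<rho> i \<noteq> d" for i using Sub.prems by auto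
  have r': "\<rho> i \<noteq> n" "\<rho> i \<noteq> Suc n" for i using r(2)[of i] by auto
  have "runs w K (compile a n (n + 1) \<rho>) (\<sigma>, out) (poly (time_bound a) s)
      (\<sigma>(n := \<sigma> n + ?A), out)"
    by (rule Sub.IH(1)) (use Sub.prems r r' in \<open>auto simp: less_SucI\<close>)
  then have 1: "runs w K (compile a n (n + 1) \<rho>) (\<sigma>, out) (poly (time_bound a) s) (\<sigma>(n := ?A), out)"
    using Sub.prems by simp
  let ?s = "\<sigma>(n := ?A)"
  have e: "(\<lambda>i. ?s (\<rho> i)) = (\<lambda>i. \<sigma> (\<rho> i))"
    using r' by (auto simp: fun_eq_iff)
  have "runs w K (compile b (n + 1) (n + 2) \<rho>) (?s, out) (poly (time_bound b) s)
      (?s(n + 1 := ?s (n + 1) + eval b w (\<lambda>i. ?s (\<rho> i))), out)"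
    by (rule Sub.IH(2)) (use Sub.prems r r' in \<open>auto simp: less_SucI\<close>)
  then have 2: "runs w K (compile b (n + 1) (n + 2) \<rho>) (?s, out) (poly (time_bound b) s)
      (?s(n + 1 := ?B), out)"
    using Sub.prems by (simp only: e) simp
  have 3: "runs w K (Seq (countdown (n + 1) (Cond n 1 Skip (dec n))) (countdown n (inc d))) (?s(n + 1 := ?B), out)
      (5 * poly (val_bound b) s + 4 * poly (val_bound a) s + 2)
      ((?s(n + 1 := ?B))(d := (?s(n + 1 := ?B)) d + (?A - ?B), n := 0, n + 1 := 0), out)"
    by (rule runs_monus) (use Sub.prems eval_le in auto)
  have 4: "(?s(n + 1 := ?B))(d := (?s(n + 1 := ?B)) d + (?A - ?B), n := 0, n + 1 := 0) =
      \<sigma>(d := \<sigma> d + (?A - ?B))"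
    using Sub.prems by (auto simp: fun_eq_iff)
  show ?case
    using runs_mono[OF runs_Seq[OF 1 runs_Seq[OF 2 3[unfolded 4]]]] by (simp add: fun_upd_def)
next
  case (Sum a b)
  let ?e = "\<lambda>i. \<sigma> (\<rho> i)"
  let ?A = "eval a w ?e" and ?B = "\<lambda>i. eval b w (case_nat i ?e)"
  let ?S = "s + poly (val_bound a) s"
  have r: "2 \<le> \<rho> i" "\<rho> i < n" "\<rho> i \<noteq> d" for i using Sum.prems by auto
  have r': "\<rho> i \<noteq> n" "\<rho> i \<noteq> Suc n" for i using r(2)[of i] by auto
  have A: "?A \<le> poly (val_bound a) s" by (rule eval_le) (use Sum.prems in auto)
  have "runs w K (compile a n (n + 1) \<rho>) (\<sigma>, out) (poly (time_bound a) s)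
      (\<sigma>(n := \<sigma> n + ?A), out)"
    by (rule Sum.IH(1)) (use Sum.prems r r' in \<open>auto simp: less_SucI\<close>)
  then have 1: "runs w K (compile a n (n + 1) \<rho>) (\<sigma>, out) (poly (time_bound a) s) (\<sigma>(n := ?A), out)"
    using Sum.prems by simp
  let ?g = "\<lambda>i. \<sigma>(n + 1 := i, d := \<sigma> d + (\<Sum>j<i. ?B j))"
  let ?c = "Seq (compile b d (n + 2) (case_nat (n + 1) \<rho>)) (inc (n + 1))"
  let ?T = "poly (time_bound b) ?S"
  have 2: "runs w K (countdown n ?c) (\<sigma>(n := ?A), out) (poly (val_bound a) s * (?T + 4) + 1)
      ((?g ?A)(n := 0), out)"
  proof (rule runs_countdown[where g = ?g and ou = "\<lambda>_. out" and k = ?A and n = "?T + 1"])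
    fix i assume i: "i < ?A"
    let ?s = "(?g i)(n := ?A - Suc i)"
    have e: "(\<lambda>j. ?s (case_nat (n + 1) \<rho> j)) = case_nat i ?e"
      using r r' Sum.prems(2) by (auto simp: fun_eq_iff split: nat.splits)
    have "runs w K (compile b d (n + 2) (case_nat (n + 1) \<rho>)) (?s, out) ?T
        (?s(d := ?s d + eval b w (\<lambda>j. ?s (case_nat (n + 1) \<rho> j))), out)"
    proof (rule Sum.IH(2))
      show "\<forall>j. ?s (case_nat (n + 1) \<rho> j) \<le> ?S"
      proof
        fix j
        have "?s (case_nat (n + 1) \<rho> j) = case_nat i ?e j" using e by (simp add: fun_eq_iff)
        also have "\<dots> \<le> ?S" using i A Sum.prems(8) by (auto split: nat.splits simp: trans_le_add1)
        finally show "?s (case_nat (n + 1) \<rho> j) \<le> ?S" .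
      qed
    qed (use Sum.prems r r' in \<open>auto split: nat.splits simp: less_SucI\<close>)
    then have "runs w K (compile b d (n + 2) (case_nat (n + 1) \<rho>)) (?s, out) ?T
        (?s(d := ?s d + ?B i), out)" by (simp only: e)
    then show "runs w K ?c (?s, out) (?T + 1) ((?g (Suc i))(n := ?A - Suc i), out)"
      by (rule runs_Seq[OF _ runs_inc']) (use Sum.prems in \<open>auto simp: fun_eq_iff\<close>)
  next
    show "?A * (?T + 1 + 3) + 1 \<le> poly (val_bound a) s * (?T + 4) + 1"
      using mult_le_mono1[OF A, of "?T + 4"] by (simp add: algebra_simps)
  qed (use Sum.prems in \<open>auto simp: fun_eq_iff\<close>)
  have 3: "runs w K (countdown (n + 1) Skip) ((?g ?A)(n := 0), out) (3 * poly (val_bound a) s + 1)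
      (\<sigma>(d := \<sigma> d + (\<Sum>j<?A. ?B j)), out)"
    by (rule runs_countdown[where g = "\<lambda>i. \<sigma>(d := \<sigma> d + (\<Sum>j<?A. ?B j))" and ou = "\<lambda>_. out"
          and k = ?A and n = 0, OF _ _ runs_Skip])
      (use Sum.prems A in \<open>auto simp: fun_eq_iff\<close>)
  show ?case
    using runs_mono[OF runs_Seq[OF 1 runs_Seq[OF 2 3]]] by (simp add: poly_pcompose algebra_simps fun_upd_def)
next
  case (Sym a)
  let ?A = "eval a w (\<lambda>i. \<sigma> (\<rho> i))"
  have r: "2 \<le> \<rho> i" "\<rho> i < n" "\<rho> i \<noteq> d" for i using Sym.prems by auto
  have r': "\<rho> i \<noteq> n" "\<rho> i \<noteq> Suc n" for i using r(2)[of i] by auto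
  have "runs w K (compile a n (n + 1) \<rho>) (\<sigma>, out) (poly (time_bound a) s)
      (\<sigma>(n := \<sigma> n + ?A), out)"
    by (rule Sym.IH) (use Sym.prems r r' in \<open>auto simp: less_SucI\<close>)
  then have 1: "runs w K (compile a n (n + 1) \<rho>) (\<sigma>, out) (poly (time_bound a) s) (\<sigma>(n := ?A), out)"
    using Sym.prems by simp
  let ?s = "\<sigma>(n := ?A)"
  have 2: "runs w K (Seq (countdown n (Seq (inc (n + 1)) (inc 0)))
     (Seq (Cond 0 1 (inc d) (Cond 0 2 (Seq (inc d) (inc d)) Skip)) (countdown (n + 1) (dec 0)))) (?s, out)
    (9 * poly (val_bound a) s + 7) (?s(d := ?s d + tape_word w (int ?A), n := 0), out)"
    by (rule runs_symbol) (use Sym.prems eval_le in auto)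
  have 3: "?s(d := ?s d + tape_word w (int ?A), n := 0) = \<sigma>(d := \<sigma> d + tape_word w (int ?A))"
    using Sym.prems by (auto simp: fun_eq_iff)
  show ?case
    using runs_mono[OF runs_Seq[OF 1 2[unfolded 3]]] by (simp add: add.assoc fun_upd_def)
next
  case Len
  then show ?case using runs_length[of d n K \<sigma> w s out] by (simp add: algebra_simps fun_upd_def)
qed

lemma wf_com_const: "wf_com K ((Seq (inc d) ^^ k) Skip) \<longleftrightarrow> k = 0 \<or> d < K"
  by (induction k) auto

lemma wf_compile:
  assumes "d < n" "\<forall>i. \<rho> i < n" "n + regs t \<le> K"
  shows "wf_com K (compile t d n \<rho>)"
  using assms
proof (induction t arbitrary: d n \<rho>)
  case (Weak t)
  then show ?case by simp
next
  case (Sub a b)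
  have "wf_com K (compile a n (n + 1) \<rho>)" by (rule Sub.IH(1)) (use Sub.prems in \<open>auto simp: less_SucI\<close>)
  moreover have "wf_com K (compile b (n + 1) (n + 2) \<rho>)"
    by (rule Sub.IH(2)) (use Sub.prems in \<open>auto simp: less_SucI\<close>)
  ultimately show ?case using Sub.prems by auto
next
  case (Sum a b)
  have "wf_com K (compile a n (n + 1) \<rho>)" by (rule Sum.IH(1)) (use Sum.prems in \<open>auto simp: less_SucI\<close>)
  moreover have "wf_com K (compile b d (n + 2) (case_nat (n + 1) \<rho>))"
    by (rule Sum.IH(2)) (use Sum.prems in \<open>auto simp: less_SucI split: nat.splits\<close>)
  ultimately show ?case using Sum.prems by auto
next
  case (Sym a)
  have "wf_com K (compile a n (n + 1) \<rho>)" by (rule Sym.IH) (use Sym.prems in \<open>auto simp: less_SucI\<close>)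
  then show ?case using Sym.prems by auto
qed (auto simp: wf_com_const intro: less_le_trans)

section \<open>From counter programs to polynomial-time functions\<close>

fun init_marks :: "nat \<Rightarrow> com" where
  "init_marks 0 = Skip"
| "init_marks (Suc j) = Seq (init_marks j) (Act (j + 2) (Some 1) Stay)"

lemma wf_init_marks: "j + 2 \<le> K \<Longrightarrow> wf_com K (init_marks j)"
  by (induction j) auto

lemma exec_init_marks:
  assumes "j + 2 \<le> K"
  shows "exec (init_marks j) (snd (init_config \<lparr>num_tapes = K, num_symbols = a, num_states = b, trans = c\<rparr> w)) j
    (map (\<lambda>r. if r = 0 then (0, tape_word w) else if 2 \<le> r \<and> r < j + 2 then (0, mark_tape) else (0, tape_word [])) [0..<K])"
  using assms
proof (induction j)
  case 0
  have "snd (init_config \<lparr>num_tapes = K, num_symbols = a, num_states = b, trans = c\<rparr> w) =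
    map (\<lambda>r. if r = 0 then (0, tape_word w) else if 2 \<le> r \<and> r < 0 + 2 then (0, mark_tape) else (0, tape_word [])) [0..<K]"
    using 0 by (intro nth_equalityI) (auto simp: init_config_def nth_Cons')
  then show ?case by (simp add: exec.Skip del: upt_Suc)
next
  case (Suc j)
  let ?f = "\<lambda>j r. if r = (0::nat) then (0, tape_word w) else if 2 \<le> r \<and> r < j + 2 then (0, mark_tape) else (0, tape_word [])"
  have "tape_word [] = (\<lambda>_. 0)" by (auto simp: tape_word_def)
  then have "(map (?f j) [0..<K])[j + 2 := act_tape (1, Stay) (map (?f j) [0..<K] ! (j + 2))] = map (?f (Suc j)) [0..<K]"
    using Suc.prems by (intro nth_equalityI) (auto simp: nth_list_update mark_tape_def)
  then show ?case
    using exec.Seq[OF Suc.IH exec.Act[of "j + 2" "Some 1" Stay]] Suc.prems by simp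
qed

text \<open>The marks are written first, one step for each of the \<open>K - 2\<close> counters. The
  program may finish earlier than the polynomial says; the remaining steps do nothing because
  halting configurations are fixed points.\<close>

lemma computes_if_runs:
  assumes "wf_com K c" "2 \<le> K"
    "\<And>w. \<exists>\<sigma>. runs w K c (\<lambda>_. 0, []) (poly p (length w)) (\<sigma>, f w)"
  shows "polytime_computable f"
proof -
  let ?c = "Seq (init_marks (K - 2)) c"
  let ?M = "machine K (instrs ?c 0)"
  have wf: "wf_com K ?c" using assms wf_init_marks by auto
  have "computes_in_time ?M f (poly ([:K:] + p))"
    unfolding computes_in_time_def
  proof (intro conjI allI)
    show "wf_tm ?M" using wf assms(2) by (rule wf_machine)
    fix w
    obtain \<sigma> t where t: "t \<le> poly p (length w)"
      "exec c (counter_tapes w K (\<lambda>_. 0, [])) t (counter_tapes w K (\<sigma>, f w))"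
      using assms(3)[of w] by (auto simp: runs_def)
    have "exec (init_marks (K - 2)) (snd (init_config ?M w)) (K - 2) (counter_tapes w K (\<lambda>_. 0, []))"
    proof -
      have "counter_tapes w K (\<lambda>_. 0, []) = (map (\<lambda>r. if r = 0 then (0, tape_word w)
         else if 2 \<le> r \<and> r < K - 2 + 2 then (0, mark_tape) else (0, tape_word [])) [0..<K])"
        using assms(2) by (auto simp: counter_tapes_def)
      then show ?thesis
        using exec_init_marks[of "K - 2" K] assms(2) by (simp add: machine_def)
    qed
    from exec.Seq[OF this t(2)]
    have e: "exec ?c (snd (init_config ?M w)) (K - 2 + t) (counter_tapes w K (\<sigma>, f w))" .
    have "(step_tm ?M ^^ (K - 2 + t)) (length ([]::instr list), snd (init_config ?M w)) =
        (length ([]::instr list) + com_len ?c, counter_tapes w K (\<sigma>, f w))"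
      by (rule exec_machine[OF e wf, where post = "[]"])
        (use assms(2) in \<open>auto simp: init_config_def machine_def\<close>)
    moreover have "fst (init_config ?M w) = 0" by (simp add: init_config_def)
    ultimately have 1: "(step_tm ?M ^^ (K - 2 + t)) (init_config ?M w) = (com_len ?c, counter_tapes w K (\<sigma>, f w))"
      by (metis add_0 list.size(3) prod.collapse)
    have halt: "num_states ?M = com_len ?c" by (simp add: machine_def)
    have "step_tm ?M (com_len ?c, ts) = (com_len ?c, ts)" for ts
      by (simp only: step_tm.simps halt if_True refl)
    then have "(step_tm ?M ^^ n) (com_len ?c, ts) = (com_len ?c, ts)" for n ts
      by (induction n) (simp_all del: com_len.simps instrs.simps)
    from funpow_trans[OF 1 this, of "poly ([:K:] + p) (length w) - (K - 2 + t)"] t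
    have "(step_tm ?M ^^ poly ([:K:] + p) (length w)) (init_config ?M w) =
        (com_len ?c, counter_tapes w K (\<sigma>, f w))"
      by simp
    then show "case (step_tm ?M ^^ poly ([:K:] + p) (length w)) (init_config ?M w) of
        (q, ts) \<Rightarrow> q = num_states ?M \<and> snd (ts ! 1) = tape_word (f w)"
      using assms(2) halt by (simp add: counter_tapes_def)
  qed
  then show ?thesis unfolding polytime_computable_def by blast
qed

text \<open>The value goes to counter 2. All free variables are mapped to counter 3, which stays
  zero and so represents the zero environment.\<close>

lemma polytime_nonzero: "polytime_computable (\<lambda>w. [eval t w (\<lambda>_. 0) \<noteq> 0])"
proof (rule computes_if_runs)
  let ?K = "4 + regs t"
  let ?c = "Seq (compile t 2 4 (\<lambda>_. 3)) (Cond 2 1 (emit False) (emit True))"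
  show "wf_com ?K ?c" by (auto intro: wf_compile)
  fix w
  have 1: "runs w ?K (compile t 2 4 (\<lambda>_. 3)) (\<lambda>_. 0, []) (poly (time_bound t) (length w))
      ((\<lambda>_. 0)(2 := 0 + eval t w (\<lambda>_. 0)), [])"
    using runs_compile[of 2 4 "\<lambda>_. 3" t ?K "\<lambda>_. 0" w "length w" "[]"] by simp
  have 2: "runs w ?K (Cond 2 1 (emit False) (emit True)) ((\<lambda>_. 0)(2 := v), []) 3 ((\<lambda>_. 0)(2 := v), [v \<noteq> 0])" for v
  proof (cases "v = 0")
    case True
    then show ?thesis using runs_CondT[OF _ runs_emit, of w ?K "\<lambda>_. 0" "[]" 2 1 False "emit True"]
      by (simp add: fun_upd_idem numeral_3_eq_3)
  next
    case False
    then show ?thesis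
      using runs_mono[OF runs_CondF[OF _ runs_emit, of w ?K "(\<lambda>_. 0)(2 := v)" "[]" 2 1 "emit False" True], of 3]
      by simp
  qed
  show "\<exists>\<sigma>. runs w ?K ?c (\<lambda>_. 0, []) (poly (time_bound t + [:3:]) (length w)) (\<sigma>, [eval t w (\<lambda>_. 0) \<noteq> 0])"
    using runs_Seq[OF 1 2] by auto
qed simp

text \<open>Counter 2 counts the remaining entries, 3 is the index, 4 receives the current entry and
  is emptied while the entry is written in unary, and 5 is the constant zero for the outer
  variables.\<close>

lemma polytime_unary_list:
  "polytime_computable (\<lambda>w. concat (map unary (map (\<lambda>i. eval b w (case_nat i (\<lambda>_. 0))) [0..<eval a w (\<lambda>_. 0)])))"
proof (rule computes_if_runs)
  let ?K = "6 + max (regs a) (regs b)"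
  let ?c2 = "Seq (compile b 4 6 (case_nat 3 (\<lambda>_. 5))) (Seq (countdown 4 (emit True)) (Seq (emit False) (inc 3)))"
  let ?c = "Seq (compile a 2 6 (\<lambda>_. 5)) (countdown 2 ?c2)"
  have "wf_com ?K (compile a 2 6 (\<lambda>_. 5))" by (rule wf_compile) auto
  moreover have "wf_com ?K (compile b 4 6 (case_nat 3 (\<lambda>_. 5)))"
    by (rule wf_compile) (auto split: nat.splits)
  ultimately show "wf_com ?K ?c" by auto
  fix w
  let ?A = "eval a w (\<lambda>_. 0)" and ?B = "\<lambda>i. eval b w (case_nat i (\<lambda>_. 0))"
  let ?l = "length w"
  let ?P = "poly (val_bound a) ?l"
  let ?T = "poly (time_bound b) (?l + ?P) + (4 * poly (val_bound b) (?l + ?P) + 1 + (1 + 1))"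
  have A: "?A \<le> ?P" by (rule eval_le) auto
  have 1: "runs w ?K (compile a 2 6 (\<lambda>_. 5)) (\<lambda>_. 0, []) (poly (time_bound a) ?l)
      ((\<lambda>_. 0)(2 := 0 + ?A), [])"
    using runs_compile[of 2 6 "\<lambda>_. 5" a ?K "\<lambda>_. 0" w ?l "[]"] by simp
  let ?g = "\<lambda>i. (\<lambda>_::nat. 0::nat)(3 := i)"
  let ?o = "\<lambda>i. concat (map unary (map ?B [0..<i]))"
  have 2: "runs w ?K (countdown 2 ?c2) ((\<lambda>_. 0)(2 := 0 + ?A), []) (?A * (?T + 3) + 1) ((?g ?A)(2 := 0), ?o ?A)"
  proof (rule runs_countdown[where g = ?g and ou = ?o and k = ?A and n = ?T])
    fix i assume i: "i < ?A"
    let ?s = "(?g i)(2 := ?A - Suc i)"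
    have e: "(\<lambda>j. ?s (case_nat 3 (\<lambda>_. 5) j)) = case_nat i (\<lambda>_. 0)"
      by (auto simp: fun_eq_iff split: nat.splits)
    have "runs w ?K (compile b 4 6 (case_nat 3 (\<lambda>_. 5))) (?s, ?o i) (poly (time_bound b) (?l + ?P))
        (?s(4 := ?s 4 + eval b w (\<lambda>j. ?s (case_nat 3 (\<lambda>_. 5) j))), ?o i)"
      by (rule runs_compile) (use i A in \<open>auto split: nat.splits\<close>)
    then have 3: "runs w ?K (compile b 4 6 (case_nat 3 (\<lambda>_. 5))) (?s, ?o i) (poly (time_bound b) (?l + ?P))
        (?s(4 := ?B i), ?o i)"
      by (simp only: e) simp
    have B: "?B i \<le> poly (val_bound b) (?l + ?P)"
      by (rule eval_le) (use i A in \<open>auto split: nat.splits\<close>)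
    have 4: "runs w ?K (countdown 4 (emit True)) (?s(4 := ?B i), ?o i) (4 * poly (val_bound b) (?l + ?P) + 1)
        (?s, ?o i @ replicate (?B i) True)"
    proof (rule runs_countdown[where g = "\<lambda>_. ?s" and ou = "\<lambda>j. ?o i @ replicate j True" and k = "?B i" and n = 1])
      fix j
      show "runs w ?K (emit True) (?s(4 := ?B i - Suc j), ?o i @ replicate j True) 1
          (?s(4 := ?B i - Suc j), ?o i @ replicate (Suc j) True)"
        using runs_emit[of ?K w True "?s(4 := ?B i - Suc j)" "?o i @ replicate j True"]
        by (simp add: replicate_append_same)
    qed (use B in \<open>auto simp: fun_eq_iff\<close>)
    have 5: "runs w ?K (Seq (emit False) (inc 3)) (?s, ?o i @ replicate (?B i) True) (1 + 1)
        ((?g (Suc i))(2 := ?A - Suc i), (?o i @ replicate (?B i) True) @ [False])"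
      by (rule runs_Seq[OF _ runs_inc'])
        (use runs_emit[of ?K w False ?s "?o i @ replicate (?B i) True"] in \<open>auto simp: fun_eq_iff\<close>)
    show "runs w ?K ?c2 (?s, ?o i) ?T ((?g (Suc i))(2 := ?A - Suc i), ?o (Suc i))"
      using runs_Seq[OF 3 runs_Seq[OF 4 5]] by (simp add: unary_def)
  qed (auto simp: fun_eq_iff)
  have "?A * (?T + 3) + 1 \<le> ?P * (?T + 3) + 1" using A by simp
  then have "runs w ?K ?c (\<lambda>_. 0, []) (poly (time_bound a + val_bound a *
      (pcompose (time_bound b) ([:0,1:] + val_bound a) + [:4:] * pcompose (val_bound b) ([:0,1:] + val_bound a) + [:6:]) + [:1:]) ?l)
      ((?g ?A)(2 := 0), ?o ?A)"
    by (intro runs_mono[OF runs_Seq[OF 1 2]]) (simp add: poly_pcompose algebra_simps)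
  then show "\<exists>\<sigma>. runs w ?K ?c (\<lambda>_. 0, []) (poly (time_bound a + val_bound a *
      (pcompose (time_bound b) ([:0,1:] + val_bound a) + [:4:] * pcompose (val_bound b) ([:0,1:] + val_bound a) + [:6:]) + [:1:]) ?l)
      (\<sigma>, ?o ?A)" by blast
qed simp

section \<open>Definable functions and predicates\<close>

text \<open>With constants in place of \<open>e 0\<close> and \<open>\<lambda>i. e (Suc i)\<close>
  the introduction rules are directed by syntax: a bound variable shows up as \<open>top_var\<close>
  below some \<open>pop_var\<close>, and each \<open>pop_var\<close> is removed by a weakening rule
  without guessing by higher-order unification.\<close>

definition top_var :: "(nat \<Rightarrow> nat) \<Rightarrow> nat" where "top_var e = e 0"
definition pop_var :: "(nat \<Rightarrow> nat) \<Rightarrow> nat \<Rightarrow> nat" where "pop_var e = (\<lambda>i. e (Suc i))"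

lemma top_var_case [simp]: "top_var (case_nat i e) = i" by (simp add: top_var_def)
lemma pop_var_case [simp]: "pop_var (case_nat i e) = e" by (simp add: pop_var_def)

text \<open>Terms are never written by hand. Functions are stated in HOL, and closure rules
  following their shape show that some term exists.\<close>

definition definable :: "(bool list \<Rightarrow> (nat \<Rightarrow> nat) \<Rightarrow> nat) \<Rightarrow> bool" where
  "definable f \<longleftrightarrow> (\<exists>t. \<forall>w e. f w e = eval t w e)"

definition definable_pred :: "(bool list \<Rightarrow> (nat \<Rightarrow> nat) \<Rightarrow> bool) \<Rightarrow> bool" where
  "definable_pred P \<longleftrightarrow> definable (\<lambda>w e. of_bool (P w e))"

lemma definable_const: "definable (\<lambda>w e. k)"
  unfolding definable_def by (rule exI[of _ "Const k"]) simp

lemma definable_var: "definable (\<lambda>w e. top_var e)"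
  unfolding definable_def by (rule exI[of _ Var]) (simp add: top_var_def)

lemma definable_weak: "definable f \<Longrightarrow> definable (\<lambda>w e. f w (pop_var e))"
  unfolding definable_def
proof (erule exE)
  fix t assume "\<forall>w e. f w e = eval t w e"
  then show "\<exists>t. \<forall>w e. f w (pop_var e) = eval t w e"
    by (intro exI[of _ "Weak t"]) (simp add: pop_var_def)
qed

lemma definable_pred_weak: "definable_pred P \<Longrightarrow> definable_pred (\<lambda>w e. P w (pop_var e))"
  unfolding definable_pred_def by (rule definable_weak)

lemma definable_add: "definable f \<Longrightarrow> definable g \<Longrightarrow> definable (\<lambda>w e. f w e + g w e)"
  unfolding definable_def by (elim exE, rule_tac x = "Add t ta" in exI) simp

lemma definable_diff: "definable f \<Longrightarrow> definable g \<Longrightarrow> definable (\<lambda>w e. f w e - g w e)"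
  unfolding definable_def by (elim exE, rule_tac x = "Sub t ta" in exI) simp

lemma definable_length: "definable (\<lambda>w e. length w)"
  unfolding definable_def by (rule exI[of _ Len]) simp

lemma definable_symbol: "definable f \<Longrightarrow> definable (\<lambda>w e. tape_word w (int (f w e)))"
  unfolding definable_def by (elim exE, rule_tac x = "Sym t" in exI) simp

lemma definable_sum:
  assumes "definable a" "definable (\<lambda>w e. b w (pop_var e) (top_var e))"
  shows "definable (\<lambda>w e. \<Sum>i<a w e. b w e i)"
proof -
  obtain t where t: "a w e = eval t w e" for w e using assms(1) unfolding definable_def by blast
  obtain s where s: "b w (pop_var e) (top_var e) = eval s w e" for w e
    using assms(2) unfolding definable_def by blast
  have "b w e i = eval s w (case_nat i e)" for w e i using s[of w "case_nat i e"] by simp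
  then show ?thesis
    unfolding definable_def using t by (intro exI[of _ "Sum t s"]) simp
qed

lemma definable_mult:
  assumes "definable f" "definable g" shows "definable (\<lambda>w e. f w e * g w e)"
proof -
  have "definable (\<lambda>w e. \<Sum>i<f w e. g w e)"
    by (rule definable_sum[OF assms(1) definable_weak[OF assms(2)]])
  then show ?thesis by simp
qed

lemma definable_Suc: "definable f \<Longrightarrow> definable (\<lambda>w e. Suc (f w e))"
  using definable_add[OF _ definable_const[of 1], of f] by simp

lemma definable_of_bool: "definable_pred P \<Longrightarrow> definable (\<lambda>w e. of_bool (P w e))"
  by (simp add: definable_pred_def)

lemma definable_poly: "definable f \<Longrightarrow> definable (\<lambda>w e. poly p (f w e))"
  by (induction p) (auto intro: definable_const definable_add definable_mult)

lemma definable_pred_const: "definable_pred (\<lambda>w e. b)"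
  unfolding definable_pred_def by (rule definable_const)

lemma definable_pred_le:
  assumes "definable f" "definable g" shows "definable_pred (\<lambda>w e. f w e \<le> g w e)"
proof -
  have "(\<lambda>w e. of_bool (f w e \<le> g w e)) = (\<lambda>w e. 1 - (f w e - g w e))"
    by (auto simp: fun_eq_iff)
  then show ?thesis
    unfolding definable_pred_def using assms by (simp add: definable_diff definable_const)
qed

lemma definable_pred_less: "definable f \<Longrightarrow> definable g \<Longrightarrow> definable_pred (\<lambda>w e. f w e < g w e)"
  unfolding Suc_le_eq[symmetric] by (intro definable_pred_le definable_Suc)

lemma definable_pred_not:
  assumes "definable_pred P" shows "definable_pred (\<lambda>w e. \<not> P w e)"
proof -
  have "(\<lambda>w e. of_bool (\<not> P w e)) = (\<lambda>w e. 1 - of_bool (P w e) :: nat)" by (auto simp: fun_eq_iff)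
  then show ?thesis
    using assms unfolding definable_pred_def by (simp add: definable_diff definable_const)
qed

lemma definable_pred_conj:
  assumes "definable_pred P" "definable_pred Q" shows "definable_pred (\<lambda>w e. P w e \<and> Q w e)"
  using assms unfolding definable_pred_def of_bool_conj by (rule definable_mult)

lemma definable_pred_disj:
  assumes "definable_pred P" "definable_pred Q" shows "definable_pred (\<lambda>w e. P w e \<or> Q w e)"
proof -
  have "definable_pred (\<lambda>w e. \<not> (\<not> P w e \<and> \<not> Q w e))"
    using assms by (intro definable_pred_not definable_pred_conj)
  then show ?thesis by simp
qed

lemma definable_pred_imp:
  assumes "definable_pred P" "definable_pred Q" shows "definable_pred (\<lambda>w e. P w e \<longrightarrow> Q w e)"
  unfolding imp_conv_disj using assms by (intro definable_pred_disj definable_pred_not)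

lemma definable_pred_iff:
  assumes "definable_pred P" "definable_pred Q" shows "definable_pred (\<lambda>w e. P w e \<longleftrightarrow> Q w e)"
  unfolding iff_conv_conj_imp using assms by (intro definable_pred_conj definable_pred_imp)

lemma definable_pred_eq:
  assumes "definable f" "definable g" shows "definable_pred (\<lambda>w e. f w e = g w e)"
  unfolding order_eq_iff using assms by (intro definable_pred_conj definable_pred_le)

declare sum_of_bool_eq [simp del]

lemma sum_of_bool_pos: "0 < (\<Sum>i<n::nat. of_bool (P i) :: nat) \<longleftrightarrow> (\<exists>i<n. P i)"
  by (induction n) (auto simp: less_Suc_eq)

lemma definable_pred_ex:
  assumes "definable a" "definable_pred (\<lambda>w e. P w (pop_var e) (top_var e))"
  shows "definable_pred (\<lambda>w e. \<exists>i<a w e. P w e i)"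
proof -
  have "definable_pred (\<lambda>w e. 0 < (\<Sum>i<a w e. of_bool (P w e i) :: nat))"
    using assms unfolding definable_pred_def[of "\<lambda>w e. P w (pop_var e) (top_var e)"]
    by (intro definable_pred_less definable_const definable_sum)
  then show ?thesis by (simp only: sum_of_bool_pos)
qed

lemma definable_pred_all:
  assumes "definable a" "definable_pred (\<lambda>w e. P w (pop_var e) (top_var e))"
  shows "definable_pred (\<lambda>w e. \<forall>i<a w e. P w e i)"
proof -
  have "definable_pred (\<lambda>w e. \<not> (\<exists>i<a w e. \<not> P w e i))"
    using assms by (intro definable_pred_not definable_pred_ex)
  then show ?thesis by simp
qed

lemma definable_if:
  assumes "definable_pred P" "definable f" "definable g"
  shows "definable (\<lambda>w e. if P w e then f w e else g w e)"
proof -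
  have "definable (\<lambda>w e. of_bool (P w e) * f w e + of_bool (\<not> P w e) * g w e)"
    using assms by (intro definable_add definable_mult definable_of_bool definable_pred_not)
  moreover have "(\<lambda>w e. of_bool (P w e) * f w e + of_bool (\<not> P w e) * g w e) =
      (\<lambda>w e. if P w e then f w e else g w e)" by (auto simp: fun_eq_iff)
  ultimately show ?thesis by simp
qed

text \<open>The list is fixed, independent of the word, so this is a finite conjunction; it serves
  for the finitely many clause schemes of a fixed machine.\<close>

lemma definable_pred_ball_list:
  assumes "\<And>s. s \<in> set l \<Longrightarrow> definable_pred (P s)"
  shows "definable_pred (\<lambda>w e. \<forall>s\<in>set l. P s w e)"
  using assms by (induction l) (auto intro!: definable_pred_conj definable_pred_const)

lemma definable_pred_bex_list:
  assumes "\<And>s. s \<in> set l \<Longrightarrow> definable_pred (P s)"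
  shows "definable_pred (\<lambda>w e. \<exists>s\<in>set l. P s w e)"
  using assms by (induction l) (auto intro!: definable_pred_disj definable_pred_const)

lemmas definable_intros =
  definable_add definable_diff definable_mult definable_Suc definable_length definable_symbol
  definable_sum definable_of_bool definable_poly definable_if
  definable_pred_le definable_pred_less definable_pred_eq definable_pred_not
  definable_pred_conj definable_pred_disj definable_pred_imp definable_pred_iff
  definable_pred_ex definable_pred_all definable_pred_const definable_const
  definable_var definable_weak definable_pred_weak

lemma polytime_decidable_definable:
  assumes "definable_pred (\<lambda>w e. P w)"
  shows "polytime_decidable {w. P w}"
proof -
  obtain t where "\<forall>w e. of_bool (P w) = eval t w e"
    using assms unfolding definable_pred_def definable_def by blast
  then have "(\<lambda>w. [w \<in> {w. P w}]) = (\<lambda>w. [eval t w (\<lambda>_. 0) \<noteq> 0])"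
    by (intro ext) (simp flip: \<open>\<forall>w e. of_bool (P w) = eval t w e\<close>[rule_format])
  then show ?thesis
    unfolding polytime_decidable_def by (simp only: polytime_nonzero)
qed

lemma polytime_computable_definable:
  assumes "definable (\<lambda>w e. a w)" "definable (\<lambda>w e. b w (top_var e))"
  shows "polytime_computable (\<lambda>w. concat (map unary (map (b w) [0..<a w])))"
proof -
  obtain t where t: "a w = eval t w e" for w e using assms(1) unfolding definable_def by blast
  obtain s where "b w (top_var e) = eval s w e" for w e
    using assms(2) unfolding definable_def by blast
  from this[where e = "case_nat i (\<lambda>_. 0)" for i]
  have s: "b w i = eval s w (case_nat i (\<lambda>_. 0))" for w i by simp
  have "(\<lambda>w. concat (map unary (map (b w) [0..<a w]))) =
      (\<lambda>w. concat (map unary (map (\<lambda>i. eval s w (case_nat i (\<lambda>_. 0))) [0..<eval t w (\<lambda>_. 0)])))"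
    by (intro ext) (simp flip: s t)
  then show ?thesis using polytime_unary_list by simp
qed

section \<open>Puzzles in NP\<close>

text \<open>A solution is certified by the history of the grid, two bits for every cell and every time.\<close>

lemma tape_word_Cons: "tape_word (b # x) (int (Suc i)) = tape_word x (int i)"
  by (simp add: tape_word_def nat_add_distrib)

lemma tape_word_1: "i < length x \<Longrightarrow> tape_word x (int i) = 1 \<Longrightarrow> \<not> x ! i"
  by (auto simp: tape_word_def)

lemma pair_word_Cons: "pair_word (b # x) u = True # b # pair_word x u"
  by (simp add: pair_word_def)

lemma length_pair_word: "length (pair_word x u) = 2 * length x + 1 + length u"
  by (induction x) (auto simp: pair_word_Cons, simp add: pair_word_def)

lemma pair_word_flag: "j < length x \<Longrightarrow> tape_word (pair_word x u) (int (2 * j)) = 2"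
proof (induction x arbitrary: j)
  case (Cons b x)
  then show ?case
    by (cases j) (simp_all add: pair_word_Cons tape_word_Cons del: of_nat_Suc of_nat_mult, simp add: tape_word_def)
qed simp

lemma pair_word_sep: "tape_word (pair_word x u) (int (2 * length x)) = 1"
proof (induction x)
  case (Cons b x)
  then show ?case by (simp add: pair_word_Cons tape_word_Cons del: of_nat_Suc of_nat_mult)
qed (simp add: tape_word_def pair_word_def)

lemma pair_word_fst: "j < length x \<Longrightarrow> tape_word (pair_word x u) (int (2 * j + 1)) = tape_word x (int j)"
proof (induction x arbitrary: j)
  case (Cons b x)
  then show ?case
    by (cases j) (simp_all add: pair_word_Cons tape_word_Cons del: of_nat_Suc of_nat_mult, simp add: tape_word_def)
qed simp

lemma pair_word_snd: "tape_word (pair_word x u) (int (2 * length x + 1 + i)) = tape_word u (int i)"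
proof (induction x)
  case Nil
  show ?case by (simp add: pair_word_def tape_word_Cons del: of_nat_Suc)
next
  case (Cons b x)
  then show ?case by (simp add: pair_word_Cons tape_word_Cons del: of_nat_Suc of_nat_mult of_nat_add)
qed

text \<open>The length of the first component of a pair. Position \<open>i\<close> counts if the
  even positions up to \<open>2 * i\<close> all hold the bit 1, which is symbol 2; the separator is
  the first even position with the bit 0.\<close>

definition fst_length :: "bool list \<Rightarrow> nat" where
  "fst_length z = (\<Sum>i<length z. of_bool (\<forall>j<Suc i. tape_word z (int (2 * j)) = 2))"

lemma fst_length_pair: "fst_length (pair_word x u) = length x"
proof -
  have "(\<forall>j<Suc i. tape_word (pair_word x u) (int (2 * j)) = 2) \<longleftrightarrow> i < length x" for i
    using pair_word_flag pair_word_sep[of x u] by (metis less_Suc_eq_le less_le_trans not_le numeral_eq_one_iff semiring_norm(85))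
  then have "fst_length (pair_word x u) = (\<Sum>i<length (pair_word x u). of_bool (i < length x))"
    unfolding fst_length_def by simp
  also have "\<dots> = card ({..<length (pair_word x u)} \<inter> {i. i < length x})"
    by (subst sum_of_bool_eq) auto
  also have "{..<length (pair_word x u)} \<inter> {i. i < length x} = {..<length x}"
    by (auto simp: length_pair_word)
  finally show ?thesis by simp
qed

text \<open>The 1-bits of the first component that are preceded by exactly \<open>k\<close> 0-bits.
  In a concatenation of unary numbers their number is the entry with index \<open>k\<close>,
  obtained by counting instead of scanning.\<close>

definition field :: "bool list \<Rightarrow> nat \<Rightarrow> nat" where
  "field z k = (\<Sum>i<fst_length z. of_bool (tape_word z (int (2 * i + 1)) = 2 \<and>
     (\<Sum>j<i. of_bool (tape_word z (int (2 * j + 1)) = 1)) = k))"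

definition num_fields :: "bool list \<Rightarrow> nat" where
  "num_fields z = (\<Sum>i<fst_length z. of_bool (tape_word z (int (2 * i + 1)) = 1))"

lemma sum_lessThan_add: "(\<Sum>i<m + n::nat. f i) = (\<Sum>i<m. f i) + (\<Sum>i<n. f (m + i) :: nat)"
  by (induction n) auto

lemma field_pair:
  "field (pair_word x u) k = (\<Sum>i<length x. of_bool (x ! i \<and> (\<Sum>j<i. of_bool (\<not> x ! j)) = k))"
  unfolding field_def fst_length_pair
proof (rule sum.cong[OF refl])
  fix i assume "i \<in> {..<length x}"
  then have i: "i < length x" by simp
  have "(\<Sum>j<i. of_bool (tape_word (pair_word x u) (int (2 * j + 1)) = 1)) = (\<Sum>j<i. of_bool (\<not> x ! j) :: nat)"
    by (rule sum.cong[OF refl], subst pair_word_fst) (use i in \<open>auto simp: tape_word_def\<close>)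
  moreover have "tape_word (pair_word x u) (int (2 * i + 1)) = tape_word x (int i)"
    using i by (rule pair_word_fst)
  ultimately show "of_bool (tape_word (pair_word x u) (int (2 * i + 1)) = 2 \<and>
     (\<Sum>j<i. of_bool (tape_word (pair_word x u) (int (2 * j + 1)) = 1)) = k) =
     (of_bool (x ! i \<and> (\<Sum>j<i. of_bool (\<not> x ! j)) = k) :: nat)"
    using i by (simp only:) (simp add: tape_word_def)
qed

lemma num_fields_pair: "num_fields (pair_word x u) = (\<Sum>i<length x. of_bool (\<not> x ! i))"
  unfolding num_fields_def fst_length_pair
  by (rule sum.cong[OF refl], subst pair_word_fst) (auto simp: tape_word_def)

lemma nth_unary_append: "(unary a @ y) ! i = (if i < a then True else if i = a then False else y ! (i - Suc a))"
  by (auto simp: unary_def nth_append)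

lemma falses_unary_append:
  "(\<Sum>j<i. of_bool (\<not> (unary a @ y) ! j)) =
    (if i \<le> a then 0 else Suc (\<Sum>j<i - Suc a. of_bool (\<not> y ! j)) :: nat)"
proof (cases "i \<le> a")
  case True
  then show ?thesis by (simp add: nth_unary_append)
next
  case False
  then obtain k where i: "i = Suc a + k" by (metis le_add_diff_inverse not_less_eq_eq)
  show ?thesis unfolding i sum_lessThan_add by (simp add: nth_unary_append)
qed

lemma num_fields_concat: "num_fields (pair_word (concat (map unary xs)) u) = length xs"
  unfolding num_fields_pair
proof (induction xs)
  case (Cons a xs)
  have "length (unary a @ concat (map unary xs)) = Suc a + length (concat (map unary xs))"
    by (simp add: unary_def)
  then show ?case using Cons by (simp add: falses_unary_append)
qed simp

lemma field_concat: "k < length xs \<Longrightarrow> field (pair_word (concat (map unary xs)) u) k = xs ! k"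
  unfolding field_pair
proof (induction xs arbitrary: k)
  case (Cons a xs)
  let ?y = "concat (map unary xs)"
  have l: "length (unary a @ ?y) = Suc a + length ?y" by (simp add: unary_def)
  have f: "(\<Sum>j<Suc a + i. of_bool (\<not> (unary a @ ?y) ! j)) = Suc (\<Sum>j<i. of_bool (\<not> ?y ! j))" for i
    by (subst falses_unary_append) simp
  have g: "(unary a @ ?y) ! (Suc a + i) = ?y ! i" for i
    by (simp add: nth_unary_append)
  have "(\<Sum>i<Suc a. of_bool ((unary a @ ?y) ! i \<and> (\<Sum>j<i. of_bool (\<not> (unary a @ ?y) ! j)) = k)) =
      (\<Sum>i<Suc a. of_bool (i < a \<and> k = 0) :: nat)"
    by (rule sum.cong) (auto simp: nth_unary_append falses_unary_append)
  also have "\<dots> = card ({..<Suc a} \<inter> {i. i < a \<and> k = 0})"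
    by (subst sum_of_bool_eq) auto
  also have "{..<Suc a} \<inter> {i. i < a \<and> k = 0} = (if k = 0 then {..<a} else {})"
    by auto
  finally have 1: "(\<Sum>i<Suc a. of_bool ((unary a @ ?y) ! i \<and> (\<Sum>j<i. of_bool (\<not> (unary a @ ?y) ! j)) = k)) =
      (if k = 0 then a else 0 :: nat)"
    by simp
  have 2: "(\<Sum>i<length ?y. of_bool ((unary a @ ?y) ! (Suc a + i) \<and> (\<Sum>j<Suc a + i. of_bool (\<not> (unary a @ ?y) ! j)) = k))
      = (if k = 0 then 0 else xs ! (k - 1))"
    unfolding f g using Cons by (cases k) auto
  show ?case
    by (simp only: list.map concat.simps l sum_lessThan_add[of _ "Suc a" "length ?y"] 1 2) (simp add: nth_Cons')
qed simp

lemma unary_Suc: "unary (Suc a) = True # unary a" and unary_0: "unary 0 = [False]"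
  by (simp_all add: unary_def)

text \<open>This makes the syntax check cheap: a look at the last bit decides whether a nonempty
  word is a list of unary numbers.\<close>

lemma unary_list_exists: "x = [] \<or> \<not> last x \<Longrightarrow> \<exists>xs. x = concat (map unary xs)"
proof (induction x)
  case Nil
  show ?case by (rule exI[of _ "[]"]) simp
next
  case (Cons b x)
  show ?case
  proof (cases b)
    case True
    then have x: "x \<noteq> []" "\<not> last x" using Cons.prems by (auto split: if_splits)
    then obtain xs where xs: "x = concat (map unary xs)" using Cons.IH by blast
    then obtain a ys where "xs = a # ys" using x by (cases xs) auto
    then show ?thesis using xs True by (intro exI[of _ "Suc a # ys"]) (simp add: unary_Suc)
  next
    case False
    have "x = [] \<or> \<not> last x" using Cons.prems by (auto split: if_splits)
    then obtain xs where "x = concat (map unary xs)" using Cons.IH by blast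
    then show ?thesis using False by (intro exI[of _ "0 # xs"]) (simp add: unary_0)
  qed
qed

section \<open>The certificate check as an arithmetic predicate\<close>

definition cell_field :: "bool list \<Rightarrow> nat \<Rightarrow> nat \<Rightarrow> nat" where
  "cell_field z r c = field z (3 + (r * field z 0 + c))"

definition valid_puzzle :: "bool \<Rightarrow> bool list \<Rightarrow> bool" where
  "valid_puzzle ones z \<longleftrightarrow> 0 < fst_length z \<and> tape_word z (int (2 * (fst_length z - 1) + 1)) = 1 \<and>
     num_fields z = 3 + field z 0 * field z 0 \<and> field z 1 < field z 0 \<and> field z 2 < field z 0 \<and>
     cell_field z (field z 1) (field z 2) = 0 \<and>
     (\<forall>r<field z 0. \<forall>c<field z 0. cell_field z r c < field z 0 \<and> (ones \<longrightarrow> cell_field z r c \<le> 1))"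

definition history_bit :: "bool list \<Rightarrow> nat \<Rightarrow> bool" where
  "history_bit z l \<longleftrightarrow> tape_word z (int (2 * fst_length z + 1 + l)) = 2"

text \<open>Each square owns two consecutive bits at each time, the odd one for being numbered, the
  even one for being filled. The number itself is not recorded: a tile keeps its initial number
  until it is used.\<close>

definition numbered_at :: "bool list \<Rightarrow> nat \<Rightarrow> nat \<Rightarrow> nat \<Rightarrow> bool" where
  "numbered_at z \<tau> r c \<longleftrightarrow> history_bit z (((\<tau> * field z 0 + r) * field z 0 + c) * 2 + 1)"

definition unfilled_at :: "bool list \<Rightarrow> nat \<Rightarrow> nat \<Rightarrow> nat \<Rightarrow> bool" where
  "unfilled_at z \<tau> r c \<longleftrightarrow> \<not> numbered_at z \<tau> r c \<and> \<not> history_bit z (((\<tau> * field z 0 + r) * field z 0 + c) * 2)"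

definition on_ray :: "nat \<Rightarrow> nat \<Rightarrow> nat \<Rightarrow> nat \<Rightarrow> nat \<Rightarrow> bool" where
  "on_ray d r c i j \<longleftrightarrow> (d = 0 \<and> i < r \<and> j = c) \<or> (d = 1 \<and> r < i \<and> j = c) \<or>
     (d = 2 \<and> i = r \<and> j < c) \<or> (d = 3 \<and> i = r \<and> c < j)"

definition square_dist :: "nat \<Rightarrow> nat \<Rightarrow> nat \<Rightarrow> nat \<Rightarrow> nat" where
  "square_dist r c i j = (r - i) + (i - r) + ((c - j) + (j - c))"

text \<open>Terms can count but have no lists. Membership in the first \<open>k\<close> unfilled
  squares of a ray is therefore expressed by the number of unfilled squares that are closer.\<close>

definition filled_by :: "bool list \<Rightarrow> nat \<Rightarrow> nat \<Rightarrow> nat \<Rightarrow> nat \<Rightarrow> nat \<Rightarrow> nat \<Rightarrow> bool" where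
  "filled_by z \<tau> d r c i j \<longleftrightarrow> on_ray d r c i j \<and> unfilled_at z \<tau> i j \<and>
     (\<Sum>i'<field z 0. \<Sum>j'<field z 0. of_bool (on_ray d r c i' j' \<and> unfilled_at z \<tau> i' j' \<and>
        square_dist r c i' j' < square_dist r c i j)) < cell_field z r c"

definition move_at :: "bool list \<Rightarrow> nat \<Rightarrow> bool" where
  "move_at z \<tau> \<longleftrightarrow> (\<exists>r<field z 0. \<exists>c<field z 0. \<exists>d<4. numbered_at z \<tau> r c \<and>
     (\<forall>i<field z 0. \<forall>j<field z 0.
        if (i = r \<and> j = c) \<or> filled_by z \<tau> d r c i j
        then \<not> numbered_at z (Suc \<tau>) i j \<and> \<not> unfilled_at z (Suc \<tau>) i j
        else (numbered_at z (Suc \<tau>) i j \<longleftrightarrow> numbered_at z \<tau> i j) \<and>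
             (unfilled_at z (Suc \<tau>) i j \<longleftrightarrow> unfilled_at z \<tau> i j)))"

text \<open>The number of moves is bounded by the length of the word only to bound the quantifier; a
  complete history is longer than any sequence of moves.\<close>

definition certified :: "bool \<Rightarrow> bool list \<Rightarrow> bool" where
  "certified ones z \<longleftrightarrow> valid_puzzle ones z \<and>
     (\<forall>r<field z 0. \<forall>c<field z 0. if cell_field z r c = 0 then unfilled_at z 0 r c else numbered_at z 0 r c) \<and>
     (\<exists>T<Suc (length z). (\<forall>\<tau><T. move_at z \<tau>) \<and> \<not> unfilled_at z T (field z 1) (field z 2))"

lemma if_bool_conv: "(if P then Q else R) \<longleftrightarrow> (P \<longrightarrow> Q) \<and> (\<not> P \<longrightarrow> R)" by simp

lemma definable_fst_length: "definable (\<lambda>w e. fst_length w)"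
  unfolding fst_length_def by (assumption | rule definable_intros)+

lemma definable_field: "definable f \<Longrightarrow> definable (\<lambda>w e. field w (f w e))"
  unfolding field_def by (assumption | rule definable_fst_length definable_intros)+

lemma definable_num_fields: "definable (\<lambda>w e. num_fields w)"
  unfolding num_fields_def by (assumption | rule definable_fst_length definable_intros)+

lemma definable_cell_field: "definable f \<Longrightarrow> definable g \<Longrightarrow> definable (\<lambda>w e. cell_field w (f w e) (g w e))"
  unfolding cell_field_def by (assumption | rule definable_field definable_intros)+

lemma definable_valid_puzzle: "definable_pred (\<lambda>w e. valid_puzzle ones w)"
  unfolding valid_puzzle_def
  by (assumption | rule definable_fst_length definable_num_fields definable_cell_field definable_field definable_intros)+

lemma definable_history_bit: "definable f \<Longrightarrow> definable_pred (\<lambda>w e. history_bit w (f w e))"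
  unfolding history_bit_def by (assumption | rule definable_fst_length definable_intros)+

lemma definable_numbered_at:
  "definable f \<Longrightarrow> definable g \<Longrightarrow> definable h \<Longrightarrow> definable_pred (\<lambda>w e. numbered_at w (f w e) (g w e) (h w e))"
  unfolding numbered_at_def by (assumption | rule definable_history_bit definable_field definable_intros)+

lemma definable_unfilled_at:
  "definable f \<Longrightarrow> definable g \<Longrightarrow> definable h \<Longrightarrow> definable_pred (\<lambda>w e. unfilled_at w (f w e) (g w e) (h w e))"
  unfolding unfilled_at_def
  by (assumption | rule definable_numbered_at definable_history_bit definable_field definable_intros)+

lemma definable_filled_by:
  "definable t \<Longrightarrow> definable d \<Longrightarrow> definable r \<Longrightarrow> definable c \<Longrightarrow> definable i \<Longrightarrow> definable j \<Longrightarrow>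
    definable_pred (\<lambda>w e. filled_by w (t w e) (d w e) (r w e) (c w e) (i w e) (j w e))"
  unfolding filled_by_def on_ray_def square_dist_def
  by (assumption | rule definable_unfilled_at definable_field definable_cell_field definable_intros)+

lemma definable_move_at: "definable f \<Longrightarrow> definable_pred (\<lambda>w e. move_at w (f w e))"
  unfolding move_at_def if_bool_conv
  by (assumption | rule definable_filled_by definable_numbered_at definable_unfilled_at definable_field definable_intros)+

lemma definable_certified: "definable_pred (\<lambda>w e. certified ones w)"
  unfolding certified_def if_bool_conv
  by (assumption | rule definable_valid_puzzle definable_move_at definable_numbered_at
      definable_unfilled_at definable_cell_field definable_field definable_intros)+

section \<open>The squares filled by a move, characterised by counting\<close>

lemma in_take_sorted_iff:
  assumes "sorted_wrt (\<lambda>a b. f a < (f b :: nat)) xs"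
  shows "x \<in> set (take k xs) \<longleftrightarrow> x \<in> set xs \<and> card {y \<in> set xs. f y < f x} < k"
  using assms
proof (induction xs arbitrary: k)
  case (Cons a xs)
  show ?case
  proof (cases k)
    case (Suc k')
    have a: "\<And>y. y \<in> set xs \<Longrightarrow> f a < f y" using Cons.prems by auto
    show ?thesis
    proof (cases "x = a")
      case True
      then have "{y \<in> set (a # xs). f y < f x} = {}" using a by fastforce
      then have "card {y \<in> set (a # xs). f y < f x} = 0" by (simp only: card.empty)
      then show ?thesis using True Suc by (simp only:) simp
    next
      case False
      have "card {y \<in> set (a # xs). f y < f x} = Suc (card {y \<in> set xs. f y < f x})" if "x \<in> set xs"
      proof -
        have "{y \<in> set (a # xs). f y < f x} = insert a {y \<in> set xs. f y < f x}"
          using a that by auto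
        moreover have "a \<notin> {y \<in> set xs. f y < f x}" using a by blast
        ultimately show ?thesis by simp
      qed
      then show ?thesis using False Suc Cons by auto
    qed
  qed simp
qed simp

lemma sorted_ray:
  "sorted_wrt (\<lambda>a b. square_dist (fst s) (snd s) (fst a) (snd a) < square_dist (fst s) (snd s) (fst b) (snd b)) (ray n s d)"
  by (cases s; cases d) (auto simp: sorted_wrt_iff_nth_less rev_nth square_dist_def)

text \<open>Distances grow strictly along a ray, so the position of a square in the filtered list is
  the number of closer unfilled squares.\<close>

lemma closest_unfilled_iff:
  "t \<in> closest_unfilled n g s d k \<longleftrightarrow> t \<in> set (ray n s d) \<and> g t = Unfilled \<and>
    card {t' \<in> set (ray n s d). g t' = Unfilled \<and>
      square_dist (fst s) (snd s) (fst t') (snd t') < square_dist (fst s) (snd s) (fst t) (snd t)} < k"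
proof -
  let ?f = "\<lambda>a. square_dist (fst s) (snd s) (fst a) (snd a)"
  have "sorted_wrt (\<lambda>a b. ?f a < ?f b) (filter (\<lambda>t. g t = Unfilled) (ray n s d))"
    by (rule sorted_wrt_filter[OF sorted_ray])
  from in_take_sorted_iff[OF this] show ?thesis
    unfolding closest_unfilled_def by (simp add: conj_assoc)
qed

lemma closest_unfilled_subset_ray: "closest_unfilled n g s d k \<subseteq> set (ray n s d)"
  by (auto simp: closest_unfilled_iff)

lemma ray_subset_board: "s \<in> board n \<Longrightarrow> set (ray n s d) \<subseteq> board n"
  by (cases s; cases d) (auto simp: board_def)

definition dir_of :: "nat \<Rightarrow> direction" where
  "dir_of d = [Up, Down, Left, Right] ! d"

lemma dir_of_exhaust: "\<exists>k<4. d = dir_of k"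
proof (cases d)
  case Up then show ?thesis by (intro exI[of _ 0]) (simp add: dir_of_def)
next
  case Down then show ?thesis by (intro exI[of _ 1]) (simp add: dir_of_def)
next
  case Left then show ?thesis by (intro exI[of _ 2]) (simp add: dir_of_def)
next
  case Right then show ?thesis by (intro exI[of _ 3]) (simp add: dir_of_def)
qed

lemma on_ray_iff:
  assumes "d < 4" "i < n" "j < n" "r < n" "c < n"
  shows "on_ray d r c i j \<longleftrightarrow> (i, j) \<in> set (ray n (r, c) (dir_of d))"
proof -
  have "d = 0 \<or> d = 1 \<or> d = 2 \<or> d = 3" using assms by auto
  then show ?thesis using assms by (auto simp: on_ray_def dir_of_def)
qed

text \<open>Off the board the grid is \<open>Unfilled\<close>, as in the initial grid of a
  well-formed puzzle and after every move. Hence histories and runs can be compared as whole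
  functions.\<close>

definition grid_at :: "bool list \<Rightarrow> nat \<Rightarrow> grid" where
  "grid_at z \<tau> s = (if s \<in> board (field z 0) then
     (if numbered_at z \<tau> (fst s) (snd s) then Numbered (cell_field z (fst s) (snd s))
      else if unfilled_at z \<tau> (fst s) (snd s) then Unfilled else Blank) else Unfilled)"

lemma sum_of_bool_square:
  "(\<Sum>i<n. \<Sum>j<n. of_bool (P i j)) = card {s. s \<in> board n \<and> P (fst s) (snd s)}"
proof -
  have "(\<Sum>i<n. \<Sum>j<n. of_bool (P i j)) = (\<Sum>s\<in>{..<n} \<times> {..<n}. of_bool (P (fst s) (snd s)))"
    by (simp add: sum.cartesian_product case_prod_beta)
  also have "\<dots> = card (({..<n} \<times> {..<n}) \<inter> {s. P (fst s) (snd s)})"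
    by (subst sum_of_bool_eq) auto
  finally show ?thesis by (simp add: board_def Int_def)
qed

lemma filled_by_iff:
  assumes "d < 4" "i < field z 0" "j < field z 0" "r < field z 0" "c < field z 0"
  shows "filled_by z \<tau> d r c i j \<longleftrightarrow>
    (i, j) \<in> closest_unfilled (field z 0) (grid_at z \<tau>) (r, c) (dir_of d) (cell_field z r c)"
proof -
  let ?n = "field z 0"
  have u: "grid_at z \<tau> s = Unfilled \<longleftrightarrow> unfilled_at z \<tau> (fst s) (snd s)" if "s \<in> board ?n" for s
    using that by (auto simp: grid_at_def unfilled_at_def)
  have sub: "set (ray ?n (r, c) (dir_of d)) \<subseteq> board ?n"
    by (rule ray_subset_board) (use assms in \<open>simp add: board_def\<close>)
  have "{s. s \<in> board ?n \<and> (on_ray d r c (fst s) (snd s) \<and> unfilled_at z \<tau> (fst s) (snd s) \<and>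
        square_dist r c (fst s) (snd s) < square_dist r c i j)} =
      {t' \<in> set (ray ?n (r, c) (dir_of d)). grid_at z \<tau> t' = Unfilled \<and>
      square_dist r c (fst t') (snd t') < square_dist r c i j}"
  proof -
    have "on_ray d r c (fst s) (snd s) \<longleftrightarrow> s \<in> set (ray ?n (r, c) (dir_of d))" if "s \<in> board ?n" for s
      using on_ray_iff[of d "fst s" ?n "snd s" r c] assms that by (auto simp: board_def)
    then show ?thesis using u sub by blast
  qed
  then show ?thesis
    unfolding filled_by_def closest_unfilled_iff sum_of_bool_square
    using on_ray_iff[of d i ?n j r c] u[of "(i, j)"] assms by (simp add: board_def)
qed

lemma move_at_iff: "move_at z \<tau> \<longleftrightarrow> zhed_move (field z 0) (grid_at z \<tau>) (grid_at z (Suc \<tau>))"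
proof
  let ?n = "field z 0"
  assume "move_at z \<tau>"
  then obtain r c d where rcd: "r < ?n" "c < ?n" "d < 4" "numbered_at z \<tau> r c"
    and m: "\<And>i j. i < ?n \<Longrightarrow> j < ?n \<Longrightarrow>
        if (i = r \<and> j = c) \<or> filled_by z \<tau> d r c i j
        then \<not> numbered_at z (Suc \<tau>) i j \<and> \<not> unfilled_at z (Suc \<tau>) i j
        else (numbered_at z (Suc \<tau>) i j \<longleftrightarrow> numbered_at z \<tau> i j) \<and>
             (unfilled_at z (Suc \<tau>) i j \<longleftrightarrow> unfilled_at z \<tau> i j)"
    unfolding move_at_def by blast
  let ?s = "(r, c)" and ?k = "cell_field z r c"
  let ?C = "closest_unfilled ?n (grid_at z \<tau>) ?s (dir_of d) ?k"
  have s: "?s \<in> board ?n" using rcd by (simp add: board_def)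
  have C: "?C \<subseteq> board ?n"
    by (rule order_trans[OF closest_unfilled_subset_ray ray_subset_board[OF s]])
  have "grid_at z (Suc \<tau>) = (\<lambda>t. if t = ?s \<or> t \<in> ?C then Blank else grid_at z \<tau> t)"
  proof
    fix t
    show "grid_at z (Suc \<tau>) t = (if t = ?s \<or> t \<in> ?C then Blank else grid_at z \<tau> t)"
    proof (cases "t \<in> board ?n")
      case True
      then obtain i j where t: "t = (i, j)" "i < ?n" "j < ?n" by (cases t) (auto simp: board_def)
      have f: "filled_by z \<tau> d r c i j \<longleftrightarrow> t \<in> ?C"
        using filled_by_iff[of d i z j r c \<tau>] rcd t by simp
      show ?thesis
      proof (cases "t = ?s \<or> t \<in> ?C")
        case hit: True
        then have "\<not> numbered_at z (Suc \<tau>) i j" "\<not> unfilled_at z (Suc \<tau>) i j"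
          using m[OF t(2,3)] f t(1) by auto
        then show ?thesis using hit True t(1) by (simp add: grid_at_def)
      next
        case miss: False
        then have "numbered_at z (Suc \<tau>) i j = numbered_at z \<tau> i j" "unfilled_at z (Suc \<tau>) i j = unfilled_at z \<tau> i j"
          using m[OF t(2,3)] f t(1) by auto
        then show ?thesis using miss True t(1) by (simp add: grid_at_def)
      qed
    next
      case False
      then show ?thesis using C s by (auto simp: grid_at_def)
    qed
  qed
  moreover have "grid_at z \<tau> ?s = Numbered ?k" using s rcd by (simp add: grid_at_def)
  ultimately show "zhed_move ?n (grid_at z \<tau>) (grid_at z (Suc \<tau>))"
    using zhed_move.intros[OF s, of "grid_at z \<tau>" ?k "dir_of d"] by simp
next
  let ?n = "field z 0"
  assume "zhed_move ?n (grid_at z \<tau>) (grid_at z (Suc \<tau>))"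
  then obtain s d' k where s: "s \<in> board ?n" "grid_at z \<tau> s = Numbered k"
    and g: "grid_at z (Suc \<tau>) = (\<lambda>t. if t = s \<or> t \<in> closest_unfilled ?n (grid_at z \<tau>) s d' k then Blank else grid_at z \<tau> t)"
    by (auto elim: zhed_move.cases)
  obtain r c where rc: "s = (r, c)" "r < ?n" "c < ?n" using s by (cases s) (auto simp: board_def)
  obtain d where d: "d < 4" "d' = dir_of d" using dir_of_exhaust by blast
  have k: "k = cell_field z r c" and nr: "numbered_at z \<tau> r c"
    using s rc by (auto simp: grid_at_def split: if_splits)
  have "if (i = r \<and> j = c) \<or> filled_by z \<tau> d r c i j
        then \<not> numbered_at z (Suc \<tau>) i j \<and> \<not> unfilled_at z (Suc \<tau>) i j
        else (numbered_at z (Suc \<tau>) i j \<longleftrightarrow> numbered_at z \<tau> i j) \<and>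
             (unfilled_at z (Suc \<tau>) i j \<longleftrightarrow> unfilled_at z \<tau> i j)" if ij: "i < ?n" "j < ?n" for i j
  proof -
    let ?C = "closest_unfilled ?n (grid_at z \<tau>) s d' k"
    have f: "filled_by z \<tau> d r c i j \<longleftrightarrow> (i, j) \<in> ?C"
      using filled_by_iff[of d i z j r c \<tau>] rc d k ij by simp
    have b: "(i, j) \<in> board ?n" using ij by (simp add: board_def)
    have e: "grid_at z (Suc \<tau>) (i, j) = (if (i = r \<and> j = c) \<or> (i, j) \<in> ?C then Blank else grid_at z \<tau> (i, j))"
      using fun_cong[OF g, of "(i, j)"] rc by simp
    have u: "unfilled_at z t i j \<Longrightarrow> \<not> numbered_at z t i j" for t by (simp add: unfilled_at_def)
    show ?thesis
    proof (cases "(i = r \<and> j = c) \<or> (i, j) \<in> ?C")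
      case True
      then show ?thesis using e b f by (auto simp: grid_at_def split: if_splits)
    next
      case False
      then have "grid_at z (Suc \<tau>) (i, j) = grid_at z \<tau> (i, j)" unfolding e by (rule if_not_P)
      then show ?thesis
        using False f u b unfolding grid_at_def by (auto split: if_splits)
    qed
  qed
  then show "move_at z \<tau>" unfolding move_at_def using rc d nr by blast
qed

section \<open>Decoding puzzles; soundness and completeness of certificates\<close>

lemma nth_encode:
  assumes "P = \<lparr>side = n, target = t, tiles = f\<rparr>"
  shows "encode_zhed P = concat (map unary ([n, fst t, snd t] @
    map (\<lambda>i. cell_code (f (i div n, i mod n))) [0..<n * n]))"
proof -
  have "List.product [0..<n] [0..<n] = map (\<lambda>i. (i div n, i mod n)) [0..<n * n]"
  proof (rule nth_equalityI)
    fix i assume "i < length (List.product [0..<n] [0..<n])"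
    then have i: "i < n * n" by simp
    then have "0 < n" by (cases n) auto
    then have "i div n < n" "i mod n < n" using i by (auto simp: less_mult_imp_div_less)
    then show "List.product [0..<n] [0..<n] ! i = map (\<lambda>i. (i div n, i mod n)) [0..<n * n] ! i"
      using i by (simp add: product_nth)
  qed simp
  then show ?thesis unfolding encode_zhed_def assms by (simp add: comp_def)
qed

lemma encode_fields:
  fixes P :: zhed and u :: "bool list"
  defines "z \<equiv> pair_word (encode_zhed P) u"
  shows "field z 0 = side P" "field z 1 = fst (target P)" "field z 2 = snd (target P)"
    "num_fields z = 3 + side P * side P"
    "r < side P \<Longrightarrow> c < side P \<Longrightarrow> cell_field z r c = cell_code (tiles P (r, c))"
proof -
  let ?n = "side P"
  let ?xs = "[?n, fst (target P), snd (target P)] @ map (\<lambda>i. cell_code (tiles P (i div ?n, i mod ?n))) [0..<?n * ?n]"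
  have e: "encode_zhed P = concat (map unary ?xs)"
    by (rule nth_encode) simp
  show f: "field z 0 = side P" "field z 1 = fst (target P)" "field z 2 = snd (target P)"
    unfolding z_def e by (subst field_concat; simp)+
  show "num_fields z = 3 + side P * side P"
    unfolding z_def e num_fields_concat by simp
  assume rc: "r < side P" "c < side P"
  then have "r * side P + c < (r + 1) * side P" by simp
  also have "\<dots> \<le> side P * side P" using rc by (intro mult_right_mono) auto
  finally have "r * side P + c < side P * side P" .
  moreover have "(r * side P + c) div side P = r" "(r * side P + c) mod side P = c"
    using rc by auto
  ultimately have "field z (3 + (r * side P + c)) = cell_code (tiles P (r, c))"
    unfolding z_def e by (subst field_concat) (auto simp: nth_append)
  then show "cell_field z r c = cell_code (tiles P (r, c))" by (simp add: cell_field_def f)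
qed

definition puzzle_ok :: "bool \<Rightarrow> zhed \<Rightarrow> bool" where
  "puzzle_ok ones P \<longleftrightarrow> wf_zhed P \<and> (ones \<longrightarrow> ran (tiles P) \<subseteq> {1})"

lemma valid_puzzle_encode:
  assumes "puzzle_ok ones P"
  shows "valid_puzzle ones (pair_word (encode_zhed P) u)"
proof -
  let ?z = "pair_word (encode_zhed P) u"
  let ?x = "encode_zhed P"
  have wf: "wf_zhed P" using assms by (simp add: puzzle_ok_def)
  have l: "fst_length ?z = length ?x" by (rule fst_length_pair)
  have x: "?x \<noteq> [] \<and> \<not> last ?x"
  proof -
    have "xs \<noteq> [] \<Longrightarrow> concat (map unary xs) \<noteq> [] \<and> \<not> last (concat (map unary xs))" for xs
      by (induction xs) (auto simp: unary_def)
    then show ?thesis unfolding encode_zhed_def by blast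
  qed
  have "tape_word ?z (int (2 * (length ?x - 1) + 1)) = tape_word ?x (int (length ?x - 1))"
    using x by (intro pair_word_fst) simp
  also have "\<dots> = 1" using x by (auto simp: tape_word_def last_conv_nth of_nat_diff)
  finally have last: "tape_word ?z (int (2 * (fst_length ?z - 1) + 1)) = 1" unfolding l .
  have t: "fst (target P) < side P" "snd (target P) < side P" "tiles P (target P) = None"
  proof -
    show "fst (target P) < side P" "snd (target P) < side P"
      using wf by (auto simp: wf_zhed_def board_def mem_Times_iff)
    show "tiles P (target P) = None" using wf by (metis not_None_eq wf_zhed_def)
  qed
  have c: "cell_code (tiles P (r, c)) < side P \<and> (ones \<longrightarrow> cell_code (tiles P (r, c)) \<le> 1)"
    if "r < side P" "c < side P" for r c
  proof (cases "tiles P (r, c)")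
    case (Some k)
    then have "k \<le> side P - 1" using wf unfolding wf_zhed_def by blast
    moreover have "ones \<longrightarrow> k = 1" using Some assms by (auto simp: puzzle_ok_def ran_def)
    ultimately show ?thesis using Some that by (auto simp: cell_code_def)
  qed (use that in \<open>auto simp: cell_code_def\<close>)
  show ?thesis
    unfolding valid_puzzle_def
    using last x l t c encode_fields[where P = P and u = u]
    by (simp add: cell_code_def[of None] del: One_nat_def)
qed

text \<open>Soundness concerns arbitrary words, not just codes. A puzzle is rebuilt from the fields,
  with the value 0 read as an empty cell; the last bit and the number of fields leave no other word
  than its code.\<close>

lemma valid_puzzle_decode:
  assumes "valid_puzzle ones (pair_word x u)"
  shows "\<exists>P. puzzle_ok ones P \<and> x = encode_zhed P"
proof -
  let ?z = "pair_word x u"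
  let ?n = "field ?z 0"
  have l: "fst_length ?z = length x" by (rule fst_length_pair)
  have ne: "x \<noteq> []" using assms by (auto simp: valid_puzzle_def l)
  have e1: "tape_word ?z (int (2 * (length x - 1) + 1)) = tape_word x (int (length x - 1))"
    using ne by (intro pair_word_fst) simp
  have e2: "tape_word ?z (int (2 * (length x - 1) + 1)) = 1"
    by (rule conjunct1[OF conjunct2[OF assms[unfolded valid_puzzle_def l]]])
  have "length x - 1 < length x" using ne by simp
  then have "\<not> x ! (length x - 1)" by (rule tape_word_1[OF _ trans[OF e1[symmetric] e2]])
  then have "\<not> last x" using last_conv_nth[OF ne] by simp
  then obtain xs where xs: "x = concat (map unary xs)" using unary_list_exists by blast
  have len: "length xs = 3 + ?n * ?n"
    using assms num_fields_concat[of xs u] by (simp add: valid_puzzle_def xs)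
  have f: "field ?z k = xs ! k" if "k < length xs" for k
    using field_concat[OF that] by (simp add: xs)
  define P where "P = \<lparr>side = ?n, target = (field ?z 1, field ?z 2),
    tiles = (\<lambda>s. if s \<in> board ?n \<and> cell_field ?z (fst s) (snd s) \<noteq> 0
       then Some (cell_field ?z (fst s) (snd s)) else None)\<rparr>"
  have t: "field ?z 1 < ?n" "field ?z 2 < ?n" "cell_field ?z (field ?z 1) (field ?z 2) = 0"
    and bd: "r < ?n \<Longrightarrow> c < ?n \<Longrightarrow> cell_field ?z r c < ?n \<and> (ones \<longrightarrow> cell_field ?z r c \<le> 1)" for r c
    using assms by (simp_all add: valid_puzzle_def del: One_nat_def)
  have tile: "s \<in> board ?n \<and> s \<noteq> target P \<and> 1 \<le> k \<and> k \<le> ?n - 1 \<and> (ones \<longrightarrow> k = 1)"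
    if "tiles P s = Some k" for s k
  proof -
    obtain r c where s: "s = (r, c)" by (cases s)
    have k: "r < ?n" "c < ?n" "k = cell_field ?z r c" "k \<noteq> 0"
      using that by (auto simp: P_def s board_def split: if_splits)
    moreover have "s \<noteq> target P" using k t(3) by (auto simp: P_def s)
    ultimately show ?thesis using bd[of r c] by (auto simp: s board_def)
  qed
  have ok: "puzzle_ok ones P"
    unfolding puzzle_ok_def wf_zhed_def
  proof (intro conjI allI impI)
    show "target P \<in> board (side P)" using t by (simp add: P_def board_def)
    show "ran (tiles P) \<subseteq> {1}" if ones
    proof
      fix k assume "k \<in> ran (tiles P)"
      then obtain s where "tiles P s = Some k" by (auto simp: ran_def)
      from tile[OF this] show "k \<in> {1}" using that by simp
    qed
    fix s k assume "tiles P s = Some k"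
    from tile[OF this] show "s \<in> board (side P)" "s \<noteq> target P" "1 \<le> k" "k \<le> side P - 1"
      by (simp_all add: P_def)
  qed
  have tg: "target P = (field ?z 1, field ?z 2)" by (simp add: P_def)
  have r: "xs = [?n, field ?z 1, field ?z 2] @
      map (\<lambda>i. cell_code (tiles P (i div ?n, i mod ?n))) [0..<?n * ?n]" (is "_ = ?r")
  proof (rule nth_equalityI)
    show "length xs = length ?r" using len by simp
    fix k assume k: "k < length xs"
    consider "k = 0" | "k = 1" | "k = 2" | i where "k = 3 + i"
    proof (cases "k < 3")
      case True
      then have "k = 0 \<or> k = 1 \<or> k = 2" by auto
      then show ?thesis using that(1-3) by blast
    next
      case False
      then show ?thesis using that(4)[of "k - 3"] by simp
    qed
    then show "xs ! k = ?r ! k"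
    proof cases
      case (4 i)
      then have i: "i < ?n * ?n" using k len by simp
      then have "0 < ?n" by (cases ?n) auto
      then have "i div ?n < ?n" "i mod ?n < ?n" using i by (auto simp: less_mult_imp_div_less)
      moreover have "cell_field ?z (i div ?n) (i mod ?n) = field ?z (3 + i)"
        unfolding cell_field_def by (rule arg_cong[of _ _ "\<lambda>j. field ?z (3 + j)"]) (rule div_mult_mod_eq)
      ultimately have "cell_code (tiles P (i div ?n, i mod ?n)) = field ?z (3 + i)"
        by (simp add: P_def cell_code_def board_def)
      then show ?thesis using 4 i f[OF k] by (simp add: nth_append)
    qed (use f[OF k] in simp_all)
  qed
  have "encode_zhed P = concat (map unary ([?n, fst (target P), snd (target P)] @
      map (\<lambda>i. cell_code (tiles P (i div ?n, i mod ?n))) [0..<?n * ?n]))"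
    by (rule nth_encode) (simp add: P_def)
  then have "encode_zhed P = concat (map unary ([?n, field ?z 1, field ?z 2] @
      map (\<lambda>i. cell_code (tiles P (i div ?n, i mod ?n))) [0..<?n * ?n]))"
    using tg by (simp only: fst_conv snd_conv)
  then have "x = encode_zhed P"
    using trans[OF xs arg_cong[OF r, of "\<lambda>l. concat (map unary l)"]] by (simp only:)
  then show ?thesis using ok by blast
qed

lemma grid_at_0:
  fixes P :: zhed and u :: "bool list"
  assumes "puzzle_ok ones P"
  defines "z \<equiv> pair_word (encode_zhed P) u"
  shows "grid_at z 0 = initial_grid P \<longleftrightarrow>
    (\<forall>r<field z 0. \<forall>c<field z 0. if cell_field z r c = 0 then unfilled_at z 0 r c else numbered_at z 0 r c)"
proof -
  note e = encode_fields[where P = P and u = u, folded z_def]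
  have out: "tiles P s = None" if "s \<notin> board (side P)" for s
    using assms(1) that unfolding puzzle_ok_def wf_zhed_def by (metis not_None_eq)
  have nz: "tiles P s \<noteq> Some 0" for s
    using assms(1) unfolding puzzle_ok_def wf_zhed_def by (metis not_one_le_zero)
  have *: "grid_at z 0 (r, c) = initial_grid P (r, c) \<longleftrightarrow>
      (if cell_field z r c = 0 then unfilled_at z 0 r c else numbered_at z 0 r c)"
    if "r < side P" "c < side P" for r c
    using that e(5)[OF that] nz[of "(r, c)"]
    by (cases "tiles P (r, c)")
      (auto simp: grid_at_def e(1) board_def initial_grid_def cell_code_def unfilled_at_def)
  show ?thesis
  proof
    assume "grid_at z 0 = initial_grid P"
    then show "\<forall>r<field z 0. \<forall>c<field z 0. if cell_field z r c = 0 then unfilled_at z 0 r c else numbered_at z 0 r c"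
      using * e(1) by simp
  next
    assume A: "\<forall>r<field z 0. \<forall>c<field z 0. if cell_field z r c = 0 then unfilled_at z 0 r c else numbered_at z 0 r c"
    show "grid_at z 0 = initial_grid P"
    proof
      fix s
      show "grid_at z 0 s = initial_grid P s"
      proof (cases "s \<in> board (side P)")
        case True
        then show ?thesis using A * e(1) by (cases s) (auto simp: board_def)
      next
        case False
        then show ?thesis using out e(1) by (simp add: grid_at_def initial_grid_def)
      qed
    qed
  qed
qed

text \<open>No bound on the length of \<open>u\<close> is assumed: beyond its end all history bits
  read as false, and the history is checked as it stands.\<close>

lemma certified_sound:
  assumes "certified ones (pair_word x u)"
  shows "\<exists>P. puzzle_ok ones P \<and> solvable P \<and> x = encode_zhed P"
proof -
  obtain P where P: "puzzle_ok ones P" "x = encode_zhed P"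
    using assms valid_puzzle_decode[of ones x u] by (auto simp: certified_def)
  let ?z = "pair_word (encode_zhed P) u"
  note e = encode_fields[where P = P and u = u]
  obtain T where T: "\<forall>\<tau><T. move_at ?z \<tau>" "\<not> unfilled_at ?z T (field ?z 1) (field ?z 2)"
    using assms P by (auto simp: certified_def)
  have "(zhed_move (side P))\<^sup>*\<^sup>* (grid_at ?z 0) (grid_at ?z t)" if "t \<le> T" for t
    using that
  proof (induction t)
    case (Suc t)
    then show ?case
      using T(1) move_at_iff[of ?z t] e(1) by (auto intro: rtranclp.rtrancl_into_rtrancl)
  qed simp
  moreover have "grid_at ?z 0 = initial_grid P"
    using assms P grid_at_0[OF P(1)] by (auto simp: certified_def)
  moreover have "grid_at ?z T (target P) \<noteq> Unfilled"
    using T(2) P(1) e by (auto simp: grid_at_def puzzle_ok_def wf_zhed_def split: if_splits)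
  ultimately have "solvable P" unfolding solvable_def by (metis le_refl)
  then show ?thesis using P by blast
qed

text \<open>The selected tile loses its number and no square gains one. So a board with
  \<open>n * n\<close> squares allows at most \<open>n * n\<close> moves, which bounds the
  certificate.\<close>

lemma zhed_move_numbered:
  assumes "zhed_move n g g'"
  shows "{s \<in> board n. \<exists>k. g' s = Numbered k} \<subset> {s \<in> board n. \<exists>k. g s = Numbered k}"
  using assms by cases (auto split: if_splits)

lemma zhed_move_cells:
  assumes "zhed_move n g g'" "\<forall>s. g s = Unfilled \<or> g s = Blank \<or> g s = Numbered (f s)"
    "\<forall>s. s \<notin> board n \<longrightarrow> g s = Unfilled"
  shows "(\<forall>s. g' s = Unfilled \<or> g' s = Blank \<or> g' s = Numbered (f s)) \<and> (\<forall>s. s \<notin> board n \<longrightarrow> g' s = Unfilled)"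
  using assms
proof cases
  case (1 s k d)
  have "closest_unfilled n g s d k \<subseteq> board n"
    by (rule order_trans[OF closest_unfilled_subset_ray ray_subset_board[OF 1(2)]])
  then show ?thesis using 1 assms by auto
qed

lemma certified_complete:
  assumes "puzzle_ok ones P" "solvable P"
  shows "\<exists>u. length u = 2 * ((side P * side P + 1) * side P * side P) \<and> certified ones (pair_word (encode_zhed P) u)"
proof -
  let ?n = "side P"
  obtain g where g: "(zhed_move ?n)\<^sup>*\<^sup>* (initial_grid P) g" "g (target P) \<noteq> Unfilled"
    using assms(2) by (auto simp: solvable_def)
  obtain T G where G: "G 0 = initial_grid P" "G T = g" "\<And>i. i < T \<Longrightarrow> zhed_move ?n (G i) (G (Suc i))"
    using g(1) unfolding rtranclp_power relpowp_fun_conv by blast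
  let ?c = "\<lambda>t. card {s \<in> board ?n. \<exists>k. G t s = Numbered k}"
  have fin: "finite (board ?n)" by (simp add: board_def)
  have "t + ?c t \<le> ?n * ?n" if "t \<le> T" for t
    using that
  proof (induction t)
    case 0
    have "?c 0 \<le> card (board ?n)" using fin by (intro card_mono) auto
    then show ?case by (simp add: board_def)
  next
    case (Suc t)
    then have "?c (Suc t) < ?c t"
      using fin G(3)[of t] by (intro psubset_card_mono zhed_move_numbered) auto
    then show ?case using Suc by simp
  qed
  from this[of T] have T: "T \<le> ?n * ?n" by simp
  let ?code = "\<lambda>s. cell_code (tiles P s)"
  have cells: "(\<forall>s. G t s = Unfilled \<or> G t s = Blank \<or> G t s = Numbered (?code s)) \<and>
      (\<forall>s. s \<notin> board ?n \<longrightarrow> G t s = Unfilled)" if "t \<le> T" for t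
    using that
  proof (induction t)
    case 0
    have "tiles P s = None" if "s \<notin> board (side P)" for s
      using assms(1) that unfolding puzzle_ok_def wf_zhed_def by (metis not_None_eq)
    then show ?case by (auto simp: G(1) initial_grid_def cell_code_def split: option.splits)
  next
    case (Suc t)
    then show ?case using zhed_move_cells[OF G(3)[of t], of ?code] by simp
  qed
  \<comment> \<open>Two bits for each of the \<open>?n * ?n\<close> squares at each of the times 0
    to \<open>?n * ?n\<close>.\<close>
  let ?L = "2 * ((?n * ?n + 1) * ?n * ?n)"
  define h where "h l = (let s = l div 2; q = (s div ?n mod ?n, s mod ?n); v = G (s div ?n div ?n) q in
    if l mod 2 = 1 then (\<exists>k. v = Numbered k) else v \<noteq> Unfilled)" for l
  define u where "u = map h [0..<?L]"
  let ?z = "pair_word (encode_zhed P) u"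
  note e = encode_fields[where P = P and u = u]
  have n0: "0 < ?n" using assms(1) by (auto simp: puzzle_ok_def wf_zhed_def board_def)
  have hb: "history_bit ?z (((t * ?n + r) * ?n + c) * 2 + b) \<longleftrightarrow>
      (if b = 1 then (\<exists>k. G t (r, c) = Numbered k) else G t (r, c) \<noteq> Unfilled)"
    if "t \<le> T" "r < ?n" "c < ?n" "b < 2" for t r c b
  proof -
    let ?s = "(t * ?n + r) * ?n + c"
    let ?l = "?s * 2 + b"
    have "?s < (t * ?n + r) * ?n + ?n" using that by simp
    also have "\<dots> = (t * ?n + r + 1) * ?n" by simp
    also have "\<dots> \<le> ((?n * ?n + 1) * ?n) * ?n"
    proof (rule mult_right_mono)
      have "t * ?n + r + 1 \<le> t * ?n + ?n" using that by simp
      also have "\<dots> = (t + 1) * ?n" by simp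
      also have "\<dots> \<le> (?n * ?n + 1) * ?n" using that T by (intro mult_right_mono) auto
      finally show "t * ?n + r + 1 \<le> (?n * ?n + 1) * ?n" .
    qed simp
    finally have "?l < ?L" using that by simp
    then have "tape_word u (int ?l) = (if h ?l then 2 else 1)"
      by (simp add: tape_word_def u_def nat_int[of ?l, simplified] del: of_nat_add of_nat_mult)
    then have "history_bit ?z ?l \<longleftrightarrow> h ?l"
      unfolding history_bit_def fst_length_pair pair_word_snd by simp
    moreover have dm: "(a * m + b) div m = a" "(a * m + b) mod m = b" if "b < m" for a b m :: nat
      using that by auto
    moreover have "?l div 2 = ?s" "?l mod 2 = b" using that by (blast intro: dm)+
    moreover have "?s div ?n = t * ?n + r" "?s mod ?n = c" using that by (blast intro: dm)+
    moreover have "(t * ?n + r) div ?n = t" "(t * ?n + r) mod ?n = r" using that by (blast intro: dm)+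
    ultimately show ?thesis by (simp add: h_def Let_def)
  qed
  have grid: "grid_at ?z t = G t" if t: "t \<le> T" for t
  proof
    fix s
    show "grid_at ?z t s = G t s"
    proof (cases "s \<in> board ?n")
      case True
      then obtain r c where s: "s = (r, c)" "r < ?n" "c < ?n" by (cases s) (auto simp: board_def)
      have "numbered_at ?z t r c \<longleftrightarrow> (\<exists>k. G t (r, c) = Numbered k)"
        using hb[OF t s(2,3), of 1] e(1) by (simp add: numbered_at_def)
      moreover have "unfilled_at ?z t r c \<longleftrightarrow> \<not> numbered_at ?z t r c \<and> G t (r, c) = Unfilled"
        using hb[OF t s(2,3), of 0] e(1) by (simp add: unfilled_at_def)
      moreover have "G t s = Unfilled \<or> G t s = Blank \<or> G t s = Numbered (?code s)"
        using cells[OF t] by blast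
      ultimately show ?thesis using True s e(1) e(5)[OF s(2,3)] by (auto simp: grid_at_def)
    next
      case False
      then show ?thesis using cells[OF t] e(1) by (cases s) (simp add: grid_at_def)
    qed
  qed
  have lu: "length u = ?L" by (simp add: u_def)
  have "1 \<le> ?n * ?n" using n0 by (simp add: Suc_le_eq)
  then have "?n * ?n * 1 \<le> ?n * ?n * (?n * ?n)" by (intro mult_left_mono) auto
  then have "?n * ?n \<le> (?n * ?n + 1) * ?n * ?n" by (simp add: algebra_simps)
  then have "T < Suc (length ?z)" using T unfolding length_pair_word lu by linarith
  moreover have "\<forall>\<tau><T. move_at ?z \<tau>"
    using move_at_iff[of ?z] grid e(1) G(3) by simp
  moreover have "\<not> unfilled_at ?z T (field ?z 1) (field ?z 2)"
  proof -
    have "target P \<in> board ?n" using assms(1) by (simp add: puzzle_ok_def wf_zhed_def)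
    moreover have "grid_at ?z T (target P) \<noteq> Unfilled" using grid[of T] G g by simp
    moreover have "unfilled_at ?z T r c \<Longrightarrow> \<not> numbered_at ?z T r c" for r c
      by (simp add: unfilled_at_def)
    ultimately show ?thesis using e(1-3) by (auto simp: grid_at_def split: if_splits)
  qed
  ultimately have "certified ones ?z"
    unfolding certified_def
    using valid_puzzle_encode[OF assms(1)] grid_at_0[OF assms(1), of u] grid[of 0] G(1) by auto
  then show ?thesis using lu by blast
qed

lemma side_le_length_encode: "side P \<le> length (encode_zhed P)"
  by (simp add: encode_zhed_def unary_def)

lemma puzzle_in_NP: "in_NP {encode_zhed P | P. puzzle_ok ones P \<and> solvable P}"
  unfolding in_NP_def
proof (intro exI conjI allI)
  show "polytime_decidable {w. certified ones w}"
    by (rule polytime_decidable_definable[OF definable_certified])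
  fix x
  show "x \<in> {encode_zhed P | P. puzzle_ok ones P \<and> solvable P} \<longleftrightarrow>
    (\<exists>u. length u \<le> poly ([:0, 0, 2, 0, 2:] :: nat poly) (length x) \<and> pair_word x u \<in> {w. certified ones w})"
  proof
    assume "x \<in> {encode_zhed P | P. puzzle_ok ones P \<and> solvable P}"
    then obtain P where P: "x = encode_zhed P" "puzzle_ok ones P" "solvable P" by blast
    obtain u where u: "length u = 2 * ((side P * side P + 1) * side P * side P)" "certified ones (pair_word x u)"
      using certified_complete[OF P(2,3)] P(1) by blast
    have s: "side P \<le> length x" using side_le_length_encode P(1) by simp
    have "length u \<le> 2 * ((length x * length x + 1) * length x * length x)"
      unfolding u(1) by (intro mult_le_mono add_le_mono s order_refl)
    also have "\<dots> = poly [:0, 0, 2, 0, 2:] (length x)" by (simp add: algebra_simps)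
    finally show "\<exists>u. length u \<le> poly [:0, 0, 2, 0, 2:] (length x) \<and> pair_word x u \<in> {w. certified ones w}"
      using u(2) by blast
  next
    assume "\<exists>u. length u \<le> poly [:0, 0, 2, 0, 2:] (length x) \<and> pair_word x u \<in> {w. certified ones w}"
    then show "x \<in> {encode_zhed P | P. puzzle_ok ones P \<and> solvable P}"
      using certified_sound by blast
  qed
qed

lemma ZHED_in_NP: "in_NP ZHED"
proof -
  have "ZHED = {encode_zhed P | P. puzzle_ok False P \<and> solvable P}"
    by (simp add: ZHED_def puzzle_ok_def)
  then show ?thesis using puzzle_in_NP[of False] by simp
qed

lemma ZHED_ones_in_NP: "in_NP ZHED_ones"
proof -
  have "ZHED_ones = {encode_zhed P | P. puzzle_ok True P \<and> solvable P}"
    by (simp add: ZHED_ones_def puzzle_ok_def)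
  then show ?thesis using puzzle_in_NP[of True] by simp
qed

section \<open>Puzzles with tiles of number 1\<close>

definition between :: "square \<Rightarrow> square \<Rightarrow> square set" where
  "between s t = {u. (fst s = fst t \<and> fst u = fst s \<and> (snd s < snd u \<and> snd u < snd t \<or> snd t < snd u \<and> snd u < snd s)) \<or>
     (snd s = snd t \<and> snd u = snd s \<and> (fst s < fst u \<and> fst u < fst t \<or> fst t < fst u \<and> fst u < fst s))}"

definition aligned :: "square \<Rightarrow> square \<Rightarrow> bool" where
  "aligned s t \<longleftrightarrow> s \<noteq> t \<and> (fst s = fst t \<or> snd s = snd t)"

definition ones_puzzle :: "nat \<Rightarrow> square \<Rightarrow> square set \<Rightarrow> zhed" where
  "ones_puzzle n t I = \<lparr>side = n, target = t, tiles = (\<lambda>s. if s \<in> I then Some 1 else None)\<rparr>"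

lemma between_ray:
  assumes "t \<in> set (ray n s d)" "s \<in> board n"
  shows "u \<in> between s t \<longleftrightarrow> u \<in> set (ray n s d) \<and>
    square_dist (fst s) (snd s) (fst u) (snd u) < square_dist (fst s) (snd s) (fst t) (snd t)"
proof -
  obtain r c i j a b where st: "s = (r, c)" "t = (i, j)" "u = (a, b)" by (cases s; cases t; cases u)
  have rc: "r < n" "c < n" using assms(2) by (auto simp: board_def st)
  have dist: "a < r \<Longrightarrow> i < r \<Longrightarrow> square_dist r c a c < square_dist r c i c \<longleftrightarrow> i < a"
    "r < a \<Longrightarrow> r < i \<Longrightarrow> square_dist r c a c < square_dist r c i c \<longleftrightarrow> a < i"
    "b < c \<Longrightarrow> j < c \<Longrightarrow> square_dist r c r b < square_dist r c r j \<longleftrightarrow> j < b"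
    "c < b \<Longrightarrow> c < j \<Longrightarrow> square_dist r c r b < square_dist r c r j \<longleftrightarrow> b < j"
    by (auto simp: square_dist_def)
  show ?thesis
  proof (cases d)
    case Up
    then have t: "j = c" "i < r" using assms(1) by (auto simp: st)
    have "u \<in> between s t \<longleftrightarrow> b = c \<and> i < a \<and> a < r" using t by (auto simp: between_def st)
    moreover have "u \<in> set (ray n s d) \<longleftrightarrow> b = c \<and> a < r" using Up by (auto simp: st)
    ultimately show ?thesis using t dist(1) by (auto simp: st)
  next
    case Down
    then have t: "j = c" "r < i" "i < n" using assms(1) by (auto simp: st)
    have "u \<in> between s t \<longleftrightarrow> b = c \<and> r < a \<and> a < i" using t by (auto simp: between_def st)
    moreover have "u \<in> set (ray n s d) \<longleftrightarrow> b = c \<and> r < a \<and> a < n" using Down by (auto simp: st)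
    ultimately show ?thesis using t dist(2) by (auto simp: st)
  next
    case Left
    then have t: "i = r" "j < c" using assms(1) by (auto simp: st)
    have "u \<in> between s t \<longleftrightarrow> a = r \<and> j < b \<and> b < c" using t by (auto simp: between_def st)
    moreover have "u \<in> set (ray n s d) \<longleftrightarrow> a = r \<and> b < c" using Left by (auto simp: st)
    ultimately show ?thesis using t dist(3) by (auto simp: st)
  next
    case Right
    then have t: "i = r" "c < j" "j < n" using assms(1) by (auto simp: st)
    have "u \<in> between s t \<longleftrightarrow> a = r \<and> c < b \<and> b < j" using t by (auto simp: between_def st)
    moreover have "u \<in> set (ray n s d) \<longleftrightarrow> a = r \<and> c < b \<and> b < n" using Right by (auto simp: st)
    ultimately show ?thesis using t dist(4) by (auto simp: st)
  qed
qed

lemma aligned_ray: "t \<in> set (ray n s d) \<Longrightarrow> aligned s t"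
  by (cases s; cases t; cases d) (auto simp: aligned_def)

lemma ray_aligned: "aligned s t \<Longrightarrow> s \<in> board n \<Longrightarrow> t \<in> board n \<Longrightarrow> \<exists>d. t \<in> set (ray n s d)"
proof -
  assume a: "aligned s t" "s \<in> board n" "t \<in> board n"
  obtain r c i j where st: "s = (r, c)" "t = (i, j)" by (cases s; cases t)
  have "i < r \<and> j = c \<or> r < i \<and> j = c \<or> i = r \<and> j < c \<or> i = r \<and> c < j"
    using a by (auto simp: aligned_def st)
  then consider "t \<in> set (ray n s Up)" | "t \<in> set (ray n s Down)" | "t \<in> set (ray n s Left)" | "t \<in> set (ray n s Right)"
    using a by (auto simp: st board_def)
  then show ?thesis by cases blast+
qed

lemma closest_unfilled_1:
  assumes "s \<in> board n"
  shows "t \<in> closest_unfilled n g s d 1 \<longleftrightarrow>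
    t \<in> set (ray n s d) \<and> g t = Unfilled \<and> between s t \<subseteq> {u. g u \<noteq> Unfilled}"
proof (cases "t \<in> set (ray n s d)")
  case True
  let ?S = "{t' \<in> set (ray n s d). g t' = Unfilled \<and>
      square_dist (fst s) (snd s) (fst t') (snd t') < square_dist (fst s) (snd s) (fst t) (snd t)}"
  have "card ?S < 1 \<longleftrightarrow> ?S = {}" by simp
  also have "\<dots> \<longleftrightarrow> between s t \<subseteq> {u. g u \<noteq> Unfilled}"
    using between_ray[OF True assms] by blast
  finally show ?thesis using True by (simp only: closest_unfilled_iff simp_thms)
qed (simp add: closest_unfilled_iff)

lemma closest_unfilled_1_unique:
  "t \<in> closest_unfilled n g s d 1 \<Longrightarrow> closest_unfilled n g s d 1 = {t}"
  unfolding closest_unfilled_def by (cases "filter (\<lambda>t. g t = Unfilled) (ray n s d)") auto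

lemma initial_grid_ones: "initial_grid (ones_puzzle n t I) = (\<lambda>s. if s \<in> I then Numbered 1 else Unfilled)"
  by (auto simp: initial_grid_def ones_puzzle_def)

text \<open>
  Every square filled in the course of the game is charged to the tile that filled it. The squares
  between the two were filled at that time, hence are filled at the end.
\<close>

definition charging :: "square set \<Rightarrow> square set \<Rightarrow> (square \<Rightarrow> square) \<Rightarrow> bool" where
  "charging I F src \<longleftrightarrow> I \<subseteq> F \<and> inj_on src (F - I) \<and>
     (\<forall>t \<in> F - I. src t \<in> I \<and> aligned (src t) t \<and> between (src t) t \<subseteq> F)"

text \<open>The invariant also records that all sources are blank by now. The tile selected by the
  next move still has its number, so it is a new source and \<open>src\<close> stays injective. A
  move that finds no unfilled square charges nothing.\<close>

lemma solvable_ones_charging: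
  assumes "solvable (ones_puzzle n t I)"
  obtains F src where "t \<in> F" "charging I F src"
proof -
  let ?F = "\<lambda>g. {s. g s \<noteq> Unfilled}"
  let ?inv = "\<lambda>g. \<exists>src. charging I (?F g) src \<and> (\<forall>u \<in> ?F g - I. g (src u) = Blank) \<and>
    (\<forall>s k. g s = Numbered k \<longrightarrow> k = 1 \<and> s \<in> I)"
  obtain g where g: "(zhed_move n)\<^sup>*\<^sup>* (initial_grid (ones_puzzle n t I)) g" "g t \<noteq> Unfilled"
    using assms by (auto simp: solvable_def ones_puzzle_def)
  have "?inv g"
    using g(1)
  proof (induction rule: rtranclp_induct)
    case base
    show ?case by (auto simp: initial_grid_ones charging_def inj_on_def)
  next
    case (step g g')
    then obtain src where src: "charging I (?F g) src" "\<forall>u \<in> ?F g - I. g (src u) = Blank"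
      and num: "\<And>s k. g s = Numbered k \<Longrightarrow> k = 1 \<and> s \<in> I" by blast
    from step(2) show ?case
    proof cases
      case (1 s k d)
      then have k: "k = 1" and sI: "s \<in> I" using num[of s k] by auto
      let ?C = "closest_unfilled n g s d 1"
      have g': "g' = (\<lambda>t. if t = s \<or> t \<in> ?C then Blank else g t)" using 1 k by simp
      show ?thesis
      proof (cases "?C = {}")
        case True
        have "?F g' = ?F g" using g' True 1 by auto
        moreover have "\<forall>u \<in> ?F g - I. g' (src u) = Blank" using src g' by auto
        moreover have "\<forall>s k. g' s = Numbered k \<longrightarrow> k = 1 \<and> s \<in> I"
          using num g' by (simp split: if_splits)
        ultimately show ?thesis using src(1) by auto
      next
        case False
        then obtain u where u: "u \<in> ?C" by blast
        have C: "?C = {u}" by (rule closest_unfilled_1_unique[OF u])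
        have ur: "u \<in> set (ray n s d)" "g u = Unfilled" "between s u \<subseteq> ?F g"
          using u closest_unfilled_1[OF 1(2)] by auto
        have F': "?F g' = insert u (?F g)" unfolding g' C using 1(3) by auto
        have uI: "u \<notin> I" using src(1) ur(2) by (auto simp: charging_def)
        have d: "?F g' - I = insert u (?F g - I)" using F' uI by auto
        let ?src = "src(u := s)"
        have nu: "u \<notin> ?F g - I" using ur by simp
        have ns: "s \<notin> src ` (?F g - I)" using src(2) 1(3) by force
        have inj: "inj_on src (?F g - I)" using src(1) by (simp add: charging_def)
        have "inj_on ?src (insert u (?F g - I))"
          using inj_on_fun_updI[OF inj ns, of u] nu ns
          by (subst inj_on_insert) (auto simp: image_iff)
        moreover have "\<forall>t \<in> insert u (?F g - I). ?src t \<in> I \<and> aligned (?src t) t \<and> between (?src t) t \<subseteq> ?F g'"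
          using src(1) sI ur aligned_ray[OF ur(1)] F' by (auto simp: charging_def)
        ultimately have "charging I (?F g') ?src"
          using src(1) F' d by (auto simp: charging_def)
        moreover have "\<forall>t \<in> ?F g' - I. g' (?src t) = Blank"
          unfolding d using src(2) by (auto simp: g')
        moreover have "\<forall>s k. g' s = Numbered k \<longrightarrow> k = 1 \<and> s \<in> I"
          using num g' by (simp split: if_splits)
        ultimately show ?thesis by blast
      qed
    qed
  qed
  then obtain src where "charging I (?F g) src" by blast
  then show ?thesis using that[of "?F g" src] g(2) by simp
qed

section \<open>Building solutions line by line\<close>

definition reach :: "nat \<Rightarrow> square set \<Rightarrow> square set \<Rightarrow> square set \<Rightarrow> bool" where
  "reach n I F U \<longleftrightarrow> (\<exists>g. (zhed_move n)\<^sup>*\<^sup>* (\<lambda>s. if s \<in> I then Numbered 1 else Unfilled) g \<and>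
     {s. g s \<noteq> Unfilled} = F \<and> (\<forall>s \<in> U. g s = Numbered 1))"

lemma reach_init: "reach n I I I"
  unfolding reach_def by (rule exI[of _ "\<lambda>s. if s \<in> I then Numbered 1 else Unfilled"]) auto

lemma solvable_ones_reach: "reach n I F U \<Longrightarrow> t \<in> F \<Longrightarrow> solvable (ones_puzzle n t I)"
  unfolding reach_def solvable_def initial_grid_ones by (auto simp: ones_puzzle_def)

lemma reach_step:
  assumes "reach n I F U" "s \<in> U" "s \<in> board n" "u \<in> board n" "u \<notin> F" "aligned s u" "between s u \<subseteq> F"
  shows "reach n I (insert u F) (U - {s})"
proof -
  obtain g where g: "(zhed_move n)\<^sup>*\<^sup>* (\<lambda>s. if s \<in> I then Numbered 1 else Unfilled) g"
    "{s. g s \<noteq> Unfilled} = F" "\<forall>s \<in> U. g s = Numbered 1"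
    using assms(1) by (auto simp: reach_def)
  obtain d where d: "u \<in> set (ray n s d)" using ray_aligned assms(3,4,6) by blast
  have gs: "g s = Numbered 1" and gu: "g u = Unfilled" using g assms(2,5) by auto
  have "between s u \<subseteq> {v. g v \<noteq> Unfilled}" using g(2) assms(7) by simp
  then have C: "closest_unfilled n g s d 1 = {u}"
    using closest_unfilled_1_unique closest_unfilled_1[OF assms(3)] d gu by blast
  let ?g = "\<lambda>t. if t = s \<or> t \<in> closest_unfilled n g s d 1 then Blank else g t"
  have "zhed_move n g ?g" using zhed_move.intros[of s n g 1 d] assms(3) gs by simp
  then have 1: "(zhed_move n)\<^sup>*\<^sup>* (\<lambda>s. if s \<in> I then Numbered 1 else Unfilled) ?g"
    using g(1) by (simp add: rtranclp.rtrancl_into_rtrancl)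
  have "{v. ?g v \<noteq> Unfilled} = {v. g v \<noteq> Unfilled} \<union> {s, u}" using C by auto
  then have 2: "{v. ?g v \<noteq> Unfilled} = insert u F" using g(2) gs by auto
  have 3: "\<forall>v \<in> U - {s}. ?g v = Numbered 1"
  proof
    fix v assume v: "v \<in> U - {s}"
    then have "g v = Numbered 1" using g(3) by simp
    then show "?g v = Numbered 1" using C v gu by auto
  qed
  show ?thesis unfolding reach_def using 1 2 3 by (intro exI[of _ ?g] conjI)
qed

text \<open>The square of greatest rank is filled last: everything between a square and its source
  is filled from the start or has smaller rank.\<close>

lemma reach_ranked:
  fixes rank :: "square \<Rightarrow> nat"
  assumes "finite T" "reach n I F U" "T \<subseteq> board n" "U \<subseteq> board n" "T \<inter> F = {}" "inj_on src T"
    "\<And>u. u \<in> T \<Longrightarrow> src u \<in> U \<and> aligned (src u) u"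
    "\<And>u v. u \<in> T \<Longrightarrow> v \<in> between (src u) u \<Longrightarrow> v \<in> F \<or> v \<in> T \<and> rank v < rank u"
  shows "reach n I (F \<union> T) (U - src ` T)"
  using assms
proof (induction "card T" arbitrary: T)
  case 0
  then show ?case by simp
next
  case (Suc j)
  then have "T \<noteq> {}" by auto
  then have "Max (rank ` T) \<in> rank ` T" using Suc.prems(1) by (intro Max_in) auto
  then obtain u where "u \<in> T" "rank u = Max (rank ` T)" by auto
  then have u: "u \<in> T" "\<And>v. v \<in> T \<Longrightarrow> rank v \<le> rank u" using Suc.prems(1) by auto
  let ?T = "T - {u}"
  have IH: "reach n I (F \<union> ?T) (U - src ` ?T)"
  proof (rule Suc.hyps(1))
    show "j = card ?T" using Suc.hyps(2) u(1) Suc.prems(1) by simp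
    show "inj_on src ?T" using Suc.prems(6) by (rule inj_on_subset) auto
    fix w v assume w: "w \<in> ?T" "v \<in> between (src w) w"
    have "v \<in> F \<or> v \<in> T \<and> rank v < rank w" using Suc.prems(8)[of w v] w by blast
    moreover have "rank w \<le> rank u" using u(2) w by blast
    ultimately show "v \<in> F \<or> v \<in> ?T \<and> rank v < rank w" by auto
  qed (use Suc.prems in auto)
  have "reach n I (insert u (F \<union> ?T)) (U - src ` ?T - {src u})"
  proof (rule reach_step[OF IH])
    have su: "src u \<in> U" "aligned (src u) u" using Suc.prems(7)[OF u(1)] by auto
    then show "aligned (src u) u" "src u \<in> board n" using Suc.prems(4) by auto
    show "src u \<in> U - src ` ?T" using su Suc.prems(6) u(1) by (auto simp: inj_on_def)
    show "u \<in> board n" "u \<notin> F \<union> ?T" using Suc.prems(3,5) u(1) by auto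
    show "between (src u) u \<subseteq> F \<union> ?T"
    proof
      fix v assume "v \<in> between (src u) u"
      from Suc.prems(8)[OF u(1) this] show "v \<in> F \<union> ?T" by auto
    qed
  qed
  moreover have "insert u (F \<union> ?T) = F \<union> T" using u(1) by blast
  moreover have "U - src ` ?T - {src u} = U - src ` T" using u(1) by blast
  ultimately show ?case by simp
qed

text \<open>On one line every source can serve every square, because the squares in between are
  filled already or come earlier in the order \<open>pos\<close>. So only the numbers of tiles and
  squares matter, and any injection of squares into sources will do. A square on several lines is
  assigned to one of them by \<open>lab\<close>.\<close>

lemma reach_lines:
  fixes pos :: "square \<Rightarrow> nat" and A S :: "'l \<Rightarrow> square set"
  assumes "reach n I F U" "finite L" "U \<subseteq> board n"
    and A: "\<And>l. l \<in> L \<Longrightarrow> finite (A l) \<and> A l \<subseteq> board n"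
    and S: "\<And>l. l \<in> L \<Longrightarrow> S l \<subseteq> U" "\<And>l l'. l \<in> L \<Longrightarrow> l' \<in> L \<Longrightarrow> l \<noteq> l' \<Longrightarrow> S l \<inter> S l' = {}"
    and card: "\<And>l. l \<in> L \<Longrightarrow> card (A l) \<le> card (S l)"
    and al: "\<And>l u s. l \<in> L \<Longrightarrow> u \<in> A l \<Longrightarrow> s \<in> S l \<Longrightarrow> aligned s u"
    and btw: "\<And>l u s v. l \<in> L \<Longrightarrow> u \<in> A l \<Longrightarrow> s \<in> S l \<Longrightarrow> v \<in> between s u \<Longrightarrow> v \<in> F \<or> v \<in> A l \<and> pos v < pos u"
  shows "reach n I (F \<union> (\<Union>l\<in>L. A l)) (U - (\<Union>l\<in>L. S l))"
proof -
  have finU: "finite U" using assms(3) finite_subset[of U "board n"] by (simp add: board_def)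
  let ?T = "(\<Union>l\<in>L. A l) - F"
  define lab where "lab u = (SOME l. l \<in> L \<and> u \<in> A l)" for u
  have lab: "lab u \<in> L \<and> u \<in> A (lab u)" if "u \<in> ?T" for u
    using that someI_ex[of "\<lambda>l. l \<in> L \<and> u \<in> A l"] unfolding lab_def by blast
  have "\<exists>f. inj_on f {v \<in> ?T. lab v = l} \<and> f ` {v \<in> ?T. lab v = l} \<subseteq> S l" if l: "l \<in> L" for l
  proof -
    have sub: "{v \<in> ?T. lab v = l} \<subseteq> A l" using lab by blast
    have fin: "finite (A l)" "finite (S l)" using A[OF l] S(1)[OF l] finU finite_subset by auto
    have "card {v \<in> ?T. lab v = l} \<le> card (S l)"
      using card_mono[OF fin(1) sub] card[OF l] by simp
    then show ?thesis
      using card_le_inj[of "{v \<in> ?T. lab v = l}" "S l"] fin finite_subset[OF sub] by auto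
  qed
  then have "\<forall>l \<in> L. \<exists>f. inj_on f {v \<in> ?T. lab v = l} \<and> f ` {v \<in> ?T. lab v = l} \<subseteq> S l"
    by (rule ballI)
  from bchoice[OF this] obtain f
    where f: "\<And>l. l \<in> L \<Longrightarrow> inj_on (f l) {v \<in> ?T. lab v = l} \<and> f l ` {v \<in> ?T. lab v = l} \<subseteq> S l"
    by (elim exE) (rule that, erule (1) bspec)
  let ?src = "\<lambda>u. f (lab u) u"
  have in_S: "?src u \<in> S (lab u)" if "u \<in> ?T" for u
  proof -
    have "u \<in> {v \<in> ?T. lab v = lab u}" using that by simp
    then show ?thesis using f[of "lab u"] lab[OF that] by (meson image_subset_iff)
  qed
  have inj: "inj_on ?src ?T"
  proof (rule inj_onI)
    fix u v assume uv: "u \<in> ?T" "v \<in> ?T" "?src u = ?src v"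
    have l: "lab u = lab v"
      using in_S[OF uv(1)] in_S[OF uv(2)] uv(3) S(2)[of "lab u" "lab v"] lab[OF uv(1)] lab[OF uv(2)] by auto
    have "inj_on (f (lab u)) {w \<in> ?T. lab w = lab u}" using f lab[OF uv(1)] by blast
    moreover have "u \<in> {w \<in> ?T. lab w = lab u}" "v \<in> {w \<in> ?T. lab w = lab u}" using uv l by simp_all
    moreover have "f (lab u) u = f (lab u) v" using uv(3) l by simp
    ultimately show "u = v" by (meson inj_onD)
  qed
  have "reach n I (F \<union> ?T) (U - ?src ` ?T)"
  proof (rule reach_ranked[OF _ assms(1) _ assms(3) _ inj, where rank = pos])
    show "finite ?T" using A assms(2) by simp
    show "?T \<subseteq> board n" using A by blast
    fix u assume u: "u \<in> ?T"
    have l: "lab u \<in> L" "u \<in> A (lab u)" using lab[OF u] by auto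
    show "?src u \<in> U \<and> aligned (?src u) u"
      using S(1)[OF l(1)] in_S[OF u] al[OF l in_S[OF u]] by blast
    fix v assume "v \<in> between (?src u) u"
    from btw[OF l in_S[OF u] this] show "v \<in> F \<or> v \<in> ?T \<and> pos v < pos u" using l(1) by blast
  qed auto
  then obtain g where g: "(zhed_move n)\<^sup>*\<^sup>* (\<lambda>s. if s \<in> I then Numbered 1 else Unfilled) g"
    "{s. g s \<noteq> Unfilled} = F \<union> ?T" "\<forall>s \<in> U - ?src ` ?T. g s = Numbered 1"
    by (auto simp: reach_def)
  have "F \<union> ?T = F \<union> (\<Union>l\<in>L. A l)" by blast
  moreover have "U - (\<Union>l\<in>L. S l) \<subseteq> U - ?src ` ?T" using in_S lab by blast
  ultimately show ?thesis unfolding reach_def using g by (intro exI[of _ g] conjI) auto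
qed

section \<open>The puzzle of a hitting set instance\<close>

lemma mult_add_less_mono: "(i::nat) < j \<Longrightarrow> i * H + H \<le> j * H"
  by (metis Suc_leI add.commute mult_Suc mult_le_mono1)

lemma mult_add_eq_cases:
  assumes "i * H + a = j * H + b" "a < H" "b < (H::nat)"
  shows "i = j \<and> a = b"
proof -
  have "\<not> i < j" using mult_add_less_mono[of i j H] assms by auto
  moreover have "\<not> j < i" using mult_add_less_mono[of j i H] assms by auto
  ultimately show ?thesis using assms by (simp add: not_less_iff_gr_or_eq)
qed

text \<open>
  Elements are columns, sets are bands of rows. Column \<^term>\<open>c\<close> is \<^term>\<open>M + c * W\<close>; the band of
  set \<^term>\<open>i\<close> starts in row \<^term>\<open>R + i * H\<close>. The line rows (offsets 0 and \<^term>\<open>5 * d + 2\<close>) are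
  pushed to the right from stacks on the left margin that are too short by the number of squares
  which the columns have to contribute; the column \<^term>\<open>M + N * W\<close> collects all line rows in the same way.
  A run of a column either goes up and fills its square of the line above, or down and fills its
  square of the next line; the additional tile of an incident column allows it to contribute to the
  middle line of the band on its way down.
\<close>

definition line_need :: "nat \<Rightarrow> nat \<Rightarrow> nat \<Rightarrow> nat \<Rightarrow> nat" where
  "line_need N m k i = (if i = 0 then N - k else if i = m then k else N)"

definition hit_tile :: "nat \<Rightarrow> nat \<Rightarrow> nat \<Rightarrow> nat \<Rightarrow> nat \<Rightarrow> nat \<Rightarrow> nat \<Rightarrow> nat \<Rightarrow> (nat \<Rightarrow> nat \<Rightarrow> bool) \<Rightarrow> nat \<Rightarrow> nat \<Rightarrow> bool" where
  "hit_tile N m k d H W M R hits y x \<longleftrightarrow>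
     (\<exists>i<Suc m. y = R + i * H \<and> line_need N m k i \<le> x \<and> x < M) \<or>
     (\<exists>i<m. y = R + i * H + (5 * d + 2) \<and> 1 \<le> x \<and> x < M) \<or>
     (\<exists>i<m. \<exists>c<N. x = M + c * W \<and> (\<exists>j<2 * d + 2. y = R + i * H + (2 * d + 1 + j) \<and> (j = 2 * d + 1 \<longrightarrow> hits i c))) \<or>
     (x = M + N * W \<and> 2 * m + 1 \<le> y \<and> y < R)"

text \<open>Along a line row there are \<open>Z - M + 1 = M\<close> squares from \<open>M\<close> to
  \<open>Z\<close>, and column \<open>Z\<close> has \<open>Yt - R + 1 = R\<close> squares from row
  \<open>R\<close> to the target. So an unshortened stack would have exactly enough tiles. A gap
  between columns has \<open>W - 1 = N\<close> squares, and a row off the lines has at most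
  \<open>N\<close> tiles. The height \<open>H = 6 * d + 3\<close> of a band is one line square, an
  upper zone of \<open>2 * d\<close> squares, \<open>2 * d + 1\<close> tiles, the optional tile, and
  a lower zone of \<open>2 * d\<close> squares with the middle line in it.\<close>

locale hitting_board =
  fixes N m k d H W M R :: nat and hits :: "nat \<Rightarrow> nat \<Rightarrow> bool"
  assumes m0: "0 < m" and N0: "0 < N" and kN: "k \<le> N" and d: "d = m + 2" and H: "H = 6 * d + 3"
    and W: "W = N + 1" and M: "M = N * W + 1" and R: "R = m * H + 2"
begin

abbreviation "Z \<equiv> M + N * W"
abbreviation "Yt \<equiv> R + m * H + 1"
abbreviation "krow i \<equiv> R + i * H"
abbreviation "crow i \<equiv> R + i * H + (5 * d + 2)"
abbreviation "xcol c \<equiv> M + c * W"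

definition tile_set :: "square set" where
  "tile_set = {(y, x). hit_tile N m k d H W M R hits y x}"

definition run :: "nat \<Rightarrow> nat \<Rightarrow> square set" where
  "run c i = {(krow i + (2 * d + 1 + j), xcol c) | j. j < 2 * d + 2 \<and> (j = 2 * d + 1 \<longrightarrow> hits i c)}"

definition line_rows :: "nat set" where
  "line_rows = krow ` {..m} \<union> crow ` {..<m}"

lemma row_eq: "krow i + a = krow j + b \<Longrightarrow> a < H \<Longrightarrow> b < H \<Longrightarrow> i = j \<and> a = b"
  using mult_add_eq_cases[of i H a j b] by simp

lemma row_mono: "i < j \<Longrightarrow> krow i + H \<le> krow j"
  using mult_add_less_mono[of i j H] by simp

lemma col_eq: "xcol c + a = xcol c' + b \<Longrightarrow> a < W \<Longrightarrow> b < W \<Longrightarrow> c = c' \<and> a = b"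
  using mult_add_eq_cases[of c W a c' b] by simp

lemma col_mono: "c < c' \<Longrightarrow> xcol c + W \<le> xcol c'"
  using mult_add_less_mono[of c c' W] by simp

lemma tile_cases:
  assumes "(y, x) \<in> tile_set"
  obtains (K) i where "i \<le> m" "y = krow i" "line_need N m k i \<le> x" "x < M"
  | (C) i where "i < m" "y = crow i" "1 \<le> x" "x < M"
  | (Run) i c where "i < m" "c < N" "(y, x) \<in> run c i" "x = xcol c"
  | (Z) "x = Z" "2 * m + 1 \<le> y" "y < R"
proof -
  have "hit_tile N m k d H W M R hits y x" using assms by (simp add: tile_set_def)
  then show thesis
    unfolding hit_tile_def
  proof (elim disjE exE conjE)
    fix i assume "i < Suc m" "y = krow i" "line_need N m k i \<le> x" "x < M"
    then show thesis by (intro K) auto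
  next
    fix i assume "i < m" "y = crow i" "1 \<le> x" "x < M"
    then show thesis by (rule C)
  next
    fix i c j assume "i < m" "c < N" "x = xcol c" "j < 2 * d + 2" "y = krow i + (2 * d + 1 + j)"
      "j = 2 * d + 1 \<longrightarrow> hits i c"
    then show thesis by (intro Run[of i c]) (auto simp: run_def)
  next
    assume "x = Z" "2 * m + 1 \<le> y" "y < R"
    then show thesis by (rule Z)
  qed
qed

lemma run_rowE:
  assumes "(y, x) \<in> run c i"
  obtains j where "y = krow i + (2 * d + 1 + j)" "j < 2 * d + 2" "j = 2 * d + 1 \<longrightarrow> hits i c" "x = xcol c"
  using assms by (auto simp: run_def)

lemma run_not_line: "(y, x) \<in> run c i \<Longrightarrow> i < m \<Longrightarrow> y \<notin> line_rows"
proof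
  assume "(y, x) \<in> run c i" "i < m" "y \<in> line_rows"
  then obtain j where j: "y = krow i + (2 * d + 1 + j)" "j < 2 * d + 2" by (auto elim: run_rowE)
  from \<open>y \<in> line_rows\<close> show False
    unfolding line_rows_def
  proof
    assume "y \<in> krow ` {..m}"
    then obtain i' where "y = krow i'" by blast
    then show False using row_eq[of i "2 * d + 1 + j" i' 0] j H by simp
  next
    assume "y \<in> crow ` {..<m}"
    then obtain i' where "y = crow i'" by blast
    then show False using row_eq[of i "2 * d + 1 + j" i' "5 * d + 2"] j H d by simp
  qed
qed

lemma krow_line: "i \<le> m \<Longrightarrow> krow i \<in> line_rows" and crow_line: "i < m \<Longrightarrow> crow i \<in> line_rows"
  by (auto simp: line_rows_def)

lemma tile_nonline_row:
  "(y, x) \<in> tile_set \<Longrightarrow> R \<le> y \<Longrightarrow> y \<notin> line_rows \<Longrightarrow> \<exists>c<N. x = xcol c"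
  by (erule tile_cases) (use krow_line in blast, use crow_line in blast, blast, simp)

lemma tile_krow: "(krow i, x) \<in> tile_set \<Longrightarrow> i \<le> m \<Longrightarrow> line_need N m k i \<le> x \<and> x < M"
proof (erule tile_cases)
  fix i' assume "i' \<le> m" "krow i = krow i'" "line_need N m k i' \<le> x" "x < M"
  then show ?thesis using row_eq[of i 0 i' 0] H by simp
next
  fix i' assume "krow i = crow i'"
  then show ?thesis using row_eq[of i 0 i' "5 * d + 2"] H by simp
next
  fix i' c assume "i' < m" "(krow i, x) \<in> run c i'" "i \<le> m"
  moreover have "krow i \<in> line_rows" using \<open>i \<le> m\<close> by (auto simp: line_rows_def)
  ultimately show ?thesis using run_not_line[of "krow i" x c i'] by blast
qed simp

lemma tile_crow: "(crow i, x) \<in> tile_set \<Longrightarrow> i < m \<Longrightarrow> 1 \<le> x \<and> x < M"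
proof (erule tile_cases)
  fix i' assume "crow i = krow i'"
  then show ?thesis using row_eq[of i "5 * d + 2" i' 0] H by simp
next
  fix i' c assume "i' < m" "(crow i, x) \<in> run c i'" "i < m"
  moreover have "crow i \<in> line_rows" using \<open>i < m\<close> by (auto simp: line_rows_def)
  ultimately show ?thesis using run_not_line[of "crow i" x c i'] by blast
qed simp_all

lemma tile_column: "(y, xcol c) \<in> tile_set \<Longrightarrow> c < N \<Longrightarrow> \<exists>i<m. (y, xcol c) \<in> run c i"
proof (erule tile_cases)
  fix i c' assume "i < m" "c' < N" "(y, xcol c) \<in> run c' i" "xcol c = xcol c'" "c < N"
  moreover have "c = c'" using col_eq[of c 0 c' 0] calculation W by simp
  ultimately show ?thesis by blast
next
  assume "xcol c = Z" "c < N"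
  then show ?thesis using col_mono[of c N] W by simp
qed simp_all

lemma tile_Z: "(y, Z) \<in> tile_set \<Longrightarrow> 2 * m + 1 \<le> y \<and> y < R"
proof (erule tile_cases)
  fix i c' assume "c' < N" "Z = xcol c'"
  then show ?thesis using col_mono[of c' N] W by simp
qed simp_all

lemma no_tile_gap:
  assumes "xcol c < x" "x < xcol c + W" "c < N"
  shows "(y, x) \<notin> tile_set"
proof
  assume "(y, x) \<in> tile_set"
  then show False
  proof (cases rule: tile_cases)
    case (Run i c')
    then show ?thesis using col_eq[of c "x - xcol c" c' 0] assms by simp
  next
    case Z
    then show ?thesis using col_mono[of c N] assms by simp
  qed (use assms in simp_all)
qed

lemma card_run: "card (run c i) \<le> 2 * d + 2" and card_run_not_inc: "\<not> hits i c \<Longrightarrow> card (run c i) \<le> 2 * d + 1"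
  and finite_run: "finite (run c i)"
proof -
  have *: "run c i = (\<lambda>j. (krow i + (2 * d + 1 + j), xcol c)) ` {j. j < 2 * d + 2 \<and> (j = 2 * d + 1 \<longrightarrow> hits i c)}"
    by (auto simp: run_def)
  have fin: "finite {j. j < 2 * d + 2 \<and> (j = 2 * d + 1 \<longrightarrow> hits i c)}" by simp
  show "finite (run c i)" unfolding * using fin by (rule finite_imageI)
  have "card (run c i) \<le> card {j. j < 2 * d + 2 \<and> (j = 2 * d + 1 \<longrightarrow> hits i c)}"
    unfolding * using fin by (rule card_image_le)
  also have "\<dots> \<le> card {..<2 * d + 2}" by (intro card_mono) auto
  finally show "card (run c i) \<le> 2 * d + 2" by simp
  show "card (run c i) \<le> 2 * d + 1" if "\<not> hits i c"
  proof -
    have "card (run c i) \<le> card {j. j < 2 * d + 2 \<and> (j = 2 * d + 1 \<longrightarrow> hits i c)}"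
      unfolding * using fin by (rule card_image_le)
    also have "\<dots> \<le> card {..<2 * d + 1}" using that by (intro card_mono) auto
    finally show ?thesis by simp
  qed
qed

end

context hitting_board
begin

lemma H_bounds: "6 * d + 3 \<le> H" "H \<le> 6 * d + 3" and d_bounds: "m + 2 \<le> d" "d \<le> m + 2"
  using H d by simp_all

lemma card_vertical_segment: "card {(y, x). x = x0 \<and> a \<le> y \<and> y < b} = b - (a::nat)"
proof -
  have "{(y, x). x = x0 \<and> a \<le> y \<and> y < b} = (\<lambda>y. (y, x0)) ` {a..<b}" by auto
  then show ?thesis by (simp add: card_image inj_on_def)
qed

lemma card_horizontal_segment: "card {(y, x). y = y0 \<and> a \<le> x \<and> x < b} = b - (a::nat)"
proof -
  have "{(y, x). y = y0 \<and> a \<le> x \<and> x < b} = (\<lambda>x. (y0, x)) ` {a..<b}" by auto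
  then show ?thesis by (simp add: card_image inj_on_def)
qed

lemma finite_segments:
  "finite {(y, x). x = x0 \<and> a \<le> y \<and> y < (b::nat)}" "finite {(y, x). y = y0 \<and> a \<le> x \<and> x < (b::nat)}"
proof -
  have "{(y, x). x = x0 \<and> a \<le> y \<and> y < b} = (\<lambda>y. (y, x0)) ` {a..<b}" by auto
  then show "finite {(y, x). x = x0 \<and> a \<le> y \<and> y < b}" by simp
  have "{(y, x). y = y0 \<and> a \<le> x \<and> x < b} = (\<lambda>x. (y0, x)) ` {a..<b}" by auto
  then show "finite {(y, x). y = y0 \<and> a \<le> x \<and> x < b}" by simp
qed

lemma line_rows_inj: "inj_on krow {..m}" "inj_on crow {..<m}" "krow ` {..m} \<inter> crow ` {..<m} = {}"
proof -
  show "inj_on krow {..m}" using row_eq[of _ 0 _ 0] H by (auto intro!: inj_onI)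
  show "inj_on crow {..<m}" using row_eq[of _ 0 _ 0] H by (auto intro!: inj_onI)
  have "krow i \<noteq> crow j" for i j using row_eq[of i 0 j "5 * d + 2"] H by auto
  then show "krow ` {..m} \<inter> crow ` {..<m} = {}" by blast
qed

lemma card_line_rows: "card line_rows = 2 * m + 1"
proof -
  have "card line_rows = card (krow ` {..m}) + card (crow ` {..<m})"
    unfolding line_rows_def using line_rows_inj(3) by (intro card_Un_disjoint) auto
  also have "\<dots> = Suc m + m" using card_image[OF line_rows_inj(1)] card_image[OF line_rows_inj(2)] by simp
  finally show ?thesis by simp
qed

end

section \<open>Contributions of the columns to the lines\<close>

locale charged_board = hitting_board +
  fixes F :: "square set" and src :: "square \<Rightarrow> square"
  assumes charging: "charging tile_set F src" and target: "(Yt, Z) \<in> F"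
begin

definition vert :: "square \<Rightarrow> bool" where
  "vert t \<longleftrightarrow> snd (src t) = snd t"

lemma inj: "inj_on src (F - tile_set)" and tile_F: "tile_set \<subseteq> F"
  using charging by (auto simp: charging_def)

lemma src_tile: "t \<in> F - tile_set \<Longrightarrow> src t \<in> tile_set"
  and src_aligned: "t \<in> F - tile_set \<Longrightarrow> aligned (src t) t"
  and src_between: "t \<in> F - tile_set \<Longrightarrow> between (src t) t \<subseteq> F"
  using charging by (auto simp: charging_def)

lemma horizontal: "t \<in> F - tile_set \<Longrightarrow> \<not> vert t \<Longrightarrow> fst (src t) = fst t"
  using src_aligned[of t] by (auto simp: vert_def aligned_def)

lemma vertical_between:
  assumes "(y, x) \<in> F - tile_set" "src (y, x) = (y', x)" "y' < v \<and> v < y \<or> y < v \<and> v < y'"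
  shows "(v, x) \<in> F"
  using src_between[OF assms(1)] assms(2,3) by (auto simp: between_def)

lemma horizontal_between:
  assumes "(y, x) \<in> F - tile_set" "src (y, x) = (y, x')" "x' < v \<and> v < x \<or> x < v \<and> v < x'"
  shows "(y, v) \<in> F"
  using src_between[OF assms(1)] assms(2,3) by (auto simp: between_def)

lemma card_le_sources:
  assumes "A \<subseteq> F - tile_set" "src ` A \<subseteq> B" "finite B"
  shows "card A \<le> card B"
  using assms by (meson card_inj_on_le inj inj_on_subset)

text \<open>Crossing a gap between two columns horizontally would take more tiles than a row has.\<close>

lemma nonline_vertical:
  assumes t: "(y, xcol c) \<in> F - tile_set" and y: "R \<le> y" "y \<notin> line_rows" and c: "c \<le> N"
  shows "vert (y, xcol c)"
proof (rule ccontr)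
  assume "\<not> vert (y, xcol c)"
  then obtain x' where x': "src (y, xcol c) = (y, x')" "x' \<noteq> xcol c"
    using horizontal[OF t] by (cases "src (y, xcol c)") (auto simp: vert_def)
  obtain c' where c': "c' < N" "x' = xcol c'"
    using tile_nonline_row src_tile[OF t] x'(1) y by metis
  have "c' \<noteq> c" using x' c' by auto
  \<comment> \<open>A whole gap lies between source and square: the one to the left of column
    \<open>c\<close> or the one to its right.\<close>
  obtain l where l: "l < N" "\<And>v. xcol l < v \<Longrightarrow> v < xcol l + W \<Longrightarrow> x' < v \<and> v < xcol c \<or> xcol c < v \<and> v < x'"
  proof (cases "c' < c")
    case True
    have "c' \<le> c - 1" using True by simp
    then have "xcol c' \<le> xcol (c - 1)" by (simp add: mult_le_mono1)
    moreover have "xcol (c - 1) + W = xcol c" using True by (cases c) auto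
    ultimately have "x' < v \<and> v < xcol c" if "xcol (c - 1) < v" "v < xcol (c - 1) + W" for v
      using that c'(2) by linarith
    then show ?thesis using that[of "c - 1"] c True by auto
  next
    case False
    then have "c < c'" using \<open>c' \<noteq> c\<close> by simp
    then have "xcol c + W \<le> xcol c'" by (rule col_mono)
    then have "xcol c < v \<and> v < x'" if "xcol c < v" "v < xcol c + W" for v
      using that c'(2) by linarith
    then show ?thesis using that[of c] c' \<open>c < c'\<close> by auto
  qed
  let ?G = "{(v, x). v = y \<and> Suc (xcol l) \<le> x \<and> x < xcol l + W}"
  have G: "?G \<subseteq> F - tile_set"
    using horizontal_between[OF t x'(1)] l(2) no_tile_gap[OF _ _ l(1)] by auto
  let ?T = "(\<lambda>c. (y, xcol c)) ` {..<N}"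
  have row: "u \<in> ?T" if "u \<in> tile_set" "fst u = y" for u
    using tile_nonline_row[of y "snd u"] that y by (cases u) auto
  \<comment> \<open>The gap has no tile in any row, so its squares can be charged only within row
    \<open>y\<close>.\<close>
  have "src u \<in> ?T" if "u \<in> ?G" for u
  proof -
    have u: "u \<in> F - tile_set" using G that by blast
    have "\<not> vert u"
    proof
      assume "vert u"
      then have "(fst (src u), snd u) \<in> tile_set" using src_tile[OF u] by (cases "src u") (simp add: vert_def)
      then show False using no_tile_gap[of l "snd u" "fst (src u)"] l(1) that by auto
    qed
    then have "fst (src u) = y" using horizontal[OF u] that by auto
    then show ?thesis using row src_tile[OF u] by blast
  qed
  moreover have "src (y, xcol c) \<in> ?T" using c' x' by auto
  \<comment> \<open>The \<open>N\<close> squares of the gap and the square itself compete for at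
    most \<open>N\<close> tiles.\<close>
  ultimately have "card (insert (y, xcol c) ?G) \<le> card ?T"
    using G t by (intro card_le_sources) auto
  also have "\<dots> \<le> N" using card_image_le[of "{..<N}"] by simp
  finally have "card (insert (y, xcol c) ?G) \<le> N" .
  moreover have "(y, xcol c) \<notin> ?G"
  proof
    assume "(y, xcol c) \<in> ?G"
    then have "Suc (xcol l) \<le> xcol c" "xcol c < xcol l + W" by (simp_all only: mem_Collect_eq case_prod_conv)
    from l(2)[OF Suc_le_lessD[OF this(1)] this(2)] show False by simp
  qed
  ultimately show False
    using card_horizontal_segment[of y "Suc (xcol l)" "xcol l + W"] finite_segments(2)[of y "Suc (xcol l)" "xcol l + W"] W
    by simp
qed

text \<open>Column \<open>Z\<close> has \<open>R\<close> squares from row \<open>R\<close> to the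
  target, but only \<open>R - (2 * m + 1)\<close> tiles above them. At least
  \<open>2 * m + 1\<close> squares are charged horizontally, which \<open>nonline_vertical\<close>
  allows only in line rows. There are just \<open>2 * m + 1\<close> of these, so each of them must
  reach column \<open>Z\<close>.\<close>

lemma line_collected:
  assumes "y \<in> line_rows"
  shows "(y, Z) \<in> F - tile_set \<and> \<not> vert (y, Z)"
proof -
  let ?A = "{(v, x). x = Z \<and> R \<le> v \<and> v < Suc Yt}"
  have lr: "v < Yt" "R \<le> v" if "v \<in> line_rows" for v
  proof -
    show "R \<le> v" using that by (auto simp: line_rows_def)
    from that show "v < Yt" unfolding line_rows_def
    proof
      assume "v \<in> krow ` {..m}"
      then show ?thesis by (auto simp: mult_le_mono1 less_Suc_eq_le)
    next
      assume "v \<in> crow ` {..<m}"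
      then obtain i where i: "i < m" "v = crow i" by auto
      then show ?thesis using row_mono[of i m] H by simp
    qed
  qed
  have Z: "(v, Z) \<notin> tile_set" if "R \<le> v" for v using tile_Z that by fastforce
  have tF: "(Yt, Z) \<in> F - tile_set" using target Z by simp
  have "vert (Yt, Z)"
    using nonline_vertical[of Yt N] tF lr(1) by fastforce
  then obtain y0 where y0: "src (Yt, Z) = (y0, Z)"
    by (cases "src (Yt, Z)") (auto simp: vert_def)
  then have "y0 < R" using src_tile[OF tF] tile_Z by metis
  have A: "?A \<subseteq> F - tile_set"
  proof
    fix u assume "u \<in> ?A"
    then obtain v where v: "u = (v, Z)" "R \<le> v" "v \<le> Yt" by auto
    have "(v, Z) \<in> F"
    proof (cases "v = Yt")
      case False
      then show ?thesis using vertical_between[OF tF y0, of v] \<open>y0 < R\<close> v by simp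
    qed (use tF in simp)
    then show "u \<in> F - tile_set" using v Z by simp
  qed
  let ?B = "{u \<in> ?A. vert u}"
  have finA: "finite ?A" by (rule finite_segments)
  have "card ?B \<le> card {(v, x). x = Z \<and> 2 * m + 1 \<le> v \<and> v < R}"
  proof (rule card_le_sources)
    show "?B \<subseteq> F - tile_set" using A by blast
    show "src ` ?B \<subseteq> {(v, x). x = Z \<and> 2 * m + 1 \<le> v \<and> v < R}"
    proof
      fix s assume "s \<in> src ` ?B"
      then obtain u where u: "u \<in> ?A" "vert u" "s = src u" by blast
      have "s \<in> tile_set" using u A src_tile by blast
      moreover have "snd s = Z" using u by (auto simp: vert_def)
      ultimately show "s \<in> {(v, x). x = Z \<and> 2 * m + 1 \<le> v \<and> v < R}"
        using tile_Z[of "fst s"] by (cases s) auto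
    qed
  qed (rule finite_segments)
  then have B: "card ?B \<le> R - (2 * m + 1)" by (simp only: card_vertical_segment)
  have "card ?A = Suc Yt - R" by (rule card_vertical_segment)
  moreover have "card (?A - ?B) = card ?A - card ?B" using finA by (intro card_Diff_subset) auto
  moreover have "2 * m + 1 \<le> R"
  proof -
    have "2 * m \<le> m * H" using H by simp
    then show ?thesis using R by linarith
  qed
  ultimately have "2 * m + 1 \<le> card (?A - ?B)" using B R by simp
  moreover have sub: "?A - ?B \<subseteq> (\<lambda>y. (y, Z)) ` line_rows"
  proof
    fix u assume u: "u \<in> ?A - ?B"
    then obtain v where v: "u = (v, Z)" "R \<le> v" by auto
    have "v \<in> line_rows"
      using nonline_vertical[of v N] u v A by auto
    then show "u \<in> (\<lambda>y. (y, Z)) ` line_rows" using v by blast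
  qed
  moreover have "finite line_rows" by (simp add: line_rows_def)
  moreover have "card ((\<lambda>y. (y, Z)) ` line_rows) = 2 * m + 1"
    using card_line_rows by (subst card_image) (auto simp: inj_on_def)
  ultimately have "?A - ?B = (\<lambda>y. (y, Z)) ` line_rows"
    by (intro card_seteq) auto
  then have "(y, Z) \<in> ?A - ?B" using assms by blast
  then show ?thesis using A by blast
qed

definition contributes :: "nat \<Rightarrow> nat set" where
  "contributes y = {c. c < N \<and> (y, xcol c) \<in> F - tile_set \<and> vert (y, xcol c)}"

text \<open>The same count along a row: \<open>M\<close> squares from \<open>M\<close> to
  \<open>Z\<close> are filled, at most \<open>M - a\<close> tiles stand in the row, so
  \<open>a\<close> squares are charged vertically. Their sources lie in element columns, since the
  square in column \<open>Z\<close> is charged horizontally by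
  \<open>line_collected\<close>.\<close>

lemma line_contributions:
  assumes y: "y \<in> line_rows" and tiles: "\<And>x. (y, x) \<in> tile_set \<Longrightarrow> a \<le> x \<and> x < M" and "a \<le> M"
  shows "a \<le> card (contributes y)"
proof -
  have yR: "R \<le> y" using y by (auto simp: line_rows_def)
  have t: "(y, Z) \<in> F - tile_set" "\<not> vert (y, Z)" using line_collected[OF y] by auto
  then obtain x0 where x0: "src (y, Z) = (y, x0)"
    using horizontal[OF t] by (cases "src (y, Z)") auto
  then have "x0 < M" using src_tile[OF t(1)] tiles by metis
  let ?A = "{(v, x). v = y \<and> M \<le> x \<and> x < Suc Z}"
  have A: "?A \<subseteq> F - tile_set"
  proof
    fix u assume "u \<in> ?A"
    then obtain x where x: "u = (y, x)" "M \<le> x" "x \<le> Z" by auto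
    have "(y, x) \<in> F"
    proof (cases "x = Z")
      case False
      then show ?thesis using horizontal_between[OF t(1) x0, of x] \<open>x0 < M\<close> x by simp
    qed (use t in simp)
    then show "u \<in> F - tile_set" using x tiles[of x] by auto
  qed
  let ?B = "{u \<in> ?A. \<not> vert u}"
  have finA: "finite ?A" by (rule finite_segments)
  have "card ?B \<le> card {(v, x). v = y \<and> a \<le> x \<and> x < M}"
  proof (rule card_le_sources)
    show "?B \<subseteq> F - tile_set" using A by blast
    show "src ` ?B \<subseteq> {(v, x). v = y \<and> a \<le> x \<and> x < M}"
    proof
      fix s assume "s \<in> src ` ?B"
      then obtain u where u: "u \<in> ?A" "\<not> vert u" "s = src u" by blast
      have "s \<in> tile_set" using u A src_tile by blast
      moreover have "fst s = y" using horizontal[of u] u A by auto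
      ultimately show "s \<in> {(v, x). v = y \<and> a \<le> x \<and> x < M}"
        using tiles[of "snd s"] by (cases s) auto
    qed
  qed (rule finite_segments)
  then have B: "card ?B \<le> M - a" by (simp only: card_horizontal_segment)
  have "card ?A = Suc Z - M" by (rule card_horizontal_segment)
  moreover have "card (?A - ?B) = card ?A - card ?B" using finA by (intro card_Diff_subset) auto
  ultimately have "a \<le> card (?A - ?B)" using B M assms(3) by simp
  also have "?A - ?B \<subseteq> (\<lambda>c. (y, xcol c)) ` contributes y"
  proof
    fix u assume u: "u \<in> ?A - ?B"
    then obtain x where x: "u = (y, x)" "M \<le> x" by auto
    have uF: "u \<in> F - tile_set" "vert u" using u A by auto
    have "(fst (src u), x) \<in> tile_set"
      using src_tile[OF uF(1)] uF(2) x(1) by (cases "src u") (auto simp: vert_def)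
    then have "(\<exists>c<N. x = xcol c) \<or> x = Z"
      by (cases rule: tile_cases) (use x in auto)
    then obtain c where "c < N" "x = xcol c" using uF t x by auto
    then show "u \<in> (\<lambda>c. (y, xcol c)) ` contributes y"
      using uF x by (auto simp: contributes_def)
  qed
  then have "card (?A - ?B) \<le> card ((\<lambda>c. (y, xcol c)) ` contributes y)"
    by (intro card_mono) (auto simp: contributes_def)
  also have "\<dots> \<le> card (contributes y)" by (intro card_image_le) (auto simp: contributes_def)
  finally show ?thesis .
qed

lemma krow_contributions: "i \<le> m \<Longrightarrow> line_need N m k i \<le> card (contributes (krow i))"
proof (rule line_contributions)
  assume i: "i \<le> m"
  show "krow i \<in> line_rows" using i by (rule krow_line)
  show "line_need N m k i \<le> x \<and> x < M" if "(krow i, x) \<in> tile_set" for x using tile_krow[OF that i] .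
  have "line_need N m k i \<le> N" using kN by (simp add: line_need_def)
  also have "N \<le> M" using M W by simp
  finally show "line_need N m k i \<le> M" .
qed

lemma crow_contributions: "i < m \<Longrightarrow> 1 \<le> card (contributes (crow i))"
proof (rule line_contributions)
  assume i: "i < m"
  show "crow i \<in> line_rows" using i by (rule crow_line)
  show "1 \<le> x \<and> x < M" if "(crow i, x) \<in> tile_set" for x using tile_crow[OF that i] .
  show "1 \<le> M" using M by simp
qed

end

section \<open>Counting the charges of a single column\<close>

locale charged_column = charged_board +
  fixes c :: nat
  assumes c: "c < N"
begin

definition kap :: "nat \<Rightarrow> bool" where
  "kap i \<longleftrightarrow> c \<in> contributes (krow i)"

definition fullU :: "nat \<Rightarrow> bool" where
  "fullU i \<longleftrightarrow> (\<forall>a. 1 \<le> a \<and> a \<le> 2 * d \<longrightarrow> (krow i + a, xcol c) \<in> F)"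

text \<open>The lower zone of a band. The middle line at \<open>5 * d + 2\<close> is excluded
  because its square may be filled from the row, and offset \<open>4 * d + 2\<close> because it is a
  tile in an incident column.\<close>

definition D_offsets :: "nat set" where
  "D_offsets = {4 * d + 3..<H} - {5 * d + 2}"

definition fullD :: "nat \<Rightarrow> bool" where
  "fullD i \<longleftrightarrow> (\<forall>a \<in> D_offsets. (krow i + a, xcol c) \<in> F)"

definition charged :: "nat \<times> nat \<Rightarrow> bool" where
  "charged q \<longleftrightarrow> (krow (fst q) + snd q, xcol c) \<in> F - tile_set \<and> vert (krow (fst q) + snd q, xcol c)"

lemma card_D_offsets: "card D_offsets = 2 * d - 1"
  unfolding D_offsets_def unfolding H using d_bounds by simp

lemma charged_src:
  assumes "charged (i, a)"
  obtains i' j where "i' < m" "src (krow i + a, xcol c) \<in> run c i'"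
    "src (krow i + a, xcol c) = (krow i' + (2 * d + 1 + j), xcol c)" "j < 2 * d + 2" "j = 2 * d + 1 \<longrightarrow> hits i' c"
proof -
  let ?t = "(krow i + a, xcol c)"
  have "src ?t \<in> tile_set" "snd (src ?t) = xcol c"
    using assms src_tile by (auto simp: charged_def vert_def)
  then obtain i' where "i' < m" "src ?t \<in> run c i'"
    using tile_column[of "fst (src ?t)" c] c by (cases "src ?t") auto
  then obtain j where j: "fst (src ?t) = krow i' + (2 * d + 1 + j)" "j < 2 * d + 2" "j = 2 * d + 1 \<longrightarrow> hits i' c"
    using run_rowE[of "fst (src ?t)" "snd (src ?t)" c i'] by auto
  have "src ?t = (krow i' + (2 * d + 1 + j), xcol c)"
    using j(1) \<open>snd (src ?t) = xcol c\<close> by (simp add: prod_eq_iff)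
  with \<open>i' < m\<close> \<open>src ?t \<in> run c i'\<close> show ?thesis using j(2,3) by (rule that)
qed

lemma run_src:
  assumes "s \<in> run c i'"
  obtains j where "s = (krow i' + (2 * d + 1 + j), xcol c)" "j < 2 * d + 2"
  using assms by (auto simp: run_def)

lemma not_tile:
  assumes "a < H" "\<not> (2 * d + 1 \<le> a \<and> a \<le> 4 * d + 2 \<and> (a = 4 * d + 2 \<longrightarrow> hits i c))"
  shows "(krow i + a, xcol c) \<notin> tile_set"
proof
  assume "(krow i + a, xcol c) \<in> tile_set"
  then obtain i' where "i' < m" "(krow i + a, xcol c) \<in> run c i'" using tile_column c by blast
  then obtain j where j: "krow i + a = krow i' + (2 * d + 1 + j)" "j < 2 * d + 2" "j = 2 * d + 1 \<longrightarrow> hits i' c"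
    by (auto elim: run_rowE)
  then have "i = i' \<and> a = 2 * d + 1 + j" using assms(1) H by (intro row_eq) auto
  then show False using assms(2) j by auto
qed

lemma offset_not_line:
  assumes "a < H" "a \<noteq> 0" "a \<noteq> 5 * d + 2"
  shows "krow i + a \<notin> line_rows"
proof
  assume "krow i + a \<in> line_rows"
  then show False
    unfolding line_rows_def
  proof (elim UnE imageE)
    fix i' assume "krow i + a = krow i'"
    then show False using row_eq[of i a i' 0] assms H_bounds by simp
  next
    fix i' assume "krow i + a = crow i'"
    then show False using row_eq[of i a i' "5 * d + 2"] assms H_bounds by simp
  qed
qed

text \<open>Off the lines a filled square that is no tile must be charged vertically, by
  \<open>nonline_vertical\<close>. The last condition on \<open>a\<close> excludes the run of the
  band.\<close>

lemma chargedI: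
  assumes "(krow i + a, xcol c) \<in> F" "a < H" "a \<noteq> 0" "a \<noteq> 5 * d + 2"
    "\<not> (2 * d + 1 \<le> a \<and> a \<le> 4 * d + 2 \<and> (a = 4 * d + 2 \<longrightarrow> hits i c))"
  shows "charged (i, a)"
proof -
  have "(krow i + a, xcol c) \<in> F - tile_set" using assms not_tile by blast
  moreover have "vert (krow i + a, xcol c)"
    using calculation offset_not_line[OF assms(2-4)] c by (intro nonline_vertical) auto
  ultimately show ?thesis by (simp add: charged_def)
qed

lemma fullU_charged: "fullU i \<Longrightarrow> 1 \<le> a \<Longrightarrow> a \<le> 2 * d \<Longrightarrow> charged (i, a)"
  using H_bounds by (intro chargedI) (auto simp: fullU_def)

lemma fullD_charged: "fullD i \<Longrightarrow> a \<in> D_offsets \<Longrightarrow> charged (i, a)"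
  by (intro chargedI) (auto simp: fullD_def D_offsets_def)

lemma kap_charged: "kap i \<longleftrightarrow> charged (i, 0)"
  using c by (simp add: kap_def charged_def contributes_def)

lemma row_mono_le: "i \<le> j \<Longrightarrow> krow i \<le> krow j"
  by simp

text \<open>A charge that passes over a zone fills it, as everything between a square and its source
  is filled. Read backwards, here and in the next two lemmas: a zone that is not full is a wall, and
  the sources of squares on one side of it lie on that side.\<close>

lemma fullU_if_from_below:
  assumes "charged (i, a)" "src (krow i + a, xcol c) \<in> run c i'" "krow i + a \<le> krow j" "j \<le> i'"
  shows "fullU j"
  unfolding fullU_def
proof (intro allI impI)
  fix b assume b: "1 \<le> b \<and> b \<le> 2 * d"
  obtain jj where s: "src (krow i + a, xcol c) = (krow i' + (2 * d + 1 + jj), xcol c)"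
    using assms(2) by (rule run_src)
  have "krow i + a < krow j + b \<and> krow j + b < krow i' + (2 * d + 1 + jj)"
    using assms(3) b row_mono_le[OF assms(4)] by linarith
  then show "(krow j + b, xcol c) \<in> F"
    using assms(1) by (intro vertical_between[OF _ s]) (auto simp: charged_def)
qed

lemma fullU_if_from_above:
  assumes "charged (i, a)" "src (krow i + a, xcol c) \<in> run c i'" "krow j + 2 * d < krow i + a" "i' < j"
  shows "fullU j"
  unfolding fullU_def
proof (intro allI impI)
  fix b assume b: "1 \<le> b \<and> b \<le> 2 * d"
  obtain jj where s: "src (krow i + a, xcol c) = (krow i' + (2 * d + 1 + jj), xcol c)" "jj < 2 * d + 2"
    using assms(2) by (rule run_src)
  have "krow i' + (2 * d + 1 + jj) < krow j + b \<and> krow j + b < krow i + a"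
    using assms(3) b row_mono[OF assms(4)] s(2) H_bounds by linarith
  then show "(krow j + b, xcol c) \<in> F"
    using assms(1) by (intro vertical_between[OF _ s(1)]) (auto simp: charged_def)
qed

lemma fullD_if_from_above:
  assumes "charged (i, a)" "src (krow i + a, xcol c) \<in> run c i'" "krow j + H \<le> krow i + a" "i' \<le> j"
  shows "fullD j"
  unfolding fullD_def
proof
  fix b assume "b \<in> D_offsets"
  then have b: "4 * d + 3 \<le> b" "b < H" by (auto simp: D_offsets_def)
  obtain jj where s: "src (krow i + a, xcol c) = (krow i' + (2 * d + 1 + jj), xcol c)" "jj < 2 * d + 2"
    using assms(2) by (rule run_src)
  have "krow i' + (2 * d + 1 + jj) < krow j + b \<and> krow j + b < krow i + a"
    using assms(3) b row_mono_le[OF assms(4)] s(2) by linarith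
  then show "(krow j + b, xcol c) \<in> F"
    using assms(1) by (intro vertical_between[OF _ s(1)]) (auto simp: charged_def)
qed

text \<open>The tile that serves line \<open>i\<close> comes either from below, across the upper
  zone of band \<open>i\<close>, or from above, across the lower zone of band
  \<open>i - 1\<close>.\<close>

lemma kap_full:
  assumes "kap i"
  shows "i < m \<and> fullU i \<or> 0 < i \<and> fullD (i - 1)"
proof -
  have ch: "charged (i, 0)" using assms by (simp add: kap_charged)
  then obtain i' where i': "i' < m" "src (krow i + 0, xcol c) \<in> run c i'" by (rule charged_src)
  show ?thesis
  proof (cases "i \<le> i'")
    case True
    then show ?thesis using fullU_if_from_below[OF ch i'(2)] i'(1) by auto
  next
    case False
    then have "krow (i - 1) + H \<le> krow i + 0" using row_mono[of "i - 1" i] by simp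
    then show ?thesis using fullD_if_from_above[OF ch i'(2)] False by auto
  qed
qed

lemma card_charged:
  assumes "finite Q" "\<And>q. q \<in> Q \<Longrightarrow> snd q < H \<and> charged q" "finite J"
    "\<And>i a i'. (i, a) \<in> Q \<Longrightarrow> i' < m \<Longrightarrow> src (krow i + a, xcol c) \<in> run c i' \<Longrightarrow> i' \<in> J"
  shows "card Q \<le> card J * (2 * d + 2)"
proof -
  let ?f = "\<lambda>q. (krow (fst q) + snd q, xcol c)"
  have "inj_on ?f Q"
  proof (rule inj_onI)
    fix q q' assume "q \<in> Q" "q' \<in> Q" "?f q = ?f q'"
    then show "q = q'" using row_eq[of "fst q" "snd q" "fst q'" "snd q'"] assms(2) by (auto simp: prod_eq_iff)
  qed
  then have "card Q = card (?f ` Q)" by (simp add: card_image)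
  also have "\<dots> \<le> card (\<Union>i\<in>J. run c i)"
  proof (rule card_le_sources)
    show "?f ` Q \<subseteq> F - tile_set" using assms(2) by (auto simp: charged_def)
    show "src ` ?f ` Q \<subseteq> (\<Union>i\<in>J. run c i)"
    proof
      fix s assume "s \<in> src ` ?f ` Q"
      then obtain i a where q: "(i, a) \<in> Q" "s = src (krow i + a, xcol c)" by auto
      have "charged (i, a)" using assms(2) q(1) by blast
      then obtain i' where "i' < m" "src (krow i + a, xcol c) \<in> run c i'" by (rule charged_src)
      then show "s \<in> (\<Union>i\<in>J. run c i)" using assms(4) q by blast
    qed
    show "finite (\<Union>i\<in>J. run c i)" using assms(3) finite_run by blast
  qed
  also have "\<dots> \<le> (\<Sum>i\<in>J. card (run c i))" by (rule card_UN_le[OF assms(3)])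
  also have "\<dots> \<le> (\<Sum>i\<in>J. 2 * d + 2)" by (intro sum_mono card_run)
  also have "\<dots> = card J * (2 * d + 2)" by simp
  finally show ?thesis .
qed

text \<open>The squares of full zones, the served line squares and the extra squares
  \<open>E\<close> are disjoint and have different sources. These lie in the runs of the bands
  \<open>J\<close>, each with at most \<open>2 * d + 2\<close> tiles.\<close>

lemma count_zones:
  assumes fin: "finite IU" "finite ID" "finite IK" "finite E" "finite J"
    and full: "\<And>i. i \<in> IU \<Longrightarrow> fullU i" "\<And>i. i \<in> ID \<Longrightarrow> fullD i" "\<And>i. i \<in> IK \<Longrightarrow> kap i"
    and E: "\<And>i a. (i, a) \<in> E \<Longrightarrow> a \<in> {2 * d + 1..<H} \<and> charged (i, a) \<and> (i \<in> ID \<longrightarrow> a \<notin> D_offsets)"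
    and J: "\<And>i a i'. (i, a) \<in> IU \<times> {1..2 * d} \<union> ID \<times> D_offsets \<union> IK \<times> {0} \<union> E \<Longrightarrow> i' < m \<Longrightarrow>
      src (krow i + a, xcol c) \<in> run c i' \<Longrightarrow> i' \<in> J"
  shows "card IU * (2 * d) + card ID * (2 * d - 1) + card IK + card E \<le> card J * (2 * d + 2)"
proof -
  let ?Q = "IU \<times> {1..2 * d} \<union> ID \<times> D_offsets \<union> IK \<times> {0} \<union> E"
  have fD: "finite D_offsets" by (simp add: D_offsets_def)
  have "card ?Q = card (IU \<times> {1..2 * d} \<union> ID \<times> D_offsets \<union> IK \<times> {0}) + card E"
    using fin fD E by (intro card_Un_disjoint) fastforce+
  also have "card (IU \<times> {1..2 * d} \<union> ID \<times> D_offsets \<union> IK \<times> {0}) =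
      card (IU \<times> {1..2 * d} \<union> ID \<times> D_offsets) + card (IK \<times> {0::nat})"
    using fin fD by (intro card_Un_disjoint) (auto simp: D_offsets_def)
  also have "card (IU \<times> {1..2 * d} \<union> ID \<times> D_offsets) = card (IU \<times> {1..2 * d}) + card (ID \<times> D_offsets)"
    using fin fD by (intro card_Un_disjoint) (auto simp: D_offsets_def)
  finally have "card ?Q = card IU * (2 * d) + card ID * (2 * d - 1) + card IK + card E"
    by (simp add: card_cartesian_product card_D_offsets)
  moreover have "card ?Q \<le> card J * (2 * d + 2)"
  proof (rule card_charged)
    show "finite ?Q" using fin fD by auto
    fix q assume "q \<in> ?Q"
    then consider "fst q \<in> IU" "1 \<le> snd q" "snd q \<le> 2 * d" | "fst q \<in> ID" "snd q \<in> D_offsets"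
      | "fst q \<in> IK" "snd q = 0" | "(fst q, snd q) \<in> E" by auto
    then show "snd q < H \<and> charged q"
    proof cases
      case 1
      then show ?thesis using fullU_charged[OF full(1)] H_bounds by (cases q) auto
    next
      case 2
      then show ?thesis using fullD_charged[OF full(2)] by (cases q) (auto simp: D_offsets_def)
    next
      case 3
      then show ?thesis using full(3) kap_charged H_bounds by (cases q) auto
    next
      case 4
      then show ?thesis using E by (cases q) auto
    qed
  qed (use fin J in auto)
  ultimately show ?thesis by simp
qed

definition "IU = {i. i < m \<and> fullU i}"
definition "ID = {i. i < m \<and> fullD i}"
definition "IK = {i. i \<le> m \<and> kap i}"

lemma finite_zones: "finite IU" "finite ID" "finite IK"
  by (auto simp: IU_def ID_def IK_def)

lemma IK_subset: "IK \<subseteq> IU \<union> Suc ` ID"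
proof
  fix i assume i: "i \<in> IK"
  then have k: "i \<le> m" "kap i" by (auto simp: IK_def)
  from kap_full[OF k(2)] show "i \<in> IU \<union> Suc ` ID"
  proof
    assume "i < m \<and> fullU i"
    then show ?thesis by (simp add: IU_def)
  next
    assume "0 < i \<and> fullD (i - 1)"
    then have "i = Suc (i - 1)" "i - 1 \<in> ID" using k by (auto simp: ID_def)
    then show ?thesis by blast
  qed
qed

text \<open>A full zone costs at least \<open>2 * d - 1 = 2 * m + 3\<close> tiles and the
  \<open>m\<close> served lines cost \<open>m\<close> more. With \<open>m * (2 * d + 2)\<close>
  tiles in all, \<open>m + 1\<close> full zones are out of reach. Conversely,
  \<open>IK_subset\<close> demands at least as many full zones as served lines.\<close>

lemma card_zones:
  assumes "m \<le> card IK"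
  shows "card IU + card ID = m" "card IK = m"
proof -
  have "card IU * (2 * d) + card ID * (2 * d - 1) + card IK + card ({} :: (nat \<times> nat) set) \<le> card {..<m} * (2 * d + 2)"
    by (rule count_zones) (auto simp: finite_zones IU_def ID_def IK_def)
  then have 1: "card IU * (2 * d) + card ID * (2 * d - 1) + m \<le> m * (2 * d + 2)" using assms by simp
  have "(card IU + card ID) * (2 * d - 1) \<le> card IU * (2 * d) + card ID * (2 * d - 1)"
    by (simp add: add_mult_distrib)
  then have "(card IU + card ID) * (2 * d - 1) + m \<le> m * (2 * d + 2)" using 1 by linarith
  moreover have "2 * d - 1 = 2 * m + 3" "2 * d + 2 = 2 * m + 6" using d_bounds by linarith+
  ultimately have "(card IU + card ID) * (2 * m + 3) + m \<le> m * (2 * m + 6)" by (simp only:)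
  moreover have "m * (2 * m + 6) < (m + 1) * (2 * m + 3) + m" by (simp add: algebra_simps)
  ultimately have "(card IU + card ID) * (2 * m + 3) < (m + 1) * (2 * m + 3)" by linarith
  then have "card IU + card ID < m + 1" by (simp only: mult_less_cancel2)
  then have le: "card IU + card ID \<le> m" by simp
  have "card IK \<le> card (IU \<union> Suc ` ID)" using IK_subset finite_zones by (intro card_mono) auto
  also have "\<dots> \<le> card IU + card (Suc ` ID)" by (rule card_Un_le)
  also have "card (Suc ` ID) = card ID" by (simp add: card_image)
  finally show "card IU + card ID = m" "card IK = m" using le assms by auto
qed

text \<open>Both estimates are tight. So each served line has exactly one full zone next to it, and
  no other zone is full.\<close>

lemma zones_exact:
  assumes "m \<le> card IK"
  shows "IK = IU \<union> Suc ` ID" "IU \<inter> Suc ` ID = {}"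
proof -
  note z = card_zones[OF assms]
  have c1: "card (Suc ` ID) = card ID" by (simp add: card_image)
  have "card (IU \<union> Suc ` ID) \<le> m" using card_Un_le[of IU "Suc ` ID"] z c1 by simp
  then show eq: "IK = IU \<union> Suc ` ID"
    using IK_subset finite_zones z by (intro card_seteq) auto
  have "card (IU \<union> Suc ` ID) + card (IU \<inter> Suc ` ID) = m"
    using card_Un_Int[of IU "Suc ` ID"] finite_zones c1 z by simp
  then have "card (IU \<inter> Suc ` ID) = 0" using z eq by simp
  then show "IU \<inter> Suc ` ID = {}" using finite_zones by simp
qed

text \<open>This makes up and down exclusive: a column that serves all inner lines cannot serve both
  the first and the last one.\<close>

lemma not_all_kap: "\<not> (\<forall>i\<le>m. kap i)"
proof
  assume "\<forall>i\<le>m. kap i"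
  then have "IK = {..m}" by (auto simp: IK_def)
  then show False using card_zones(2) by simp
qed

text \<open>A column that serves the lines \<open>0\<close> to \<open>m - 1\<close> uses upper zones
  only. These and the line squares take all but \<open>m\<close> of its at most
  \<open>m * (2 * d + 2)\<close> tiles. To reach a middle line it would have to fill half of a lower
  zone, at least \<open>d - 1 = m + 1\<close> squares; here \<open>d = m + 2\<close> is needed
  exactly.\<close>

lemma unchosen_no_contribution:
  assumes kap: "\<And>i. i < m \<Longrightarrow> kap i" and "\<not> kap m" and i: "i < m"
  shows "c \<notin> contributes (crow i)"
proof
  assume "c \<in> contributes (crow i)"
  then have ch: "charged (i, 5 * d + 2)" by (simp add: charged_def contributes_def add.assoc)
  have "IK = {..<m}" using kap assms(2) by (auto simp: IK_def le_less)
  then have "m \<le> card IK" by simp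
  note ex = zones_exact[OF this]
  \<comment> \<open>Otherwise the line \<open>j\<close> below the first full lower zone is served,
    and the upper zone below that line is a wall. The \<open>j\<close> bands above it would have to
    pay for \<open>j\<close> upper zones, \<open>j + 1\<close> line squares and this lower zone, but
    their surplus is too small.\<close>
  have noD: "ID = {}"
  proof (rule ccontr)
    assume "ID \<noteq> {}"
    define j where "j = Suc (LEAST i. i \<in> ID)"
    have j: "j - 1 \<in> ID" using \<open>ID \<noteq> {}\<close> by (auto simp: j_def intro: LeastI)
    have least: "i \<notin> ID" if "i < j - 1" for i using that by (auto simp: j_def dest: not_less_Least)
    have "j \<in> IK" using ex(1) j by (auto simp: j_def)
    then have jm: "j < m" using assms(2) by (auto simp: IK_def le_less)
    have "j \<notin> IU" using ex(2) j by (auto simp: j_def)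
    then have nU: "\<not> fullU j" using jm by (simp add: IU_def)
    have U: "i \<in> IU" if "i < j" for i
    proof -
      have "i \<in> IK" using that jm kap by (auto simp: IK_def)
      moreover have "i \<notin> Suc ` ID"
      proof
        assume "i \<in> Suc ` ID"
        then obtain i0 where "i = Suc i0" "i0 \<in> ID" by auto
        then show False using least[of i0] that by simp
      qed
      ultimately show ?thesis using ex(1) by blast
    qed
    have j0: "0 < j" by (simp add: j_def)
    have "card {..<j} * (2 * d) + card {j - 1} * (2 * d - 1) + card {..j} + card ({} :: (nat \<times> nat) set)
        \<le> card {..<j} * (2 * d + 2)"
    proof (rule count_zones)
      fix i a i'
      assume q: "(i, a) \<in> {..<j} \<times> {1..2 * d} \<union> {j - 1} \<times> D_offsets \<union> {..j} \<times> {0} \<union> {}"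
        and s: "i' < m" "src (krow i + a, xcol c) \<in> run c i'"
      from q consider "i < j" "1 \<le> a" "a \<le> 2 * d" | "i = j - 1" "a \<in> D_offsets" | "i \<le> j" "a = 0" by auto
      then have "krow i + a \<le> krow j \<and> charged (i, a)"
      proof cases
        case 1
        then show ?thesis
          using row_mono[of i j] fullU_charged[of i a] U[of i] H_bounds by (auto simp: IU_def)
      next
        case 2
        then show ?thesis
          using row_mono[of i j] fullD_charged[of i a] j j0 by (auto simp: ID_def D_offsets_def)
      next
        case 3
        then show ?thesis using kap[of i] jm kap_charged[of i] by auto
      qed
      then show "i' \<in> {..<j}" using fullU_if_from_below[OF _ s(2), of j] nU by (cases "i' < j") auto
    qed (use U j jm kap in \<open>auto simp: IU_def ID_def\<close>)
    then have "j * (2 * d) + (2 * d - 1) + (j + 1) \<le> j * (2 * d + 2)" by simp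
    then have "2 * d + (2 * d - 1) \<le> j + 2 * d" by (simp add: algebra_simps)
    then show False using jm d_bounds by linarith
  qed
  have U: "IU = {..<m}" using ex(1) noD \<open>IK = {..<m}\<close> by simp
  obtain i' where i': "i' < m" "src (krow i + (5 * d + 2), xcol c) \<in> run c i'" using ch by (rule charged_src)
  obtain jj where s: "src (krow i + (5 * d + 2), xcol c) = (krow i' + (2 * d + 1 + jj), xcol c)" "jj < 2 * d + 2"
    using i'(2) by (rule run_src)
  \<comment> \<open>The part of the lower zone crossed on the way to the middle line: above it if
    the source lies above, below it otherwise.\<close>
  define lo where "lo = (if i' \<le> i then 4 * d + 3 else 5 * d + 3)"
  define hi where "hi = (if i' \<le> i then 5 * d + 2 else H)"
  have E: "charged (i, a)" if "lo \<le> a" "a < hi" for a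
  proof (rule chargedI)
    show "(krow i + a, xcol c) \<in> F"
    proof (rule vertical_between[OF _ s(1)])
      show "(krow i + (5 * d + 2), xcol c) \<in> F - tile_set" using ch by (simp add: charged_def)
      show "krow i' + (2 * d + 1 + jj) < krow i + a \<and> krow i + a < krow i + (5 * d + 2) \<or>
          krow i + (5 * d + 2) < krow i + a \<and> krow i + a < krow i' + (2 * d + 1 + jj)"
      proof (cases "i' \<le> i")
        case True
        then have "4 * d + 3 \<le> a" "a < 5 * d + 2" using that by (auto simp: lo_def hi_def)
        then show ?thesis using s(2) row_mono_le[OF True] by linarith
      next
        case False
        then have "5 * d + 3 \<le> a" "a < H" using that by (auto simp: lo_def hi_def)
        moreover have "krow i + H \<le> krow i'" using False by (intro row_mono) simp
        ultimately show ?thesis by linarith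
      qed
    qed
  qed (use that H_bounds d_bounds in \<open>auto simp: lo_def hi_def split: if_splits\<close>)
  have lohi: "2 * d + 1 \<le> lo" "hi \<le> H" using H_bounds by (auto simp: lo_def hi_def)
  have "card {..<m} * (2 * d) + card ({} :: nat set) * (2 * d - 1) + card {..<m} + card ({i} \<times> {lo..<hi})
      \<le> card {..<m} * (2 * d + 2)"
    by (rule count_zones) (use U kap E lohi in \<open>auto simp: IU_def\<close>)
  moreover have "m < hi - lo"
  proof (cases "i' \<le> i")
    case True
    have "m < 5 * d + 2 - (4 * d + 3)" using d_bounds by arith
    then show ?thesis unfolding lo_def hi_def if_P[OF True] .
  next
    case False
    have "m < H - (5 * d + 3)" using H_bounds d_bounds by arith
    then show ?thesis unfolding lo_def hi_def if_not_P[OF False] .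
  qed
  ultimately show False by (simp add: card_cartesian_product_singleton algebra_simps)
qed

text \<open>A column that serves the lines \<open>1\<close> to \<open>m\<close> uses lower zones
  only, so every upper zone is a wall and each band pays with its own run. Without the extra tile,
  offset \<open>4 * d + 2\<close> has to be filled too; with the rest of the lower zone, the middle
  line and the next line these are \<open>2 * d + 2\<close> squares for a run of
  \<open>2 * d + 1\<close> tiles.\<close>

lemma chosen_contribution:
  assumes kap: "\<And>i. 0 < i \<Longrightarrow> i \<le> m \<Longrightarrow> kap i" and "\<not> kap 0" and i: "i < m"
    and con: "c \<in> contributes (crow i)"
  shows "hits i c"
proof (rule ccontr)
  assume nh: "\<not> hits i c"
  have ch: "charged (i, 5 * d + 2)" using con by (simp add: charged_def contributes_def add.assoc)
  have "i \<in> IK \<longleftrightarrow> i \<in> {0<..m}" for i using kap[of i] assms(2) by (cases "i = 0") (auto simp: IK_def)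
  then have "IK = {0<..m}" by blast
  then have "m \<le> card IK" by simp
  note ex = zones_exact[OF this]
  \<comment> \<open>Mirror image of the previous lemma: below the last full upper zone, in band
    \<open>j\<close>, all lower zones are full, and the lower zone of band \<open>j - 1\<close> is a
    wall. The bands from \<open>j\<close> on cannot pay for all that.\<close>
  have noU: "IU = {}"
  proof (rule ccontr)
    assume "IU \<noteq> {}"
    define j where "j = Max IU"
    have j: "j \<in> IU" using \<open>IU \<noteq> {}\<close> finite_zones by (simp add: j_def)
    have greatest: "i \<notin> IU" if "j < i" for i using that finite_zones by (auto simp: j_def dest: Max_ge)
    have "j \<in> IK" using ex(1) j by blast
    then have j0: "0 < j" using \<open>IK = {0<..m}\<close> by auto
    have jm: "j < m" using j by (simp add: IU_def)
    have "j - 1 \<notin> ID" using ex(2) j j0 by (metis IntI Suc_diff_1 emptyE imageI)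
    then have nD: "\<not> fullD (j - 1)" using jm by (simp add: ID_def)
    have D: "i \<in> ID" if "j \<le> i" "i < m" for i
    proof -
      have "Suc i \<in> IK" using that \<open>IK = {0<..m}\<close> by auto
      moreover have "Suc i \<notin> IU" using greatest that by auto
      ultimately show ?thesis using ex(1) by auto
    qed
    have "card {j} * (2 * d) + card {j..<m} * (2 * d - 1) + card {j..m} + card ({} :: (nat \<times> nat) set)
        \<le> card {j..<m} * (2 * d + 2)"
    proof (rule count_zones)
      fix i a i'
      assume q: "(i, a) \<in> {j} \<times> {1..2 * d} \<union> {j..<m} \<times> D_offsets \<union> {j..m} \<times> {0} \<union> {}"
        and s: "i' < m" "src (krow i + a, xcol c) \<in> run c i'"
      have "krow (j - 1) + H \<le> krow j" using j0 by (intro row_mono) simp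
      moreover have "j \<le> i" using q by auto
      ultimately have "krow (j - 1) + H \<le> krow i + a" using row_mono_le[of j i] by linarith
      moreover from q consider "i = j" "1 \<le> a" "a \<le> 2 * d" | "j \<le> i" "i < m" "a \<in> D_offsets" | "j \<le> i" "i \<le> m" "a = 0" by auto
      then have "charged (i, a)"
      proof cases
        case 1
        then show ?thesis using fullU_charged[of i a] j by (auto simp: IU_def)
      next
        case 2
        then show ?thesis using fullD_charged[of i a] D[of i] by (auto simp: ID_def)
      next
        case 3
        then show ?thesis using kap[of i] j0 kap_charged[of i] by auto
      qed
      ultimately show "i' \<in> {j..<m}"
        using fullD_if_from_above[OF _ s(2), of "j - 1"] nD s(1) by (cases "j \<le> i'") auto
    qed (use D j j0 kap in \<open>auto simp: IU_def ID_def\<close>)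
    then have "2 * d + (m - j) * (2 * d - 1) + (Suc m - j) \<le> (m - j) * (2 * d + 2)" by simp
    moreover have "(m - j) * (2 * d + 2) = (m - j) * (2 * d - 1) + (m - j) * 3"
      using d_bounds by (simp flip: distrib_left)
    ultimately have "2 * d \<le> 2 * (m - j)" using jm by linarith
    then show False using d_bounds by simp
  qed
  have nU: "\<not> fullU i'" if "i' < m" for i' using noU that by (auto simp: IU_def)
  let ?Q = "insert (Suc i, 0) ({i} \<times> {4 * d + 2..<H})"
  have chK: "charged (Suc i, 0)" using kap[of "Suc i"] i kap_charged by simp
  \<comment> \<open>Between the walls in band \<open>i\<close> and band \<open>Suc i\<close> the
    only sources are the tiles of run \<open>i\<close>.\<close>
  have below: "i' = i" if q: "charged (j, a)" "krow i + 2 * d < krow j + a" "krow j + a \<le> krow (Suc i)"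
    and i': "i' < m" "src (krow j + a, xcol c) \<in> run c i'" for j a i'
  proof -
    have "\<not> i' < i" using fullU_if_from_above[OF q(1) i'(2) q(2)] nU[OF i] by blast
    moreover have "\<not> Suc i \<le> i'"
      using fullU_if_from_below[OF q(1) i'(2) q(3)] nU[of "Suc i"] i' by (meson le_less_trans)
    ultimately show ?thesis by simp
  qed
  obtain i' jj where s: "i' < m" "src (krow (Suc i) + 0, xcol c) \<in> run c i'"
    "src (krow (Suc i) + 0, xcol c) = (krow i' + (2 * d + 1 + jj), xcol c)" "jj < 2 * d + 2" "jj = 2 * d + 1 \<longrightarrow> hits i' c"
    using chK by (rule charged_src)
  have "i' = i" by (rule below[OF chK _ _ s(1,2)]) (use H_bounds in auto)
  \<comment> \<open>The tile that serves line \<open>Suc i\<close> has offset at most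
    \<open>4 * d + 1\<close>, since column \<open>c\<close> has no extra tile in this band; its
    charge crosses everything from \<open>4 * d + 2\<close> on.\<close>
  have E: "charged (i, a)" if a: "4 * d + 2 \<le> a" "a < H" for a
  proof (cases "a = 5 * d + 2")
    case False
    show ?thesis
    proof (rule chargedI)
      show "(krow i + a, xcol c) \<in> F"
      proof (rule vertical_between[OF _ s(3)])
        show "(krow (Suc i) + 0, xcol c) \<in> F - tile_set" using chK by (simp add: charged_def)
        have "jj \<noteq> 2 * d + 1" using s(5) nh \<open>i' = i\<close> by blast
        then have "krow i' + (2 * d + 1 + jj) < krow i + a" using s(4) a \<open>i' = i\<close> by simp
        moreover have "krow i + a < krow (Suc i) + 0" using a by simp
        ultimately show "krow i' + (2 * d + 1 + jj) < krow i + a \<and> krow i + a < krow (Suc i) + 0 \<or>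
            krow (Suc i) + 0 < krow i + a \<and> krow i + a < krow i' + (2 * d + 1 + jj)" by blast
      qed
    qed (use a False nh d_bounds in auto)
  qed (use ch in simp)
  let ?f = "\<lambda>q. (krow (fst q) + snd q, xcol c)"
  have Q: "charged q \<and> krow i + 2 * d < krow (fst q) + snd q \<and> krow (fst q) + snd q \<le> krow (Suc i)" if "q \<in> ?Q" for q
    using that E chK H_bounds by auto
  have "inj_on ?f ?Q"
  proof (rule inj_onI)
    fix q q' assume "q \<in> ?Q" "q' \<in> ?Q" "?f q = ?f q'"
    then show "q = q'" using row_eq[of "fst q" "snd q" "fst q'" "snd q'"] H_bounds by (auto simp: prod_eq_iff)
  qed
  then have "card ?Q = card (?f ` ?Q)" by (simp only: card_image)
  also have "\<dots> \<le> card (run c i)"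
  proof (rule card_le_sources)
    show "?f ` ?Q \<subseteq> F - tile_set"
    proof (rule image_subsetI)
      fix q assume "q \<in> ?Q"
      from Q[OF this] show "?f q \<in> F - tile_set" by (simp only: charged_def)
    qed
    show "src ` ?f ` ?Q \<subseteq> run c i"
    proof
      fix x assume "x \<in> src ` ?f ` ?Q"
      then obtain q where q: "q \<in> ?Q" "x = src (?f q)" by blast
      have cq: "charged (fst q, snd q)" using Q[OF q(1)] by simp
      obtain i'' where i'': "i'' < m" "src (krow (fst q) + snd q, xcol c) \<in> run c i''"
        using cq by (rule charged_src)
      have "i'' = i" by (rule below[OF cq _ _ i'']) (use Q[OF q(1)] in auto)
      then show "x \<in> run c i" using i'' q by simp
    qed
  qed (rule finite_run)
  also have "\<dots> \<le> 2 * d + 1" by (rule card_run_not_inc[OF nh])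
  finally show False using H_bounds by (simp add: card_cartesian_product_singleton)
qed

end

section \<open>The hitting set read off from a charging\<close>

context charged_board
begin

text \<open>The hitting set consists of the columns that do not serve the first line. That line
  needs \<open>N - k\<close> contributions, so there are at most \<open>k\<close> such columns. All
  columns serve the inner lines, so by \<open>not_all_kap\<close> only these columns can serve the
  last line, which needs \<open>k\<close> of them. The one contribution to the middle line of a band
  must then come from a chosen column incident with it.\<close>

lemma hitting_set_from_charging: "\<exists>S \<subseteq> {..<N}. card S = k \<and> (\<forall>i<m. \<exists>c\<in>S. hits i c)"
proof -
  have col: "charged_column N m k d H W M R hits F src c" if "c < N" for c
    using that by unfold_locales
  let ?V = "\<lambda>i. contributes (krow i)"
  have V: "?V i \<subseteq> {..<N}" "finite (?V i)" for i by (auto simp: contributes_def)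
  let ?S = "{..<N} - ?V 0"
  have "N - k \<le> card (?V 0)" using krow_contributions[of 0] by (simp add: line_need_def)
  moreover have "card ?S = N - card (?V 0)" using card_Diff_subset[OF V(2)[of 0] V(1)[of 0]] by simp
  ultimately have S_le: "card ?S \<le> k" using kN by simp
  have mid: "c \<in> ?V i" if "0 < i" "i < m" "c < N" for i c
  proof -
    have "N \<le> card (?V i)" using krow_contributions[of i] that by (simp add: line_need_def)
    then have "?V i = {..<N}" using V[of i] by (intro card_seteq) auto
    then show ?thesis using that by simp
  qed
  have ends: "c \<in> ?S" if "c \<in> ?V m" for c
  proof (rule ccontr)
    assume "c \<notin> ?S"
    then have c0: "c < N" "c \<in> ?V 0" using that V by auto
    interpret charged_column N m k d H W M R hits F src c by (rule col[OF c0(1)])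
    have "kap i" if im: "i \<le> m" for i
    proof (cases "i = 0")
      case True
      then show ?thesis using c0(2) by (simp add: kap_def)
    next
      case False
      then show ?thesis using im c0(1) \<open>c \<in> ?V m\<close> mid[of i c] by (cases "i = m") (simp_all add: kap_def)
    qed
    then show False using not_all_kap by blast
  qed
  have "k \<le> card (?V m)" using krow_contributions[of m] m0 by (simp add: line_need_def)
  then have "card (?V m) \<ge> card ?S" using S_le by simp
  then have S: "?V m = ?S" using ends by (intro card_seteq) auto
  then have cardS: "card ?S = k" using S_le \<open>k \<le> card (?V m)\<close> by simp
  have hit: "\<exists>c\<in>?S. hits i c" if i: "i < m" for i
  proof -
    have "contributes (crow i) \<noteq> {}" using crow_contributions[OF i] by auto
    then obtain c where con: "c \<in> contributes (crow i)" by blast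
    then have c: "c < N" by (simp add: contributes_def)
    interpret charged_column N m k d H W M R hits F src c by (rule col[OF c])
    have cS: "c \<in> ?S"
    proof (rule ccontr)
      assume n: "c \<notin> ?S"
      have "kap i" if "i < m" for i using n c that mid[of i c] by (cases "i = 0") (auto simp: kap_def)
      moreover have "\<not> kap m" using n S by (simp add: kap_def)
      ultimately show False using unchosen_no_contribution[OF _ _ i] con by blast
    qed
    have "kap i" if "0 < i" "i \<le> m" for i
      using that cS S mid[of i c] c by (cases "i = m") (auto simp: kap_def)
    moreover have "\<not> kap 0" using cS by (simp add: kap_def)
    ultimately show ?thesis using chosen_contribution[OF _ _ i con] cS by blast
  qed
  show ?thesis
  proof (intro exI[of _ ?S] conjI allI impI)
    show "?S \<subseteq> {..<N}" by (rule Diff_subset)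
  qed (use cardS hit in simp_all)
qed

end

section \<open>Solving the puzzle from a hitting set\<close>

context hitting_board
begin

lemma run_tiles: "i < m \<Longrightarrow> c < N \<Longrightarrow> run c i \<subseteq> tile_set"
  unfolding tile_set_def hit_tile_def run_def by blast

definition kstack :: "nat \<Rightarrow> square set" where
  "kstack i = {(y, x). y = krow i \<and> line_need N m k i \<le> x \<and> x < M}"

definition cstack :: "nat \<Rightarrow> square set" where
  "cstack i = {(y, x). y = crow i \<and> 1 \<le> x \<and> x < M}"

definition zstack :: "square set" where
  "zstack = {(y, x). x = Z \<and> 2 * m + 1 \<le> y \<and> y < R}"

lemma kstack_tiles: "i \<le> m \<Longrightarrow> kstack i \<subseteq> tile_set"
  unfolding tile_set_def hit_tile_def kstack_def by (auto simp: less_Suc_eq_le)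

lemma cstack_tiles: "i < m \<Longrightarrow> cstack i \<subseteq> tile_set"
  unfolding tile_set_def hit_tile_def cstack_def by blast

lemma zstack_tiles: "zstack \<subseteq> tile_set"
  unfolding tile_set_def hit_tile_def zstack_def by blast

lemma run_memD: "s \<in> run c i \<Longrightarrow> snd s = xcol c \<and> krow i + (2 * d + 1) \<le> fst s \<and> fst s \<le> krow i + (4 * d + 2) \<and>
    (fst s = krow i + (4 * d + 2) \<longrightarrow> hits i c)"
  by (auto simp: run_def)

lemma run_memI: "2 * d + 1 \<le> b \<Longrightarrow> b \<le> 4 * d + 2 \<Longrightarrow> (b = 4 * d + 2 \<longrightarrow> hits i c) \<Longrightarrow> (krow i + b, xcol c) \<in> run c i"
  unfolding run_def by (rule CollectI, rule exI[of _ "b - (2 * d + 1)"]) auto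

lemma run_disjoint: "s \<in> run c i \<Longrightarrow> s \<in> run c' i' \<Longrightarrow> c = c' \<and> i = i'"
proof -
  assume s: "s \<in> run c i" "s \<in> run c' i'"
  obtain j where j1: "s = (krow i + (2 * d + 1 + j), xcol c)" "j < 2 * d + 2" using s(1) unfolding run_def by blast
  obtain j' where j2: "s = (krow i' + (2 * d + 1 + j'), xcol c')" "j' < 2 * d + 2" using s(2) unfolding run_def by blast
  note j = j1 j2
  have "(krow i + (2 * d + 1 + j), xcol c) = (krow i' + (2 * d + 1 + j'), xcol c')"
    using j(1,3) by (rule trans[OF sym])
  then have e: "krow i + (2 * d + 1 + j) = krow i' + (2 * d + 1 + j')" "xcol c + 0 = xcol c' + 0"
    by (simp_all only: prod.inject)
  have "2 * d + 1 + j < H" "2 * d + 1 + j' < H" using j H_bounds by linarith+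
  from row_eq[OF e(1) this] col_eq[OF e(2)] W show ?thesis by simp
qed

lemma card_run_ge: "2 * d + 1 \<le> card (run c i)" and card_run_hits: "hits i c \<Longrightarrow> 2 * d + 2 \<le> card (run c i)"
proof -
  let ?f = "\<lambda>j. (krow i + (2 * d + 1 + j), xcol c)"
  have inj: "inj_on ?f A" for A by (auto simp: inj_on_def)
  have cf: "card (?f ` {..<b}) = b" for b using card_image[OF inj[of "{..<b}"]] by (simp only: card_lessThan)
  have "?f ` {..<2 * d + 1} \<subseteq> run c i" by (auto simp: run_def)
  from card_mono[OF finite_run this] show "2 * d + 1 \<le> card (run c i)" by (simp only: cf)
  assume "hits i c"
  then have "?f ` {..<2 * d + 2} \<subseteq> run c i" by (auto simp: run_def)
  from card_mono[OF finite_run this] show "2 * d + 2 \<le> card (run c i)" by (simp only: cf)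
qed

text \<open>Offset \<open>4 * d + 2\<close> is a tile of the run in an incident column and a square
  to be filled in any other; the side conditions keep both cases in one statement.\<close>

lemma down_line:
  assumes s: "s \<in> run c i" and a: "4 * d + 2 \<le> a" "a = 4 * d + 2 \<longrightarrow> \<not> hits i c"
  shows "aligned s (krow i + a, xcol c)"
    and "v \<in> between s (krow i + a, xcol c) \<Longrightarrow>
      v \<in> run c i \<or> (\<exists>b. v = (krow i + b, xcol c) \<and> 4 * d + 2 \<le> b \<and> (b = 4 * d + 2 \<longrightarrow> \<not> hits i c) \<and> b < a)"
proof -
  have lt: "fst s < krow i + a" using run_memD[OF s] a by (cases "a = 4 * d + 2") auto
  then show "aligned s (krow i + a, xcol c)" using run_memD[OF s] by (auto simp: aligned_def)
  assume "v \<in> between s (krow i + a, xcol c)"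
  then have v: "snd v = xcol c" "fst s < fst v" "fst v < krow i + a"
    using lt run_memD[OF s] by (auto simp: between_def)
  define b where "b = fst v - krow i"
  have b: "fst v = krow i + b" using v run_memD[OF s] by (simp add: b_def)
  have "2 * d + 1 \<le> b" "b < a" using v b run_memD[OF s] by linarith+
  moreover have "v = (krow i + b, xcol c)" using v b by (simp add: prod_eq_iff)
  ultimately show "v \<in> run c i \<or> (\<exists>b. v = (krow i + b, xcol c) \<and> 4 * d + 2 \<le> b \<and> (b = 4 * d + 2 \<longrightarrow> \<not> hits i c) \<and> b < a)"
    using run_memI[of b i c] by (metis linorder_not_le order_less_imp_le)
qed

lemma up_line:
  assumes s: "s \<in> run c i" and a: "a \<le> 2 * d"
  shows "aligned s (krow i + a, xcol c)"
    and "v \<in> between s (krow i + a, xcol c) \<Longrightarrow>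
      v \<in> run c i \<or> (\<exists>b. v = (krow i + b, xcol c) \<and> a < b \<and> b \<le> 2 * d)"
proof -
  have lt: "krow i + a < fst s" using run_memD[OF s] a by auto
  then show "aligned s (krow i + a, xcol c)" using run_memD[OF s] by (auto simp: aligned_def)
  assume "v \<in> between s (krow i + a, xcol c)"
  then have v: "snd v = xcol c" "krow i + a < fst v" "fst v < fst s"
    using lt run_memD[OF s] by (auto simp: between_def)
  define b where "b = fst v - krow i"
  have b: "fst v = krow i + b" using v by (simp add: b_def)
  have ab: "a < b" using v b by linarith
  have ve: "v = (krow i + b, xcol c)" using v b by (simp add: prod_eq_iff)
  show "v \<in> run c i \<or> (\<exists>b. v = (krow i + b, xcol c) \<and> a < b \<and> b \<le> 2 * d)"
  proof (cases "b \<le> 2 * d")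
    case False
    have "b < 4 * d + 2" using v b run_memD[OF s] by linarith
    then have "v \<in> run c i" unfolding ve using False by (intro run_memI) auto
    then show ?thesis ..
  qed (use ve ab in blast)
qed

lemma row_line:
  assumes "fst s = y" "snd s < M" "M \<le> x"
  shows "aligned s (y, x)"
    and "v \<in> between s (y, x) \<Longrightarrow> fst v = y \<and> snd s < snd v \<and> snd v < x"
  using assms by (auto simp: aligned_def between_def prod_eq_iff)

lemma xcol_inj: "xcol a = xcol b \<Longrightarrow> a = b"
proof -
  assume "xcol a = xcol b"
  moreover have "0 < W" using W by simp
  ultimately show "a = b" using col_eq[of a 0 b 0] by simp
qed

lemma row_mono_le': "i \<le> j \<Longrightarrow> krow i \<le> krow j"
  by simp

lemma tile_set_board:
  assumes "Yt < n" "Z < n"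
  shows "tile_set \<subseteq> board n"
proof
  fix s assume s: "s \<in> tile_set"
  obtain y x where yx: "s = (y, x)" by (cases s)
  have row_le: "krow i + a \<le> Yt" if "i < m" "a \<le> H" for i a using row_mono[OF that(1)] that(2) by linarith
  from s[unfolded yx] have "y \<le> Yt \<and> x \<le> Z"
  proof (cases rule: tile_cases)
    case (K i)
    then show ?thesis using row_mono_le'[OF K(1)] by linarith
  next
    case (C i)
    then show ?thesis using row_le[of i "5 * d + 2"] H_bounds by auto
  next
    case (Run i c)
    then show ?thesis using row_le[of i "4 * d + 2"] H_bounds run_memD[OF Run(3)] by auto
  qed auto
  then show "s \<in> board n" using assms yx by (auto simp: board_def)
qed

text \<open>The tile counts dictate the phases. Column \<open>h i\<close> goes down first in band
  \<open>i\<close>, because its extra tile pays for the middle line. The row completes this line, so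
  that the other chosen columns cross it for free on their way down, while the remaining columns go
  up. Now every line has received what its stack lacks, and finally column \<open>Z\<close> is
  filled as far as the target.\<close>

lemma solvable_if_hitting_set:
  assumes S: "S \<subseteq> {..<N}" "card S = k" and hit: "\<And>i. i < m \<Longrightarrow> \<exists>c\<in>S. hits i c"
    and n: "Yt < n" "Z < n"
  shows "solvable (ones_puzzle n (Yt, Z) tile_set)"
proof -
  obtain h where h: "\<And>i. i < m \<Longrightarrow> h i \<in> S \<and> hits i (h i)" using hit by metis
  have hN: "h i < N" if "i < m" for i using h[OF that] S by blast
  have SN: "c < N" if "c \<in> S" for c using S that by blast
  have col_le: "xcol c \<le> Z" if "c \<le> N" for c using that by simp
  have row_le: "krow i + a \<le> Yt" if "i < m" "a \<le> H" for i a using row_mono[OF that(1)] that(2) by linarith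
  have row_le_m: "krow i \<le> Yt" if "i \<le> m" for i using row_mono_le'[OF that] by linarith
  have bd: "(y, x) \<in> board n" if "y \<le> Yt" "x \<le> Z" for y x using that n by (auto simp: board_def)
  have MZ: "M \<le> Z" by simp
  have tiles_board: "tile_set \<subseteq> board n" using n by (rule tile_set_board)

  \<comment> \<open>Offset \<open>H\<close> is the square of the next line. These are
    \<open>2 * d + 1\<close> squares, and the incident run has \<open>2 * d + 2\<close>
    tiles.\<close>
  let ?A0 = "\<lambda>i. {(krow i + a, xcol (h i)) | a. 4 * d + 3 \<le> a \<and> a \<le> H}"
  define F0 where "F0 = tile_set \<union> (\<Union>i\<in>{..<m}. ?A0 i)"
  define U0 where "U0 = tile_set - (\<Union>i\<in>{..<m}. run (h i) i)"
  have 0: "reach n tile_set F0 U0"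
    unfolding F0_def U0_def
  proof (rule reach_lines[OF reach_init _ tiles_board, where pos = fst])
    fix i assume "i \<in> {..<m}"
    then have i: "i < m" by simp
    have e: "?A0 i = (\<lambda>a. (krow i + a, xcol (h i))) ` {4 * d + 3..H}" by auto
    have "?A0 i \<subseteq> board n" using row_le[OF i] col_le[of "h i"] hN[OF i] bd by auto
    then show "finite (?A0 i) \<and> ?A0 i \<subseteq> board n" using e by simp
    show "run (h i) i \<subseteq> tile_set" using run_tiles[OF i hN[OF i]] .
    have "card (?A0 i) \<le> card {4 * d + 3..H}" unfolding e by (intro card_image_le) simp
    also have "\<dots> \<le> 2 * d + 2" using H_bounds by simp
    also have "\<dots> \<le> card (run (h i) i)" using card_run_hits h[OF i] by blast
    finally show "card (?A0 i) \<le> card (run (h i) i)" .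
    show "run (h i) i \<inter> run (h i') i' = {}" if "i \<noteq> i'" for i'
      using run_disjoint that by blast
    fix u s assume "u \<in> ?A0 i" and s: "s \<in> run (h i) i"
    then obtain a where a: "u = (krow i + a, xcol (h i))" "4 * d + 3 \<le> a" "a \<le> H" by blast
    have a': "4 * d + 2 \<le> a" "a = 4 * d + 2 \<longrightarrow> \<not> hits i (h i)" using a by auto
    show "aligned s u" unfolding a(1) by (rule down_line(1)[OF s a'])
    fix v assume "v \<in> between s u"
    from down_line(2)[OF s a' this[unfolded a(1)]]
    show "v \<in> tile_set \<or> v \<in> ?A0 i \<and> fst v < fst u"
    proof
      assume "v \<in> run (h i) i"
      then show ?thesis using run_tiles[OF i hN[OF i]] by blast
    next
      assume "\<exists>b. v = (krow i + b, xcol (h i)) \<and> 4 * d + 2 \<le> b \<and> (b = 4 * d + 2 \<longrightarrow> \<not> hits i (h i)) \<and> b < a"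
      then obtain b where b: "v = (krow i + b, xcol (h i))" "4 * d + 2 \<le> b" "b = 4 * d + 2 \<longrightarrow> \<not> hits i (h i)" "b < a"
        by blast
      have "b \<noteq> 4 * d + 2" using b(3) h[OF i] by blast
      then have "v \<in> ?A0 i" using b a(3) by auto
      then show ?thesis using b a(1) by simp
    qed
  qed simp

  have A0: "?A0 i \<subseteq> F0" if "i < m" for i unfolding F0_def using that by blast
  \<comment> \<open>Leaving out the square of column \<open>h i\<close>, there are
    \<open>M - 1\<close> squares, as many as tiles in \<open>cstack i\<close>.\<close>
  let ?A1 = "\<lambda>i. {(crow i, x) | x. M \<le> x \<and> x \<le> Z \<and> x \<noteq> xcol (h i)}"
  define F1 where "F1 = F0 \<union> (\<Union>i\<in>{..<m}. ?A1 i)"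
  define U1 where "U1 = U0 - (\<Union>i\<in>{..<m}. cstack i)"
  have U0: "U0 \<subseteq> board n" using tiles_board unfolding U0_def by blast
  have tF0: "tile_set \<subseteq> F0" unfolding F0_def  by blast
  have 1: "reach n tile_set F1 U1"
    unfolding F1_def U1_def
  proof (rule reach_lines[OF 0 _ U0, where pos = snd])
    fix i assume "i \<in> {..<m}"
    then have i: "i < m" by simp
    have e: "?A1 i = (\<lambda>x. (crow i, x)) ` ({M..Z} - {xcol (h i)})" by auto
    have "?A1 i \<subseteq> board n" using row_le[OF i, of "5 * d + 2"] H_bounds bd by auto
    then show "finite (?A1 i) \<and> ?A1 i \<subseteq> board n" using e by simp
    show "cstack i \<subseteq> U0"
    proof
      fix s assume s: "s \<in> cstack i"
      then have "snd s < M" by (auto simp: cstack_def)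
      then have "s \<notin> run (h i') i'" for i' using run_memD[of s "h i'" i'] by auto
      then show "s \<in> U0" unfolding U0_def using cstack_tiles[OF i] s by blast
    qed
    have "card (?A1 i) \<le> card ({M..Z} - {xcol (h i)})" unfolding e by (intro card_image_le) simp
    also have "\<dots> = Suc Z - M - 1" using col_le[of "h i"] hN[OF i] by (subst card_Diff_singleton) auto
    also have "\<dots> = M - 1" using M by simp
    also have "\<dots> = card (cstack i)" unfolding cstack_def by (rule card_horizontal_segment[symmetric])
    finally show "card (?A1 i) \<le> card (cstack i)" .
    show "cstack i \<inter> cstack i' = {}" if "i \<noteq> i'" for i'
      using row_eq[of i "5 * d + 2" i' "5 * d + 2"] that H_bounds by (auto simp: cstack_def)
    fix u s assume "u \<in> ?A1 i" and s: "s \<in> cstack i"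
    then obtain x where x: "u = (crow i, x)" "M \<le> x" "x \<le> Z" "x \<noteq> xcol (h i)" by blast
    have s': "fst s = crow i" "1 \<le> snd s" "snd s < M" using s by (auto simp: cstack_def)
    show "aligned s u" unfolding x(1) by (rule row_line(1)[OF s'(1,3) x(2)])
    fix v assume "v \<in> between s u"
    from row_line(2)[OF s'(1,3) x(2) this[unfolded x(1)]]
    have v: "fst v = crow i" "snd s < snd v" "snd v < x" by auto
    show "v \<in> F0 \<or> v \<in> ?A1 i \<and> snd v < snd u"
    proof (cases "snd v < M")
      case True
      then have "v \<in> cstack i" using v s' by (cases v) (auto simp: cstack_def)
      then show ?thesis using cstack_tiles[OF i] tF0 by blast
    next
      case False
      show ?thesis
      proof (cases "snd v = xcol (h i)")
        case True
        then have "v = (krow i + (5 * d + 2), xcol (h i))" using v by (simp add: prod_eq_iff)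
        moreover have "4 * d + 3 \<le> 5 * d + 2" "5 * d + 2 \<le> H" using d_bounds H_bounds by linarith+
        ultimately have "v \<in> ?A0 i" by blast
        then show ?thesis using A0[OF i] by blast
      next
        case F: False
        have "v = (crow i, snd v)" using v by (simp add: prod_eq_iff)
        then have "v \<in> ?A1 i" using F False v x by (intro CollectI exI[of _ "snd v"]) auto
        then show ?thesis using v x by simp
      qed
    qed
  qed simp

  have A1: "?A1 i \<subseteq> F1" if "i < m" for i unfolding F1_def using that by blast
  let ?L2 = "{(i, c). i < m \<and> c \<in> S \<and> c \<noteq> h i}"
  \<comment> \<open>The middle line is filled by now, so at most \<open>2 * d + 1\<close> squares
    remain, which even a run without the extra tile can fill.\<close>
  let ?A2 = "\<lambda>l. {(krow (fst l) + a, xcol (snd l)) | a. 4 * d + 2 \<le> a \<and> a \<le> H \<and> a \<noteq> 5 * d + 2 \<and>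
    (a = 4 * d + 2 \<longrightarrow> \<not> hits (fst l) (snd l))}"
  define F2 where "F2 = F1 \<union> (\<Union>l\<in>?L2. ?A2 l)"
  define U2 where "U2 = U1 - (\<Union>l\<in>?L2. run (snd l) (fst l))"
  have U1: "U1 \<subseteq> board n" using U0 unfolding U1_def by blast
  have tF1: "tile_set \<subseteq> F1" unfolding F1_def using tF0 by blast
  have finL2: "finite ?L2"
  proof (rule finite_subset)
    show "?L2 \<subseteq> {..<m} \<times> {..<N}" using S by auto
  qed simp
  have 2: "reach n tile_set F2 U2"
    unfolding F2_def U2_def
  proof (rule reach_lines[OF 1 finL2 U1, where pos = fst])
    fix l assume "l \<in> ?L2"
    then obtain i c where l: "l = (i, c)" "i < m" "c \<in> S" "c \<noteq> h i" by blast
    have ic: "fst l = i" "snd l = c" using l by auto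
    have cN: "c < N" using SN l by blast
    let ?O = "{4 * d + 2..H} - {5 * d + 2}"
    have e: "?A2 l \<subseteq> (\<lambda>a. (krow i + a, xcol c)) ` ?O" unfolding ic by auto
    have "?A2 l \<subseteq> board n" unfolding ic using row_le[OF l(2)] col_le[of c] cN bd by auto
    then show "finite (?A2 l) \<and> ?A2 l \<subseteq> board n" using finite_subset[OF e] by simp
    show "run (snd l) (fst l) \<subseteq> U1"
    proof
      fix s assume s: "s \<in> run (snd l) (fst l)"
      then have s': "s \<in> run c i" by (simp add: ic)
      have "s \<notin> run (h i') i'" for i' using run_disjoint[OF s', of "h i'" i'] l(4) by blast
      moreover have "s \<notin> cstack i'" for i' using run_memD[OF s'] by (auto simp: cstack_def)
      ultimately show "s \<in> U1" unfolding U1_def U0_def using run_tiles[OF l(2) cN] s' by blast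
    qed
    show "card (?A2 l) \<le> card (run (snd l) (fst l))"
    proof -
      have "card (?A2 l) \<le> card ((\<lambda>a. (krow i + a, xcol c)) ` ?O)" by (rule card_mono[OF _ e]) simp
      also have "\<dots> \<le> card ?O" by (intro card_image_le) simp
      also have "\<dots> = Suc H - (4 * d + 2) - 1" using H_bounds by (subst card_Diff_singleton) auto
      also have "\<dots> = 2 * d + 1" using H_bounds by linarith
      also have "\<dots> \<le> card (run c i)" by (rule card_run_ge)
      finally show ?thesis by (simp only: ic)
    qed
    show "run (snd l) (fst l) \<inter> run (snd l') (fst l') = {}" if "l \<noteq> l'" for l'
      using run_disjoint that by (metis disjoint_iff prod.collapse)
    fix u s assume "u \<in> ?A2 l" and "s \<in> run (snd l) (fst l)"
    then obtain a where a: "u = (krow i + a, xcol c)" "4 * d + 2 \<le> a" "a \<le> H" "a \<noteq> 5 * d + 2" "a = 4 * d + 2 \<longrightarrow> \<not> hits i c"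
      and s: "s \<in> run c i" unfolding ic by blast
    show "aligned s u" unfolding a(1) by (rule down_line(1)[OF s a(2,5)])
    fix v assume "v \<in> between s u"
    from down_line(2)[OF s a(2,5) this[unfolded a(1)]]
    show "v \<in> F1 \<or> v \<in> ?A2 l \<and> fst v < fst u"
    proof
      assume "v \<in> run c i"
      then show ?thesis using run_tiles[OF l(2) cN] tF1 by blast
    next
      assume "\<exists>b. v = (krow i + b, xcol c) \<and> 4 * d + 2 \<le> b \<and> (b = 4 * d + 2 \<longrightarrow> \<not> hits i c) \<and> b < a"
      then obtain b where b: "v = (krow i + b, xcol c)" "4 * d + 2 \<le> b" "b = 4 * d + 2 \<longrightarrow> \<not> hits i c" "b < a"
        by blast
      show ?thesis
      proof (cases "b = 5 * d + 2")
        case True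
        have "xcol c \<noteq> xcol (h i)" using xcol_inj[of c "h i"] l(4) by blast
        then have "v \<in> ?A1 i" unfolding b(1) True using col_le[of c] cN by (intro CollectI exI[of _ "xcol c"]) auto
        then show ?thesis using A1[OF l(2)] by blast
      next
        case False
        then have "v \<in> ?A2 l" unfolding ic using b a(3) by auto
        then show ?thesis using b a(1) by simp
      qed
    qed
  qed

  let ?L3 = "{(i, c). i < m \<and> c < N \<and> c \<notin> S}"
  let ?A3 = "\<lambda>l. {(krow (fst l) + a, xcol (snd l)) | a. a \<le> 2 * d}"
  define F3 where "F3 = F2 \<union> (\<Union>l\<in>?L3. ?A3 l)"
  define U3 where "U3 = U2 - (\<Union>l\<in>?L3. run (snd l) (fst l))"
  have U2: "U2 \<subseteq> board n" using U1 unfolding U2_def by blast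
  have tF2: "tile_set \<subseteq> F2" unfolding F2_def using tF1 by blast
  have finL3: "finite ?L3"
  proof (rule finite_subset)
    show "?L3 \<subseteq> {..<m} \<times> {..<N}" by auto
  qed simp
  have 3: "reach n tile_set F3 U3"
    unfolding F3_def U3_def
  \<comment> \<open>These runs go upwards, so the order of filling is that of decreasing
    rows.\<close>
  proof (rule reach_lines[OF 2 finL3 U2, where pos = "\<lambda>u. Yt - fst u"])
    fix l assume "l \<in> ?L3"
    then obtain i c where l: "l = (i, c)" "i < m" "c < N" "c \<notin> S" by blast
    have ic: "fst l = i" "snd l = c" using l by auto
    have e: "?A3 l = (\<lambda>a. (krow i + a, xcol c)) ` {..2 * d}" unfolding ic by auto
    have "?A3 l \<subseteq> board n" unfolding ic using row_le[OF l(2)] H_bounds col_le[of c] l(3) bd by auto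
    then show "finite (?A3 l) \<and> ?A3 l \<subseteq> board n" using e by simp
    show "run (snd l) (fst l) \<subseteq> U2"
    proof
      fix s assume s: "s \<in> run (snd l) (fst l)"
      then have s': "s \<in> run c i" by (simp add: ic)
      have "s \<notin> run (h i') i'" if "i' < m" for i' using run_disjoint[OF s', of "h i'" i'] l(4) h[OF that] by blast
      then have "s \<in> U0" unfolding U0_def using run_tiles[OF l(2,3)] s' by blast
      moreover have "s \<notin> cstack i'" for i' using run_memD[OF s'] by (auto simp: cstack_def)
      ultimately have "s \<in> U1" unfolding U1_def by blast
      moreover have "s \<notin> run (snd l') (fst l')" if "l' \<in> ?L2" for l'
        using run_disjoint[OF s', of "snd l'" "fst l'"] l(4) that by auto
      ultimately show "s \<in> U2" unfolding U2_def by blast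
    qed
    have "card (?A3 l) \<le> card {..2 * d}" unfolding e by (intro card_image_le) simp
    also have "\<dots> \<le> card (run c i)" using card_run_ge[of c i] by simp
    finally show "card (?A3 l) \<le> card (run (snd l) (fst l))" by (simp only: ic)
    show "run (snd l) (fst l) \<inter> run (snd l') (fst l') = {}" if "l \<noteq> l'" for l'
      using run_disjoint that by (metis disjoint_iff prod.collapse)
    fix u s assume "u \<in> ?A3 l" and "s \<in> run (snd l) (fst l)"
    then obtain a where a: "u = (krow i + a, xcol c)" "a \<le> 2 * d" and s: "s \<in> run c i" unfolding ic by blast
    show "aligned s u" unfolding a(1) by (rule up_line(1)[OF s a(2)])
    fix v assume "v \<in> between s u"
    from up_line(2)[OF s a(2) this[unfolded a(1)]]
    show "v \<in> F2 \<or> v \<in> ?A3 l \<and> Yt - fst v < Yt - fst u"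
    proof
      assume "v \<in> run c i"
      then show ?thesis using run_tiles[OF l(2,3)] tF2 by blast
    next
      assume "\<exists>b. v = (krow i + b, xcol c) \<and> a < b \<and> b \<le> 2 * d"
      then obtain b where b: "v = (krow i + b, xcol c)" "a < b" "b \<le> 2 * d" by blast
      have "v \<in> ?A3 l" unfolding ic using b by blast
      moreover have "krow i + b \<le> Yt" using row_le[OF l(2), of b] b H_bounds by linarith
      then have "Yt - fst v < Yt - fst u" unfolding b(1) a(1) fst_conv using b(2) by linarith
      ultimately show ?thesis by blast
    qed
  qed

  \<comment> \<open>The columns that have already filled their square of line \<open>i\<close>: the
    chosen ones from band \<open>i - 1\<close> above it, the others from band \<open>i\<close> below
    it.\<close>
  let ?P = "\<lambda>i. {c. c < N \<and> (c \<in> S \<and> 0 < i \<or> c \<notin> S \<and> i < m)}"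
  let ?A4 = "\<lambda>i. {(krow i, x) | x. M \<le> x \<and> x \<le> Z \<and> x \<notin> xcol ` ?P i}"
  define F4 where "F4 = F3 \<union> (\<Union>i\<in>{..m}. ?A4 i)"
  define U4 where "U4 = U3 - (\<Union>i\<in>{..m}. kstack i)"
  have U3: "U3 \<subseteq> board n" using U2 unfolding U3_def by blast
  have tF3: "tile_set \<subseteq> F3" unfolding F3_def using tF2 by blast
  have F03: "F0 \<subseteq> F3" and F14: "F1 \<subseteq> F3" unfolding F3_def F2_def F1_def by blast+
  have kfilled: "(krow i, xcol c) \<in> F3" if "i \<le> m" "c \<in> ?P i" for i c
  proof (cases "c \<in> S")
    case True
    then have i: "0 < i" "i - 1 < m" using that by auto
    have e: "krow (i - 1) + H = krow i" using i by (cases i) auto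
    show ?thesis
    proof (cases "c = h (i - 1)")
      case True
      have "(krow i, xcol c) \<in> ?A0 (i - 1)" unfolding True[symmetric]
        by (rule CollectI, rule exI[of _ H]) (use e H_bounds in auto)
      then show ?thesis using A0[OF i(2)] F03 by blast
    next
      case False
      have "(krow i, xcol c) \<in> ?A2 (i - 1, c)"
        by (rule CollectI, rule exI[of _ H]) (use e H_bounds d_bounds in auto)
      moreover have "(i - 1, c) \<in> ?L2" using i True False by blast
      ultimately show ?thesis unfolding F3_def F2_def by blast
    qed
  next
    case False
    then have "(i, c) \<in> ?L3" using that by blast
    moreover have "(krow i, xcol c) \<in> ?A3 (i, c)" by (rule CollectI, rule exI[of _ 0]) auto
    ultimately show ?thesis unfolding F3_def by blast
  qed
  have cardP: "line_need N m k i = card (?P i)" if im: "i \<le> m" for i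
  proof -
    consider "i = 0" | "i = m" | "0 < i" "i < m" using im by force
    then show ?thesis
    proof cases
      case 1
      then have "?P i = {..<N} - S" using m0 by auto
      then show ?thesis using 1 S finite_subset[OF S(1)] by (simp add: line_need_def card_Diff_subset)
    next
      case 2
      then have "?P i = S" using m0 S by auto
      then show ?thesis using 2 S m0 by (simp add: line_need_def)
    next
      case 3
      then have "?P i = {..<N}" by auto
      then show ?thesis using 3 by (simp add: line_need_def)
    qed
  qed
  have 4: "reach n tile_set F4 U4"
    unfolding F4_def U4_def
  proof (rule reach_lines[OF 3 _ U3, where pos = snd])
    fix i assume "i \<in> {..m}"
    then have i: "i \<le> m" by simp
    let ?X = "{M..Z} - xcol ` ?P i"
    have e: "?A4 i = (\<lambda>x. (krow i, x)) ` ?X" by auto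
    have "?A4 i \<subseteq> board n" using row_le_m[OF i] bd by auto
    then show "finite (?A4 i) \<and> ?A4 i \<subseteq> board n" using e by simp
    show "kstack i \<subseteq> U3"
    proof
      fix s assume s: "s \<in> kstack i"
      have "snd s < M" "fst s = krow i" using s by (auto simp: kstack_def)
      then have "s \<notin> run c i'" for c i' using run_memD[of s c i'] by auto
      moreover have "s \<notin> cstack i'" for i'
        using row_eq[of i 0 i' "5 * d + 2"] H_bounds \<open>fst s = krow i\<close> by (auto simp: cstack_def)
      ultimately show "s \<in> U3" unfolding U3_def U2_def U1_def U0_def using kstack_tiles[OF i] s by blast
    qed
    have "card (?A4 i) \<le> card ?X" unfolding e by (intro card_image_le) simp
    also have "\<dots> = card {M..Z} - card (xcol ` ?P i)"
      using col_le by (intro card_Diff_subset) auto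
    also have "card (xcol ` ?P i) = card (?P i)"
      by (intro card_image inj_onI) (rule xcol_inj)
    also have "card {M..Z} - card (?P i) = M - line_need N m k i" using cardP[OF i] M by simp
    also have "\<dots> = card (kstack i)" unfolding kstack_def by (rule card_horizontal_segment[symmetric])
    finally show "card (?A4 i) \<le> card (kstack i)" .
    show "kstack i \<inter> kstack i' = {}" if "i \<noteq> i'" for i'
      using row_eq[of i 0 i' 0] that H_bounds by (auto simp: kstack_def)
    fix u s assume "u \<in> ?A4 i" and s: "s \<in> kstack i"
    then obtain x where x: "u = (krow i, x)" "M \<le> x" "x \<le> Z" by blast
    have s': "fst s = krow i" "line_need N m k i \<le> snd s" "snd s < M" using s by (auto simp: kstack_def)
    show "aligned s u" unfolding x(1) by (rule row_line(1)[OF s'(1,3) x(2)])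
    fix v assume "v \<in> between s u"
    from row_line(2)[OF s'(1,3) x(2) this[unfolded x(1)]]
    have v: "fst v = krow i" "snd s < snd v" "snd v < x" by auto
    have ve: "v = (krow i, snd v)" using v by (simp add: prod_eq_iff)
    show "v \<in> F3 \<or> v \<in> ?A4 i \<and> snd v < snd u"
    proof (cases "snd v < M")
      case True
      then have "v \<in> kstack i" using v s' by (cases v) (auto simp: kstack_def)
      then show ?thesis using kstack_tiles[OF i] tF3 by blast
    next
      case False
      show ?thesis
      proof (cases "snd v \<in> xcol ` ?P i")
        case True
        then obtain c where c: "c \<in> ?P i" "snd v = xcol c" by blast
        then show ?thesis using kfilled[OF i c(1)] ve by simp
      next
        case F: False
        have "v \<in> ?A4 i" by (rule CollectI, rule exI[of _ "snd v"]) (use ve F False v x in auto)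
        then show ?thesis using v x by simp
      qed
    qed
  qed simp

  let ?A5 = "{(y, Z) | y. R \<le> y \<and> y \<le> Yt \<and> y \<notin> line_rows}"
  \<comment> \<open>A single line, written as a union over one index to fit
    \<open>reach_lines\<close>.\<close>
  define F5 where "F5 = F4 \<union> (\<Union>l\<in>{()}. ?A5)"
  define U5 where "U5 = U4 - (\<Union>l\<in>{()}. zstack)"
  have U4: "U4 \<subseteq> board n" using U3 unfolding U4_def by blast
  have tF4: "tile_set \<subseteq> F4" unfolding F4_def using tF3 by blast
  have Zfilled: "(y, Z) \<in> F4" if "y \<in> line_rows" for y
    using that unfolding line_rows_def
  proof
    assume "y \<in> krow ` {..m}"
    then obtain i where i: "i \<le> m" "y = krow i" by auto
    have "Z \<notin> xcol ` ?P i"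
    proof
      assume "Z \<in> xcol ` ?P i"
      then obtain c where "Z = xcol c" "c < N" by blast
      then show False using xcol_inj[of N c] by blast
    qed
    then have "(y, Z) \<in> ?A4 i" using i by (intro CollectI exI[of _ Z]) auto
    then show ?thesis unfolding F4_def using i by blast
  next
    assume "y \<in> crow ` {..<m}"
    then obtain i where i: "i < m" "y = crow i" by auto
    have "Z \<noteq> xcol (h i)" using xcol_inj[of N "h i"] hN[OF i(1)] by blast
    then have "(y, Z) \<in> ?A1 i" using i by (intro CollectI exI[of _ Z]) auto
    then have "(y, Z) \<in> F3" using A1[OF i(1)] F14 by blast
    then show ?thesis unfolding F4_def by blast
  qed
  have line_range: "line_rows \<subseteq> {R..Yt}"
    unfolding line_rows_def using row_le_m row_le[of _ "5 * d + 2"] H_bounds by auto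
  have 5: "reach n tile_set F5 U5"
    unfolding F5_def U5_def
  proof (rule reach_lines[OF 4 _ U4, where pos = fst])
    have e: "?A5 = (\<lambda>y. (y, Z)) ` ({R..Yt} - line_rows)" by auto
    have "?A5 \<subseteq> board n" using bd by auto
    then show "finite ?A5 \<and> ?A5 \<subseteq> board n" using e by simp
    show "zstack \<subseteq> U4"
    proof
      fix s assume s: "s \<in> zstack"
      have s': "snd s = Z" "fst s < R" using s by (auto simp: zstack_def)
      then have "s \<notin> run c i'" for c i' using run_memD[of s c i'] by auto
      moreover have "s \<notin> cstack i'" "s \<notin> kstack i'" for i' using s' by (auto simp: cstack_def kstack_def)
      ultimately show "s \<in> U4" unfolding U4_def U3_def U2_def U1_def U0_def using zstack_tiles s by blast
    qed
    have "card ?A5 \<le> card ({R..Yt} - line_rows)" unfolding e by (intro card_image_le) simp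
    also have "\<dots> = card {R..Yt} - card line_rows"
      using line_range by (intro card_Diff_subset) (auto intro: finite_subset)
    also have "\<dots> = R - (2 * m + 1)" using card_line_rows R by simp
    also have "\<dots> = card zstack" unfolding zstack_def by (rule card_vertical_segment[symmetric])
    finally show "card ?A5 \<le> card zstack" .
    fix u s assume "u \<in> ?A5" and s: "s \<in> zstack"
    then obtain y where y: "u = (y, Z)" "R \<le> y" "y \<le> Yt" by blast
    have s': "snd s = Z" "2 * m + 1 \<le> fst s" "fst s < R" using s by (auto simp: zstack_def)
    show "aligned s u" using s' y by (auto simp: aligned_def)
    fix v assume "v \<in> between s u"
    then have v: "snd v = Z" "fst s < fst v" "fst v < y" using s' y by (auto simp: between_def)
    have ve: "v = (fst v, Z)" using v by (simp add: prod_eq_iff)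
    show "v \<in> F4 \<or> v \<in> ?A5 \<and> fst v < fst u"
    proof (cases "fst v < R")
      case True
      then have "v \<in> zstack" using v s' by (cases v) (auto simp: zstack_def)
      then show ?thesis using zstack_tiles tF4 by blast
    next
      case False
      show ?thesis
      proof (cases "fst v \<in> line_rows")
        case True
        then show ?thesis using Zfilled[OF True] ve by simp
      next
        case F: False
        have "v \<in> ?A5" by (rule CollectI, rule exI[of _ "fst v"]) (use ve F False v y in auto)
        then show ?thesis using v y by simp
      qed
    qed
  qed simp_all
  have "Yt \<notin> line_rows"
  proof
    assume "Yt \<in> line_rows"
    then show False
      unfolding line_rows_def
    proof (elim UnE imageE)
      fix i assume i: "Yt = krow i" "i \<in> {..m}"
      then have "krow i \<le> krow m" by (intro row_mono_le') simp
      then show False using i(1) by linarith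
    next
      fix i assume i: "Yt = crow i" "i \<in> {..<m}"
      then have "krow i + H \<le> krow m" by (intro row_mono) simp
      then show False using i(1) H_bounds by linarith
    qed
  qed
  then have "(Yt, Z) \<in> ?A5" by (intro CollectI exI[of _ Yt]) auto
  then have "(Yt, Z) \<in> F5" unfolding F5_def by blast
  with 5 show ?thesis by (rule solvable_ones_reach)
qed

lemma target_not_tile: "(Yt, Z) \<notin> tile_set"
  using tile_Z[of Yt] by auto

lemma hitting_puzzle:
  assumes "Yt < n" "Z < n"
  shows "wf_zhed (ones_puzzle n (Yt, Z) tile_set)"
    "solvable (ones_puzzle n (Yt, Z) tile_set) \<longleftrightarrow> (\<exists>S \<subseteq> {..<N}. card S = k \<and> (\<forall>i<m. \<exists>c\<in>S. hits i c))"
proof -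
  have "1 < n" using assms(1) R by simp
  then show "wf_zhed (ones_puzzle n (Yt, Z) tile_set)"
    using tile_set_board[OF assms] target_not_tile assms
    by (auto simp: wf_zhed_def ones_puzzle_def board_def split: if_splits)
  show "solvable (ones_puzzle n (Yt, Z) tile_set) \<longleftrightarrow> (\<exists>S \<subseteq> {..<N}. card S = k \<and> (\<forall>i<m. \<exists>c\<in>S. hits i c))"
  proof
    assume "solvable (ones_puzzle n (Yt, Z) tile_set)"
    then obtain F src where F: "(Yt, Z) \<in> F" "charging tile_set F src"
      by (rule solvable_ones_charging)
    interpret charged_board N m k d H W M R hits F src
      by unfold_locales (use F in auto)
    show "\<exists>S \<subseteq> {..<N}. card S = k \<and> (\<forall>i<m. \<exists>c\<in>S. hits i c)"
      by (rule hitting_set_from_charging)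
  next
    assume "\<exists>S \<subseteq> {..<N}. card S = k \<and> (\<forall>i<m. \<exists>c\<in>S. hits i c)"
    then obtain S where "S \<subseteq> {..<N}" "card S = k" "\<And>i. i < m \<Longrightarrow> \<exists>c\<in>S. hits i c" by blast
    then show "solvable (ones_puzzle n (Yt, Z) tile_set)"
      by (rule solvable_if_hitting_set[OF _ _ _ assms])
  qed
qed

end

section \<open>Computations as clauses\<close>

text \<open>\<open>Rd\<close> repeats what \<open>Hd\<close> and \<open>Ce\<close> imply, the symbol
  under a head, but detached from the position. Thus a transition is triggered by one state and one
  \<open>Rd\<close> fact per tape, and a step clause mentions a single head position instead of one
  for each tape.\<close>

datatype attr = St nat | Hd nat | Rd nat nat | Ce nat nat

instance attr :: countable by countable_datatype

type_synonym pfun = "bool list \<Rightarrow> nat \<Rightarrow> nat \<Rightarrow> nat \<Rightarrow> nat"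
type_synonym ppred = "bool list \<Rightarrow> nat \<Rightarrow> nat \<Rightarrow> nat \<Rightarrow> bool"
type_synonym lit = "bool \<times> pfun \<times> pfun \<times> attr"
type_synonym clause = "ppred \<times> lit list"

text \<open>
  A fact \<^term>\<open>(t, y, a)\<close> speaks about time \<^term>\<open>t\<close> and, if \<^term>\<open>a\<close> is the position of a head or the
  contents of a cell, about the cell \<^term>\<open>int y - int T\<close>. A clause is a family indexed by a
  time and two positions; its guard selects the indices for which it is meant.
\<close>

locale tm_reduction =
  fixes M :: tm and p q :: "nat poly"
  assumes wf: "wf_tm M"
begin

abbreviation "K \<equiv> num_tapes M"
abbreviation "S \<equiv> num_symbols M"
abbreviation "Q \<equiv> num_states M"

definition guess_len :: "bool list \<Rightarrow> nat" where
  "guess_len w = poly p (length w)"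

text \<open>The first summand bounds the time of the verifier on all relevant pairs. The second
  makes the window of cells from \<open>- T w\<close> to \<open>T w\<close> wide enough for the
  whole input.\<close>

definition T :: "bool list \<Rightarrow> nat" where
  "T w = poly q (2 * length w + 1 + guess_len w) + (2 * length w + guess_len w + 2)"

definition P :: "bool list \<Rightarrow> nat" where
  "P w = 2 * T w + 1"

definition attrs :: "attr list" where
  "attrs = map St [0..<Suc Q] @ map Hd [0..<K] @
     map (\<lambda>(k, s). Rd k s) (List.product [0..<K] [0..<S]) @ map (\<lambda>(k, s). Ce k s) (List.product [0..<K] [0..<S])"

definition A :: nat where
  "A = Suc (sum_list (map to_nat attrs))"

text \<open>Mixed radix coding. Numbers below \<open>nv w\<close> whose last digit is no code of a
  listed attribute are variables without occurrences.\<close>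

definition idx :: "bool list \<Rightarrow> nat \<Rightarrow> nat \<Rightarrow> attr \<Rightarrow> nat" where
  "idx w t y a = (t * P w + y) * A + to_nat a"

definition nv :: "bool list \<Rightarrow> nat" where
  "nv w = (T w + 1) * P w * A"

text \<open>The value 3 marks the cells of the certificate, whose contents the clauses leave open.\<close>

definition fixed_sym :: "bool list \<Rightarrow> nat \<Rightarrow> nat" where
  "fixed_sym w y = (if y < T w then 0
     else if y < T w + 2 * length w then
       (\<Sum>j<length w. of_bool (y = T w + 2 * j) * 2 + of_bool (y = T w + 2 * j + 1) * tape_word w (int j))
     else if y = T w + 2 * length w then 1
     else if y < T w + 2 * length w + 1 + guess_len w then 3 else 0)"

text \<open>The halting state stutters, so that one kind of step clause covers all times up to
  \<open>T w\<close>.\<close>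

definition ext_trans :: "nat \<Rightarrow> nat list \<Rightarrow> nat \<times> (nat \<times> shift) list" where
  "ext_trans s ss = (if s = Q then (Q, map (\<lambda>x. (x, Stay)) ss) else trans M s ss)"

fun shift_pos :: "shift \<Rightarrow> pfun" where
  "shift_pos Shift_Left = (\<lambda>w t y y'. y - 1)"
| "shift_pos Stay = (\<lambda>w t y y'. y)"
| "shift_pos Shift_Right = (\<lambda>w t y y'. y + 1)"

abbreviation (input) always :: ppred where "always \<equiv> \<lambda>w t y y'. True"
abbreviation (input) before_end :: ppred where "before_end \<equiv> \<lambda>w t y y'. t < T w"
abbreviation (input) t0 :: pfun where "t0 \<equiv> \<lambda>w t y y'. 0"
abbreviation (input) tc :: pfun where "tc \<equiv> \<lambda>w t y y'. t"
abbreviation (input) tn :: pfun where "tn \<equiv> \<lambda>w t y y'. Suc t"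
abbreviation (input) mid :: pfun where "mid \<equiv> \<lambda>w t y y'. T w"
abbreviation (input) py :: pfun where "py \<equiv> \<lambda>w t y y'. y"
abbreviation (input) py' :: pfun where "py' \<equiv> \<lambda>w t y y'. y'"

text \<open>The last two clauses leave the certificate free: each of its cells holds some symbol,
  and a blank is followed by blanks, so that the contents is a word of length at most
  \<open>guess_len w\<close>.\<close>

definition init_clauses :: "clause list" where
  "init_clauses = [(always, [(True, t0, t0, St 0)])] @
     map (\<lambda>k. (always, [(True, t0, mid, Hd k)])) [0..<K] @
     map (\<lambda>k. (always, [(True, t0, py, Ce k 0)])) [1..<K] @
     map (\<lambda>s. (\<lambda>w t y y'. fixed_sym w y = s, [(True, t0, py, Ce 0 s)])) [0..<3] @
     [(\<lambda>w t y y'. fixed_sym w y = 3, [(True, t0, py, Ce 0 0), (True, t0, py, Ce 0 1), (True, t0, py, Ce 0 2)]),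
      (\<lambda>w t y y'. fixed_sym w y = 3, [(False, t0, py, Ce 0 0), (True, t0, \<lambda>w t y y'. y + 1, Ce 0 0)])]"

text \<open>The first clause derives what the head reads; the second is the frame condition for
  cells away from the head.\<close>

definition cell_clauses :: "nat \<Rightarrow> nat \<Rightarrow> clause list" where
  "cell_clauses k s =
     [(always, [(False, tc, py, Hd k), (False, tc, py, Ce k s), (True, tc, t0, Rd k s)]),
      (\<lambda>w t y y'. t < T w \<and> y \<noteq> y', [(False, tc, py, Hd k), (False, tc, py', Ce k s), (True, tn, py', Ce k s)])]"

definition premise :: "nat \<Rightarrow> nat list \<Rightarrow> lit list" where
  "premise s ss = (False, tc, t0, St s) # map (\<lambda>k. (False, tc, t0, Rd k (ss ! k))) [0..<K]"

definition step_clauses :: "nat \<Rightarrow> nat list \<Rightarrow> clause list" where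
  "step_clauses s ss = (before_end, premise s ss @ [(True, tn, t0, St (fst (ext_trans s ss)))]) #
     concat (map (\<lambda>k.
       [(\<lambda>w t y y'. t < T w \<and> 0 < y \<and> y + 1 < P w,
          premise s ss @ [(False, tc, py, Hd k), (True, tn, shift_pos (snd (snd (ext_trans s ss) ! k)), Hd k)]),
        (before_end,
          premise s ss @ [(False, tc, py, Hd k), (True, tn, py, Ce k (fst (snd (ext_trans s ss) ! k)))])]) [0..<K])"

text \<open>Cell 0 of the output tape must not hold anything but symbol 2, the bit 1. Requiring
  symbol 2 instead would be worthless, as an assignment may contain that fact in addition to the
  real one.\<close>

definition final_clauses :: "clause list" where
  "final_clauses = map (\<lambda>s. (always, [(False, mid, mid, Ce 1 s)])) (filter (\<lambda>s. s \<noteq> 2) [0..<S])"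

definition clauses :: "clause list" where
  "clauses = init_clauses @ concat (map (\<lambda>(k, s). cell_clauses k s) (List.product [0..<K] [0..<S])) @
     concat (map (\<lambda>(s, ss). step_clauses s ss) (List.product [0..<Suc Q] (List.n_lists K [0..<S]))) @ final_clauses"

definition lit_ok :: "bool list \<Rightarrow> nat \<Rightarrow> nat \<Rightarrow> attr \<Rightarrow> bool" where
  "lit_ok w t y a \<longleftrightarrow> t \<le> T w \<and> y < P w \<and> a \<in> set attrs"

text \<open>A literal outside the window is never true, whatever its sign. Hence clauses that look
  at neighbouring cells need guards.\<close>

fun lit_true :: "(nat \<Rightarrow> nat \<Rightarrow> attr \<Rightarrow> bool) \<Rightarrow> bool list \<Rightarrow> nat \<Rightarrow> nat \<Rightarrow> nat \<Rightarrow> lit \<Rightarrow> bool" where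
  "lit_true \<alpha> w t y y' (sg, tf, pf, a) \<longleftrightarrow>
     lit_ok w (tf w t y y') (pf w t y y') a \<and> \<alpha> (tf w t y y') (pf w t y y') a = sg"

definition holds :: "(nat \<Rightarrow> nat \<Rightarrow> attr \<Rightarrow> bool) \<Rightarrow> bool list \<Rightarrow> nat \<Rightarrow> nat \<Rightarrow> nat \<Rightarrow> clause \<Rightarrow> bool" where
  "holds \<alpha> w t y y' C \<longleftrightarrow> (fst C w t y y' \<longrightarrow> (\<exists>l \<in> set (snd C). lit_true \<alpha> w t y y' l))"

definition satisfies :: "(nat \<Rightarrow> nat \<Rightarrow> attr \<Rightarrow> bool) \<Rightarrow> bool list \<Rightarrow> bool" where
  "satisfies \<alpha> w \<longleftrightarrow> (\<forall>C \<in> set clauses. \<forall>t \<le> T w. \<forall>y < P w. \<forall>y' < P w. holds \<alpha> w t y y' C)"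

subsection \<open>Runs\<close>

abbreviation conf :: "bool list \<Rightarrow> nat \<Rightarrow> config" where
  "conf z t \<equiv> (step_tm M ^^ t) (init_config M z)"

lemma ext_trans_wf:
  assumes "s \<le> Q" "length ss = K" "set ss \<subseteq> {..<S}"
  shows "fst (ext_trans s ss) \<le> Q" "length (snd (ext_trans s ss)) = K"
    "k < K \<Longrightarrow> fst (snd (ext_trans s ss) ! k) < S"
proof -
  have *: "s < Q \<Longrightarrow> fst (trans M s ss) \<le> Q \<and> length (snd (trans M s ss)) = K \<and> fst ` set (snd (trans M s ss)) \<subseteq> {..<S}"
  proof -
    assume "s < Q"
    then have "case trans M s ss of (s', as) \<Rightarrow> s' \<le> Q \<and> length as = K \<and> fst ` set as \<subseteq> {..<S}"
      using wf assms(2,3) unfolding wf_tm_def by (elim conjE allE[of _ s] allE[of _ ss] impE) (intro conjI)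
    then show ?thesis by (simp add: case_prod_unfold)
  qed
  show "fst (ext_trans s ss) \<le> Q" "length (snd (ext_trans s ss)) = K"
    using * assms(1,2) by (simp_all add: ext_trans_def)
  assume k: "k < K"
  show "fst (snd (ext_trans s ss) ! k) < S"
  proof (cases "s = Q")
    case True
    have "ss ! k \<in> set ss" using k assms(2) by simp
    then have "ss ! k < S" using assms(3) by blast
    then show ?thesis using True k assms(2) by (simp add: ext_trans_def)
  next
    case False
    then have "s < Q" using assms by simp
    note * = *[OF this]
    then have "snd (trans M s ss) ! k \<in> set (snd (trans M s ss))" using k by simp
    then have "fst (snd (trans M s ss) ! k) \<in> {..<S}" using * by blast
    then show ?thesis using False by (simp add: ext_trans_def)
  qed
qed

lemma step_ext:
  assumes "length ts = K"
  shows "step_tm M (s, ts) = (fst (ext_trans s (map read_tape ts)), map2 act_tape (snd (ext_trans s (map read_tape ts))) ts)"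
proof (cases "s = Q")
  case True
  have "map2 act_tape (map (\<lambda>x. (x, Stay)) (map read_tape ts)) ts = ts"
    by (intro nth_equalityI) auto
  then show ?thesis using True by (simp add: ext_trans_def step_tm.simps)
next
  case False
  then show ?thesis by (simp add: ext_trans_def step_tm.simps split: prod.splits)
qed

text \<open>A head moves at most one cell per step, so all heads stay in the window of cells up to
  time \<open>T w\<close>.\<close>

lemma conf_wf: "fst (conf z t) \<le> Q \<and> length (snd (conf z t)) = K \<and>
    (\<forall>k<K. \<bar>fst (snd (conf z t) ! k)\<bar> \<le> int t \<and> (\<forall>x. snd (snd (conf z t) ! k) x < S))"
proof (induction t)
  case 0
  have K: "2 \<le> K" "3 \<le> S" using wf by (auto simp: wf_tm_def)
  have "length (snd (init_config M z)) = K" using K by (simp add: init_config_def)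
  moreover have "fst (snd (init_config M z) ! k) = 0 \<and> snd (snd (init_config M z) ! k) x < S" if "k < K" for k x
    using that K by (cases k) (auto simp: init_config_def tape_word_def)
  ultimately show ?case using K by (simp add: init_config_def)
next
  case (Suc t)
  obtain s ts where c: "conf z t = (s, ts)" by fastforce
  let ?ss = "map read_tape ts"
  have s: "s \<le> Q" "length ts = K" and tape: "\<And>k. k < K \<Longrightarrow> \<bar>fst (ts ! k)\<bar> \<le> int t" "\<And>k x. k < K \<Longrightarrow> snd (ts ! k) x < S"
    using Suc c by auto
  have ss: "length ?ss = K" "set ?ss \<subseteq> {..<S}"
  proof -
    show "length ?ss = K" using s by simp
    have "read_tape x < S" if "x \<in> set ts" for x
      using that s(2) tape(2) unfolding in_set_conv_nth read_tape_def by metis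
    then show "set ?ss \<subseteq> {..<S}" by auto
  qed
  note e = ext_trans_wf[OF s(1) ss]
  have n: "conf z (Suc t) = (fst (ext_trans s ?ss), map2 act_tape (snd (ext_trans s ?ss)) ts)"
    using step_ext[OF s(2), of s] c by simp
  have "\<bar>fst (act_tape (snd (ext_trans s ?ss) ! k) (ts ! k))\<bar> \<le> int (Suc t) \<and>
      (\<forall>x. snd (act_tape (snd (ext_trans s ?ss) ! k) (ts ! k)) x < S)" if k: "k < K" for k
  proof -
    obtain x mv where a: "snd (ext_trans s ?ss) ! k = (x, mv)" by fastforce
    obtain h v where tk: "ts ! k = (h, v)" by fastforce
    have "\<bar>shift_amount mv\<bar> \<le> 1" by (cases mv) auto
    moreover have "x < S" using e(3)[OF k] a by simp
    ultimately show ?thesis using tape[OF k] a tk by auto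
  qed
  then show ?case using n e(1,2) s(2) by simp
qed

lemma conf_step:
  fixes z t
  defines "ss \<equiv> map read_tape (snd (conf z t))"
  shows "fst (conf z (Suc t)) = fst (ext_trans (fst (conf z t)) ss)"
    and "k < K \<Longrightarrow> snd (conf z (Suc t)) ! k = act_tape (snd (ext_trans (fst (conf z t)) ss) ! k) (snd (conf z t) ! k)"
    and "fst (conf z t) \<le> Q" "length ss = K" "set ss \<subseteq> {..<S}" "k < K \<Longrightarrow> ss ! k = read_tape (snd (conf z t) ! k)"
proof -
  note c = conf_wf[where z = z and t = t]
  have n: "conf z (Suc t) = (fst (ext_trans (fst (conf z t)) ss), map2 act_tape (snd (ext_trans (fst (conf z t)) ss)) (snd (conf z t)))"
    using step_ext[of "snd (conf z t)" "fst (conf z t)"] c by (simp add: ss_def)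
  show "fst (conf z t) \<le> Q" using c by blast
  show len: "length ss = K" using c by (simp add: ss_def)
  have "read_tape x < S" if x: "x \<in> set (snd (conf z t))" for x
  proof -
    obtain i where "i < K" "x = snd (conf z t) ! i" using x c unfolding in_set_conv_nth by metis
    then show ?thesis using c by (simp add: read_tape_def)
  qed
  then show sub: "set ss \<subseteq> {..<S}" by (auto simp: ss_def)
  show "fst (conf z (Suc t)) = fst (ext_trans (fst (conf z t)) ss)" using n by simp
  have "length (snd (ext_trans (fst (conf z t)) ss)) = K" using ext_trans_wf(2)[OF _ len sub] c by blast
  then show "snd (conf z (Suc t)) ! k = act_tape (snd (ext_trans (fst (conf z t)) ss) ! k) (snd (conf z t) ! k)" if "k < K"
    using n c that by simp
  show "ss ! k = read_tape (snd (conf z t) ! k)" if "k < K" using c that by (simp add: ss_def)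
qed

lemma conf_halted:
  assumes "computes_in_time M (\<lambda>x. [x \<in> B]) (poly q)" "poly q (length z) \<le> n"
  shows "snd (snd (conf z n) ! 1) = tape_word [z \<in> B]"
proof -
  let ?T = "poly q (length z)"
  have h: "fst (conf z ?T) = Q" "snd (snd (conf z ?T) ! 1) = tape_word [z \<in> B]"
  proof -
    have "case conf z ?T of (s, ts) \<Rightarrow> s = Q \<and> snd (ts ! 1) = tape_word [z \<in> B]"
      using assms(1) unfolding computes_in_time_def by (elim conjE allE[of _ z])
    then show "fst (conf z ?T) = Q" "snd (snd (conf z ?T) ! 1) = tape_word [z \<in> B]"
      by (simp_all add: case_prod_unfold)
  qed
  have "step_tm M (conf z ?T) = conf z ?T"
    using h(1) by (cases "conf z ?T") (simp add: step_tm.simps)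
  then have "(step_tm M ^^ j) (conf z ?T) = conf z ?T" for j by (induction j) auto
  from this[of "n - ?T"] have "conf z (?T + (n - ?T)) = conf z ?T" by (intro funpow_trans) auto
  then show ?thesis using h(2) assms(2) by simp
qed

lemma length_le_T: "length u \<le> guess_len w \<Longrightarrow> poly q (length (pair_word w u)) \<le> T w"
  using poly_nat_mono[of "2 * length w + 1 + length u" "2 * length w + 1 + guess_len w" q]
  by (simp add: length_pair_word T_def)

lemma fixed_sym_correct:
  assumes u: "length u \<le> guess_len w" and f: "fixed_sym w y \<noteq> 3"
  shows "tape_word (pair_word w u) (int y - int (T w)) = fixed_sym w y"
proof -
  let ?z = "pair_word w u" and ?l = "length w"
  consider "y < T w" | j where "j < ?l" "y = T w + 2 * j" | j where "j < ?l" "y = T w + 2 * j + 1"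
    | "y = T w + 2 * ?l" | "T w + 2 * ?l + 1 + guess_len w \<le> y"
  proof -
    have "y < T w \<or> (\<exists>j<?l. y = T w + 2 * j \<or> y = T w + 2 * j + 1) \<or> T w + 2 * ?l \<le> y"
    proof (cases "T w \<le> y \<and> y < T w + 2 * ?l")
      case True
      then have "(y - T w) div 2 < ?l" "y = T w + 2 * ((y - T w) div 2) \<or> y = T w + 2 * ((y - T w) div 2) + 1"
        by auto
      then show ?thesis by blast
    qed auto
    moreover have "T w + 2 * ?l \<le> y \<Longrightarrow> y = T w + 2 * ?l \<or> T w + 2 * ?l + 1 + guess_len w \<le> y"
      using f by (auto simp: fixed_sym_def split: if_splits)
    ultimately show thesis using that by blast
  qed
  then show ?thesis
  proof cases
    case 1
    then show ?thesis by (simp add: fixed_sym_def tape_word_def)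
  next
    case (2 j)
    have "fixed_sym w y = (\<Sum>j'<?l. if j' = j then 2 else 0)"
    proof -
      have "(\<Sum>j'<?l. of_bool (y = T w + 2 * j') * 2 + of_bool (y = T w + 2 * j' + 1) * tape_word w (int j')) =
          (\<Sum>j'<?l. if j' = j then 2 else 0)"
        using 2 by (intro sum.cong refl) (auto; presburger)
      then show ?thesis using 2 unfolding fixed_sym_def by simp
    qed
    also have "\<dots> = 2" using 2 by simp
    finally show ?thesis using 2 pair_word_flag[of j w u] by simp
  next
    case (3 j)
    have "fixed_sym w y = (\<Sum>j'<?l. if j' = j then tape_word w (int j) else 0)"
    proof -
      have "(\<Sum>j'<?l. of_bool (y = T w + 2 * j') * 2 + of_bool (y = T w + 2 * j' + 1) * tape_word w (int j')) =
          (\<Sum>j'<?l. if j' = j then tape_word w (int j) else 0)"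
        using 3 by (intro sum.cong refl) (auto; presburger)
      then show ?thesis using 3 unfolding fixed_sym_def by simp
    qed
    also have "\<dots> = tape_word w (int j)" using 3 by simp
    finally show ?thesis using 3 pair_word_fst[of j w u] by (simp add: algebra_simps)
  next
    case 4
    then show ?thesis using pair_word_sep[of w u] by (simp add: fixed_sym_def)
  next
    case 5
    have "tape_word ?z (int y - int (T w)) = 0"
      using 5 u by (simp add: tape_word_def length_pair_word)
    then show ?thesis using 5 by (simp add: fixed_sym_def)
  qed
qed

lemma fixed_sym_le: "fixed_sym w y \<noteq> 3 \<Longrightarrow> fixed_sym w y < 3"
  using fixed_sym_correct[of "[]" w y] by (auto simp: tape_word_def split: if_splits)

lemma fixed_sym_guess: "fixed_sym w y = 3 \<longleftrightarrow> (\<exists>i<guess_len w. y = T w + (2 * length w + 1 + i))"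
proof
  assume f: "fixed_sym w y = 3"
  show "\<exists>i<guess_len w. y = T w + (2 * length w + 1 + i)"
  proof (rule ccontr)
    assume n: "\<not> ?thesis"
    have "\<not> (T w + 2 * length w < y \<and> y < T w + 2 * length w + 1 + guess_len w)"
    proof
      assume "T w + 2 * length w < y \<and> y < T w + 2 * length w + 1 + guess_len w"
      then have "y = T w + (2 * length w + 1 + (y - (T w + 2 * length w + 1)))"
        "y - (T w + 2 * length w + 1) < guess_len w" by auto
      then show False using n by blast
    qed
    then have in_w: "T w \<le> y" "y < T w + 2 * length w"
      using f by (auto simp: fixed_sym_def split: if_splits)
    define j where "j = (y - T w) div 2"
    have "(\<Sum>j'<length w. of_bool (y = T w + 2 * j') * 2 + of_bool (y = T w + 2 * j' + 1) * tape_word w (int j')) =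
        (\<Sum>j'<length w. if j' = j then (if even (y - T w) then 2 else tape_word w (int j)) else 0)"
      using in_w by (intro sum.cong) (auto simp: j_def)
    also have "\<dots> \<le> 2" by (simp add: tape_word_def)
    finally show False using f in_w by (simp add: fixed_sym_def)
  qed
next
  assume "\<exists>i<guess_len w. y = T w + (2 * length w + 1 + i)"
  then show "fixed_sym w y = 3" by (auto simp: fixed_sym_def)
qed

lemma attrs_iff [simp]:
  "St s \<in> set attrs \<longleftrightarrow> s \<le> Q" "Hd k \<in> set attrs \<longleftrightarrow> k < K"
  "Rd k s \<in> set attrs \<longleftrightarrow> k < K \<and> s < S" "Ce k s \<in> set attrs \<longleftrightarrow> k < K \<and> s < S"
  by (simp_all add: attrs_def image_iff less_Suc_eq_le del: upt_Suc)

lemma wf_bounds: "2 \<le> K" "3 \<le> S"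
  using wf by (auto simp: wf_tm_def)

lemma P_bounds: "0 < P w" "T w < P w"
  by (auto simp: P_def)

lemma T_ge: "2 * length w + guess_len w + 2 \<le> T w"
  by (simp add: T_def)

lemma init_conf:
  "fst (init_config M z) = 0" "k < K \<Longrightarrow> fst (snd (init_config M z) ! k) = 0"
  "snd (snd (init_config M z) ! 0) = tape_word z" "0 < k \<Longrightarrow> k < K \<Longrightarrow> snd (snd (init_config M z) ! k) x = 0"
  by (cases k; simp add: init_config_def tape_word_def)+

lemma set_concat_product:
  "C \<in> set (concat (map (\<lambda>(a, b). f a b) (List.product xs ys))) \<longleftrightarrow> (\<exists>a \<in> set xs. \<exists>b \<in> set ys. C \<in> set (f a b))"
  by auto

lemma set_clauses:
  "C \<in> set clauses \<longleftrightarrow> C \<in> set init_clauses \<or> (\<exists>k<K. \<exists>s<S. C \<in> set (cell_clauses k s)) \<or>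
     (\<exists>s\<le>Q. \<exists>ss. length ss = K \<and> set ss \<subseteq> {..<S} \<and> C \<in> set (step_clauses s ss)) \<or> C \<in> set final_clauses"
  unfolding clauses_def set_append Un_iff set_concat_product set_n_lists
  by (simp add: Bex_def atLeast0LessThan less_Suc_eq_le del: product_concat_map upt_Suc)

end

context tm_reduction begin

subsection \<open>From runs to assignments and back\<close>

text \<open>States and read symbols have no position; their facts are placed at position 0.\<close>

fun truth :: "bool list \<Rightarrow> bool list \<Rightarrow> nat \<Rightarrow> nat \<Rightarrow> attr \<Rightarrow> bool" where
  "truth w z t y (St s) \<longleftrightarrow> y = 0 \<and> fst (conf z t) = s"
| "truth w z t y (Hd k) \<longleftrightarrow> fst (snd (conf z t) ! k) = int y - int (T w)"
| "truth w z t y (Rd k s) \<longleftrightarrow> y = 0 \<and> read_tape (snd (conf z t) ! k) = s"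
| "truth w z t y (Ce k s) \<longleftrightarrow> snd (snd (conf z t) ! k) (int y - int (T w)) = s"

lemma init_clauses_hold:
  assumes u: "length u \<le> guess_len w" and C: "C \<in> set init_clauses" and y: "y < P w"
  shows "holds (truth w (pair_word w u)) w t y y' C"
proof -
  let ?z = "pair_word w u"
  let ?h = "holds (truth w ?z) w t y y'"
  have 1: "?h (always, [(True, t0, t0, St 0)])"
    by (simp add: holds_def lit_ok_def init_conf P_bounds)
  have 2: "?h (always, [(True, t0, mid, Hd k)])" if "k < K" for k
    using that by (simp add: holds_def lit_ok_def init_conf P_bounds)
  have 3: "?h (always, [(True, t0, py, Ce k 0)])" if "0 < k" "k < K" for k
    using that y wf_bounds by (simp add: holds_def lit_ok_def init_conf)
  have 4: "?h (\<lambda>w t y y'. fixed_sym w y = s, [(True, t0, py, Ce 0 s)])" if "s < 3" for s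
    using that y wf_bounds fixed_sym_correct[OF u, of y] by (auto simp: holds_def lit_ok_def init_conf)
  have 5: "?h (\<lambda>w t y y'. fixed_sym w y = 3, [(True, t0, py, Ce 0 0), (True, t0, py, Ce 0 1), (True, t0, py, Ce 0 2)])"
  proof -
    have "tape_word ?z x = 0 \<or> tape_word ?z x = 1 \<or> tape_word ?z x = 2" for x by (simp add: tape_word_def)
    from this[of "int y - int (T w)"] show ?thesis using y wf_bounds by (simp add: holds_def lit_ok_def init_conf)
  qed
  have 6: "?h (\<lambda>w t y y'. fixed_sym w y = 3, [(False, t0, py, Ce 0 0), (True, t0, \<lambda>w t y y'. y + 1, Ce 0 0)])"
  proof -
    have "y + 1 < P w \<and> (tape_word ?z (int y - int (T w)) = 0 \<longrightarrow> tape_word ?z (int (y + 1) - int (T w)) = 0)"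
      if y3: "fixed_sym w y = 3"
    proof -
      obtain i where "i < guess_len w" "y = T w + (2 * length w + 1 + i)"
        using y3 unfolding fixed_sym_guess by blast
      then show ?thesis using T_ge[of w] by (auto simp: P_def tape_word_def length_pair_word)
    qed
    then show ?thesis using y wf_bounds by (auto simp: holds_def lit_ok_def init_conf)
  qed
  have "\<forall>C \<in> set init_clauses. ?h C"
    unfolding init_clauses_def
    by (simp only: set_append ball_Un set_map list.set ball_simps) (intro conjI ballI TrueI; (rule 1 2 3 4 5 6; simp))
  then show ?thesis using C by blast
qed

lemma cell_clauses_hold:
  assumes "C \<in> set (cell_clauses k s)" "k < K" "s < S" "t \<le> T w" "y < P w" "y' < P w"
  shows "holds (truth w z) w t y y' C"
proof -
  let ?h = "holds (truth w z) w t y y'"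
  have 1: "?h (always, [(False, tc, py, Hd k), (False, tc, py, Ce k s), (True, tc, t0, Rd k s)])"
    using assms(2-) P_bounds by (auto simp: holds_def lit_ok_def read_tape_def)
  have 2: "?h (\<lambda>w t y y'. t < T w \<and> y \<noteq> y', [(False, tc, py, Hd k), (False, tc, py', Ce k s), (True, tn, py', Ce k s)])"
  proof -
    have "snd (snd (conf z (Suc t)) ! k) x = snd (snd (conf z t) ! k) x" if "x \<noteq> fst (snd (conf z t) ! k)" for x
    proof -
      obtain a mv h v where "snd (ext_trans (fst (conf z t)) (map read_tape (snd (conf z t)))) ! k = (a, mv)"
        "snd (conf z t) ! k = (h, v)" by fastforce
      then show ?thesis using conf_step(2)[where z = z and t = t, OF assms(2)] that by simp
    qed
    then show ?thesis using assms(2-) by (auto simp: holds_def lit_ok_def simp del: funpow.simps)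
  qed
  have "\<forall>C \<in> set (cell_clauses k s). ?h C"
    unfolding cell_clauses_def list.set ball_simps by (intro conjI TrueI 1 2)
  then show ?thesis using assms(1) by blast
qed

lemma premise_cases:
  assumes "s \<le> Q" "length ss = K" "set ss \<subseteq> {..<S}" "t \<le> T w"
  shows "(\<exists>l \<in> set (premise s ss). lit_true (truth w z) w t y y' l) \<or>
    fst (conf z t) = s \<and> map read_tape (snd (conf z t)) = ss"
proof (cases "fst (conf z t) = s \<and> (\<forall>k<K. read_tape (snd (conf z t) ! k) = ss ! k)")
  case True
  then have "map read_tape (snd (conf z t)) = ss"
    using assms(2) conf_wf[where z = z and t = t] by (intro nth_equalityI) auto
  then show ?thesis using True by blast
next
  case False
  moreover have "ss ! k < S" if "k < K" for k
  proof -
    have "ss ! k \<in> set ss" using that assms(2) by simp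
    then show ?thesis using assms(3) by blast
  qed
  ultimately show ?thesis using assms P_bounds(1)[of w] by (auto simp: premise_def lit_ok_def)
qed

lemma shift_pos_int:
  "0 < y \<Longrightarrow> int (shift_pos mv w t y y') = int y + shift_amount mv"
  "shift_pos mv w t y y' \<le> y + 1"
  by (cases mv; simp)+

lemma step_clauses_hold:
  assumes C: "C \<in> set (step_clauses s ss)" and s: "s \<le> Q" "length ss = K" "set ss \<subseteq> {..<S}"
    and t: "t \<le> T w" "y < P w"
  shows "holds (truth w z) w t y y' C"
proof -
  have pre: "holds (truth w z) w t y y' (g, premise s ss @ ls)"
    if ls: "\<lbrakk>g w t y y'; fst (conf z t) = s; map read_tape (snd (conf z t)) = ss\<rbrakk> \<Longrightarrow> \<exists>l \<in> set ls. lit_true (truth w z) w t y y' l"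
    for g ls
    using premise_cases[OF s t(1), of z y y'] ls unfolding holds_def by auto
  note e = ext_trans_wf[OF s]
  let ?h = "holds (truth w z) w t y y'"
  have 1: "?h (before_end, premise s ss @ [(True, tn, t0, St (fst (ext_trans s ss)))])"
    using e(1) P_bounds(1)[of w] conf_step(1)[where z = z and t = t]
    by (intro pre) (auto simp: lit_ok_def simp del: funpow.simps)
  have 2: "?h (\<lambda>w t y y'. t < T w \<and> 0 < y \<and> y + 1 < P w,
      premise s ss @ [(False, tc, py, Hd k), (True, tn, shift_pos (snd (snd (ext_trans s ss) ! k)), Hd k)])"
    and 3: "?h (before_end,
      premise s ss @ [(False, tc, py, Hd k), (True, tn, py, Ce k (fst (snd (ext_trans s ss) ! k)))])"
    if k: "k < K" for k
  proof -
    obtain a mv where m: "snd (ext_trans s ss) ! k = (a, mv)" by fastforce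
    obtain h v where hv: "snd (conf z t) ! k = (h, v)" by fastforce
    have new: "snd (conf z (Suc t)) ! k = (h + shift_amount mv, v(h := a))"
      if "fst (conf z t) = s" "map read_tape (snd (conf z t)) = ss"
      using conf_step(2)[where z = z and t = t, OF k] that m hv by (simp del: funpow.simps)
    show "?h (\<lambda>w t y y'. t < T w \<and> 0 < y \<and> y + 1 < P w,
      premise s ss @ [(False, tc, py, Hd k), (True, tn, shift_pos (snd (snd (ext_trans s ss) ! k)), Hd k)])"
      using new k m hv shift_pos_int[where y = y and mv = mv and w = w and t = t and y' = y'] t
      by (intro pre) (auto simp: lit_ok_def simp del: funpow.simps)
    show "?h (before_end,
      premise s ss @ [(False, tc, py, Hd k), (True, tn, py, Ce k (fst (snd (ext_trans s ss) ! k)))])"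
      using new k m hv e(3)[OF k] t
      by (intro pre) (auto simp: lit_ok_def simp del: funpow.simps)
  qed
  have "\<forall>C \<in> set (step_clauses s ss). ?h C"
    unfolding step_clauses_def
    by (simp only: set_concat set_map list.set ball_simps ball_UN) (intro conjI ballI TrueI; (rule 1 2 3; simp))
  then show ?thesis using C by blast
qed

lemma satisfies_if_accepts:
  assumes M: "computes_in_time M (\<lambda>x. [x \<in> B]) (poly q)"
    and u: "length u \<le> guess_len w" "pair_word w u \<in> B"
  shows "satisfies (truth w (pair_word w u)) w"
proof -
  let ?h = "holds (truth w (pair_word w u)) w"
  have "snd (snd (conf (pair_word w u) (T w)) ! 1) 0 = 2"
    using conf_halted[OF M length_le_T[OF u(1)]] u(2) by (simp add: tape_word_def)
  then have "?h t y y' (always, [(False, mid, mid, Ce 1 s)])" if "s < S" "s \<noteq> 2" for s t y y'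
    using that wf_bounds P_bounds by (simp add: holds_def lit_ok_def)
  then have final: "\<forall>C \<in> set final_clauses. ?h t y y' C" for t y y'
    unfolding final_clauses_def set_map ball_simps set_filter by simp
  show ?thesis unfolding satisfies_def
  proof (intro ballI allI impI)
    fix C t y y' assume C: "C \<in> set clauses" and b: "t \<le> T w" "y < P w" "y' < P w"
    from C[unfolded set_clauses] show "?h t y y' C"
    proof (elim disjE exE conjE)
      assume "C \<in> set init_clauses"
      then show ?thesis by (rule init_clauses_hold[OF u(1) _ b(2)])
    next
      fix k s assume "k < K" "s < S" "C \<in> set (cell_clauses k s)"
      then show ?thesis using cell_clauses_hold b by simp
    next
      fix s ss assume "s \<le> Q" "length ss = K" "set ss \<subseteq> {..<S}" "C \<in> set (step_clauses s ss)"
      then show ?thesis using step_clauses_hold b(1,2) by simp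
    next
      assume "C \<in> set final_clauses"
      then show ?thesis using final by blast
    qed
  qed
qed

lemma set_concat_upt: "k < n \<Longrightarrow> c \<in> set (f k) \<Longrightarrow> c \<in> set (concat (map f [0..<n]))"
  by auto

lemma step_clauses_mem:
  "(before_end, premise s ss @ [(True, tn, t0, St (fst (ext_trans s ss)))]) \<in> set (step_clauses s ss)"
  "k < K \<Longrightarrow> (\<lambda>w t y y'. t < T w \<and> 0 < y \<and> y + 1 < P w,
     premise s ss @ [(False, tc, py, Hd k), (True, tn, shift_pos (snd (snd (ext_trans s ss) ! k)), Hd k)])
     \<in> set (step_clauses s ss)"
  "k < K \<Longrightarrow> (before_end,
     premise s ss @ [(False, tc, py, Hd k), (True, tn, py, Ce k (fst (snd (ext_trans s ss) ! k)))])
     \<in> set (step_clauses s ss)"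
  unfolding step_clauses_def
  by (rule list.set_intros(1), (rule list.set_intros(2), rule set_concat_upt[where k = k], simp, simp)+)

lemma cell_clauses_mem:
  assumes "k < K" "s < S"
  shows "(always, [(False, tc, py, Hd k), (False, tc, py, Ce k s), (True, tc, t0, Rd k s)]) \<in> set clauses"
    "(\<lambda>w t y y'. t < T w \<and> y \<noteq> y', [(False, tc, py, Hd k), (False, tc, py', Ce k s), (True, tn, py', Ce k s)]) \<in> set clauses"
proof -
  have "C \<in> set clauses" if "C \<in> set (cell_clauses k s)" for C
    using that assms unfolding set_clauses by blast
  then show "(always, [(False, tc, py, Hd k), (False, tc, py, Ce k s), (True, tc, t0, Rd k s)]) \<in> set clauses"
    "(\<lambda>w t y y'. t < T w \<and> y \<noteq> y', [(False, tc, py, Hd k), (False, tc, py', Ce k s), (True, tn, py', Ce k s)]) \<in> set clauses"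
    by (simp_all add: cell_clauses_def)
qed

text \<open>Nothing excludes additional facts, so only one inclusion is shown: whatever is the case
  in the run on the extracted certificate is true under \<alpha>. The certificate ends before the
  first cell that \<alpha> declares blank; all its later cells are then blank as well.\<close>

lemma accepts_if_satisfies:
  assumes M: "computes_in_time M (\<lambda>x. [x \<in> B]) (poly q)" and sat: "satisfies \<alpha> w"
  shows "\<exists>u. length u \<le> guess_len w \<and> pair_word w u \<in> B"
proof -
  let ?l = "length w"
  let ?g = "\<lambda>i. T w + (2 * ?l + 1 + i)"
  have C: "holds \<alpha> w t y y' C" if "C \<in> set clauses" "t \<le> T w" "y < P w" "y' < P w" for C t y y'
    using that sat unfolding satisfies_def by blast
  have init: "holds \<alpha> w 0 y 0 C" if "C \<in> set init_clauses" "y < P w" for C y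
    using that C P_bounds(1)[of w] set_clauses by blast
  have fixed: "\<alpha> 0 y (Ce 0 s)" if "fixed_sym w y = s" "s < 3" "y < P w" for y s
  proof -
    have "(\<lambda>w t y y'. fixed_sym w y = s, [(True, t0, py, Ce 0 s)]) \<in> set init_clauses"
      using that(2) unfolding init_clauses_def by auto
    from init[OF this that(3)] that show ?thesis by (simp add: holds_def)
  qed
  have g_lt: "?g i < P w" if "i \<le> guess_len w" for i
    using that T_ge[of w] by (simp add: P_def)
  have some: "\<alpha> 0 (?g i) (Ce 0 0) \<or> \<alpha> 0 (?g i) (Ce 0 1) \<or> \<alpha> 0 (?g i) (Ce 0 2)"
    and up: "\<alpha> 0 (?g i) (Ce 0 0) \<Longrightarrow> \<alpha> 0 (?g (Suc i)) (Ce 0 0)" if i: "i < guess_len w" for i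
  proof -
    have 3: "fixed_sym w (?g i) = 3" using i unfolding fixed_sym_guess by blast
    have m: "(\<lambda>w t y y'. fixed_sym w y = 3, [(True, t0, py, Ce 0 0), (True, t0, py, Ce 0 1), (True, t0, py, Ce 0 2)]) \<in> set init_clauses"
      "(\<lambda>w t y y'. fixed_sym w y = 3, [(False, t0, py, Ce 0 0), (True, t0, \<lambda>w t y y'. y + 1, Ce 0 0)]) \<in> set init_clauses"
      unfolding init_clauses_def by auto
    show "\<alpha> 0 (?g i) (Ce 0 0) \<or> \<alpha> 0 (?g i) (Ce 0 1) \<or> \<alpha> 0 (?g i) (Ce 0 2)"
      using init[OF m(1) g_lt[of i]] i 3 by (simp add: holds_def) blast
    show "\<alpha> 0 (?g (Suc i)) (Ce 0 0)" if "\<alpha> 0 (?g i) (Ce 0 0)"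
      using init[OF m(2) g_lt[of i]] i 3 that by (simp add: holds_def)
  qed
  have "fixed_sym w (?g (guess_len w)) = 0" by (simp add: fixed_sym_def)
  then have last: "\<alpha> 0 (?g (guess_len w)) (Ce 0 0)" using fixed[of _ 0] g_lt by simp
  let ?end = "\<lambda>i. \<alpha> 0 (?g i) (Ce 0 0)"
  define n where "n = (LEAST i. ?end i)"
  have n: "\<alpha> 0 (?g n) (Ce 0 0)" "n \<le> guess_len w"
    unfolding n_def using LeastI[of ?end, OF last] Least_le[of ?end, OF last] .
  have below: "\<not> \<alpha> 0 (?g i) (Ce 0 0)" if "i < n" for i
    using not_less_Least[of i ?end] that unfolding n_def by blast
  have above: "\<alpha> 0 (?g (n + j)) (Ce 0 0)" if "n + j \<le> guess_len w" for j
    using that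
  proof (induction j)
    case 0
    then show ?case using n(1) by simp
  next
    case (Suc j)
    then show ?case using up[of "n + j"] by simp
  qed
  \<comment> \<open>If \<alpha> allows both bits in a cell, the bit 1 is taken; it is enough that
    the chosen symbol is one that \<alpha> allows.\<close>
  define u where "u = map (\<lambda>i. \<alpha> 0 (?g i) (Ce 0 2)) [0..<n]"
  have u: "length u \<le> guess_len w" using n(2) by (simp add: u_def)
  let ?z = "pair_word w u"
  have input: "\<alpha> 0 y (Ce 0 (tape_word ?z (int y - int (T w))))" if y: "y < P w" for y
  proof (cases "fixed_sym w y = 3")
    case False
    then show ?thesis using fixed[of y "fixed_sym w y"] fixed_sym_le fixed_sym_correct[OF u] y by simp
  next
    case True
    then obtain i where i: "i < guess_len w" "y = ?g i" unfolding fixed_sym_guess by blast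
    have e: "tape_word ?z (int y - int (T w)) = tape_word u (int i)"
      using i pair_word_snd[of w u i] by simp
    show ?thesis
    proof (cases "i < n")
      case True
      then show ?thesis using below[OF True] some[OF i(1)] i(2) unfolding e by (auto simp: u_def tape_word_def)
    next
      case False
      then have "tape_word u (int i) = 0" by (simp add: u_def tape_word_def)
      then show ?thesis using above[of "i - n"] False i unfolding e by simp
    qed
  qed
  \<comment> \<open>By induction the premise of the clause for the actual transition holds under
    \<alpha>, so its conclusion, a fact of the next configuration, is forced.\<close>
  have run: "\<alpha> t 0 (St (fst (conf ?z t))) \<and>
      (\<forall>k<K. (\<forall>y. int y = fst (snd (conf ?z t) ! k) + int (T w) \<longrightarrow> \<alpha> t y (Hd k)) \<and>
        (\<forall>y<P w. \<alpha> t y (Ce k (snd (snd (conf ?z t) ! k) (int y - int (T w))))))" if "t \<le> T w" for t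
    using that
  proof (induction t)
    case 0
    have "\<alpha> 0 0 (St 0)"
      using init[of "(always, [(True, t0, t0, St 0)])" 0] P_bounds by (simp add: init_clauses_def holds_def)
    moreover have "\<alpha> 0 (T w) (Hd k)" if "k < K" for k
      using init[of "(always, [(True, t0, mid, Hd k)])" 0] P_bounds that by (auto simp: init_clauses_def holds_def)
    moreover have "\<alpha> 0 y (Ce k 0)" if "0 < k" "k < K" "y < P w" for k y
      using init[of "(always, [(True, t0, py, Ce k 0)])" y] that by (auto simp: init_clauses_def holds_def)
    moreover have "\<alpha> 0 y (Ce k (snd (snd (init_config M ?z) ! k) (int y - int (T w))))" if "k < K" "y < P w" for k y
      using that input[of y] calculation(3)[of k y] by (cases "k = 0") (simp_all add: init_conf)
    ultimately show ?case by (simp add: init_conf)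
  next
    case (Suc t)
    define s where "s = fst (conf ?z t)"
    define ss where "ss = map read_tape (snd (conf ?z t))"
    note st = conf_step[where z = ?z and t = t, folded ss_def s_def]
    have t: "t < T w" "t \<le> T w" using Suc.prems by auto
    define h where "h k = fst (snd (conf ?z t) ! k)" for k
    define v where "v k = snd (snd (conf ?z t) ! k)" for k
    define pos where "pos k = nat (h k + int (T w))" for k
    have IH: "\<alpha> t 0 (St s)" "\<And>k. k < K \<Longrightarrow> \<alpha> t (pos k) (Hd k)" "\<And>k y. k < K \<Longrightarrow> y < P w \<Longrightarrow> \<alpha> t y (Ce k (v k (int y - int (T w))))"
      and pos: "\<And>k. k < K \<Longrightarrow> int (pos k) = h k + int (T w) \<and> 0 < pos k \<and> pos k + 1 < P w"
    proof -
      have hk: "\<bar>h k\<bar> \<le> int t" if "k < K" for k using conf_wf[where z = ?z and t = t] that by (simp add: h_def)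
      show pos: "int (pos k) = h k + int (T w) \<and> 0 < pos k \<and> pos k + 1 < P w" if "k < K" for k
        using hk[OF that] t by (simp add: pos_def P_def) linarith
      show "\<alpha> t 0 (St s)" "k < K \<Longrightarrow> \<alpha> t (pos k) (Hd k)" "k < K \<Longrightarrow> y < P w \<Longrightarrow> \<alpha> t y (Ce k (v k (int y - int (T w))))" for k y
        using Suc.IH[OF t(2)] pos[of k] by (auto simp: s_def h_def v_def)
    qed
    have vS: "v k x < S" if "k < K" for k x using conf_wf[where z = ?z and t = t] that by (simp add: v_def)
    have ssk: "ss ! k = v k (h k)" if "k < K" for k using st(6)[OF that] by (simp add: read_tape_def h_def v_def)
    have rd: "\<alpha> t 0 (Rd k (ss ! k))" if k: "k < K" for k
    proof -
      have "ss ! k < S" using ssk[OF k] vS[OF k] by simp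
      note m = cell_clauses_mem(1)[OF k this]
      have "pos k < P w" "int (pos k) - int (T w) = h k" using pos[OF k] by auto
      then show ?thesis
        using C[OF m t(2), of "pos k" 0] P_bounds(1)[of w] IH(2)[OF k] IH(3)[OF k, of "pos k"] ssk[OF k]
        by (simp add: holds_def)
    qed
    have pre: "\<not> lit_true \<alpha> w t y y' l" if "l \<in> set (premise s ss)" for l y y'
      using that IH(1) rd by (auto simp: premise_def)
    have stepC: "holds \<alpha> w t y 0 C" if "C \<in> set (step_clauses s ss)" "y < P w" for C y
    proof -
      have "C \<in> set clauses" using that(1) st(3,4,5) unfolding set_clauses by blast
      then show ?thesis using C t(2) P_bounds(1)[of w] that(2) by simp
    qed
    have new_state: "\<alpha> (Suc t) 0 (St (fst (ext_trans s ss)))"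
    proof -
      have "holds \<alpha> w t 0 0 (before_end, premise s ss @ [(True, tn, t0, St (fst (ext_trans s ss)))])"
        using P_bounds(1)[of w] by (intro stepC step_clauses_mem)
      then show ?thesis using pre t by (auto simp: holds_def)
    qed
    have "(\<forall>y. int y = fst (snd (conf ?z (Suc t)) ! k) + int (T w) \<longrightarrow> \<alpha> (Suc t) y (Hd k)) \<and>
        (\<forall>y<P w. \<alpha> (Suc t) y (Ce k (snd (snd (conf ?z (Suc t)) ! k) (int y - int (T w)))))" if k: "k < K" for k
    proof -
      obtain a mv where m: "snd (ext_trans s ss) ! k = (a, mv)" by fastforce
      have new: "snd (conf ?z (Suc t)) ! k = (h k + shift_amount mv, (v k)(h k := a))"
        using st(2)[OF k] m by (cases "snd (conf ?z t) ! k") (simp add: h_def v_def del: funpow.simps)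
      have pk: "pos k < P w" "pos k + 1 < P w" "0 < pos k" "int (pos k) = h k + int (T w)" using pos[OF k] by auto
      have "holds \<alpha> w t (pos k) 0 (\<lambda>w t y y'. t < T w \<and> 0 < y \<and> y + 1 < P w,
          premise s ss @ [(False, tc, py, Hd k), (True, tn, shift_pos (snd (snd (ext_trans s ss) ! k)), Hd k)])"
        using k pk by (intro stepC step_clauses_mem)
      then have "\<alpha> (Suc t) (shift_pos mv w t (pos k) 0) (Hd k)"
        using pre t pk IH(2)[OF k] m by (auto simp: holds_def)
      moreover have "y = shift_pos mv w t (pos k) 0" if "int y = h k + shift_amount mv + int (T w)" for y
        using that shift_pos_int(1)[OF pk(3), where mv = mv and w = w and t = t and y' = 0] pk(4) by linarith
      moreover have "holds \<alpha> w t (pos k) 0 (before_end,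
          premise s ss @ [(False, tc, py, Hd k), (True, tn, py, Ce k (fst (snd (ext_trans s ss) ! k)))])"
        using k pk by (intro stepC step_clauses_mem)
      then have "\<alpha> (Suc t) (pos k) (Ce k a)"
        using pre t IH(2)[OF k] m by (auto simp: holds_def)
      moreover have "\<alpha> (Suc t) y (Ce k (v k (int y - int (T w))))" if y: "y < P w" "y \<noteq> pos k" for y
      proof -
        from C[OF cell_clauses_mem(2)[OF k vS[OF k, of "int y - int (T w)"]] t(2) pk(1) y(1)] show ?thesis
          using t y IH(2)[OF k] IH(3)[OF k y(1)] by (simp add: holds_def)
      qed
      moreover have "int y - int (T w) = h k \<longleftrightarrow> y = pos k" for y using pk(4) by auto
      ultimately show ?thesis unfolding new by auto
    qed
    then show ?case using new_state st(1) by simp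
  qed
  let ?s = "snd (snd (conf ?z (T w)) ! 1) 0"
  have "\<alpha> (T w) (T w) (Ce 1 ?s)" "?s < S"
  proof -
    have "1 < K" using wf_bounds by simp
    then have "\<forall>y<P w. \<alpha> (T w) y (Ce 1 (snd (snd (conf ?z (T w)) ! 1) (int y - int (T w))))"
      using run[of "T w"] by blast
    from this[rule_format, OF P_bounds(2)] show "\<alpha> (T w) (T w) (Ce 1 ?s)" by simp
    show "?s < S" using conf_wf[where z = ?z and t = "T w"] \<open>1 < K\<close> by blast
  qed
  then have "?s = 2"
  proof (rule_tac ccontr)
    assume a: "\<alpha> (T w) (T w) (Ce 1 ?s)" "?s < S" "?s \<noteq> 2"
    then have "(always, [(False, mid, mid, Ce 1 ?s)]) \<in> set final_clauses"
      unfolding final_clauses_def set_map by (intro image_eqI[OF refl]) simp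
    then have "(always, [(False, mid, mid, Ce 1 ?s)]) \<in> set clauses"
      unfolding set_clauses by blast
    from C[OF this, of 0 0 0] a(1) P_bounds(1)[of w] show False by (simp add: holds_def)
  qed
  then have "?z \<in> B"
    using conf_halted[OF M length_le_T[OF u]] by (simp add: tape_word_def split: if_splits)
  then show ?thesis using u by blast
qed

end

context tm_reduction begin

section \<open>From clauses to puzzles\<close>

text \<open>Element \<open>2 * v + 1\<close> is the literal \<open>v\<close>, element
  \<open>2 * v\<close> its negation. Where the guard fails every element hits, so that each index
  tuple can have its own band, whether its clause is meant or not.\<close>

definition clause_hit :: "bool list \<Rightarrow> nat \<Rightarrow> nat \<Rightarrow> nat \<Rightarrow> clause \<Rightarrow> nat \<Rightarrow> bool" where
  "clause_hit w t y y' C c \<longleftrightarrow> (fst C w t y y' \<longrightarrow> (\<exists>l \<in> set (snd C). case l of (sg, tf, pf, a) \<Rightarrow>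
     lit_ok w (tf w t y y') (pf w t y y') a \<and> c = 2 * idx w (tf w t y y') (pf w t y y') a + of_bool sg))"

definition row :: "bool list \<Rightarrow> nat \<Rightarrow> nat \<Rightarrow> nat \<Rightarrow> nat \<Rightarrow> nat" where
  "row w j t y y' = nv w + (((t * P w + y) * P w + y') * length clauses + j)"

definition rows :: "bool list \<Rightarrow> nat" where
  "rows w = nv w + (T w + 1) * P w * P w * length clauses"

text \<open>
  The instance of the hitting set problem has the literals as its elements. The rows below
  \<^term>\<open>nv w\<close> force a hitting set of cardinality \<^term>\<open>nv w\<close> to choose one literal of each variable.
\<close>

definition hits :: "bool list \<Rightarrow> nat \<Rightarrow> nat \<Rightarrow> bool" where
  "hits w r c \<longleftrightarrow> (r < nv w \<longrightarrow> c = 2 * r \<or> c = 2 * r + 1) \<and>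
     (\<forall>x \<in> set (List.enumerate 0 clauses). \<forall>t<T w + 1. \<forall>y<P w. \<forall>y'<P w.
        r = row w (fst x) t y y' \<longrightarrow> clause_hit w t y y' (snd x) c)"

lemma radix_less: "i < m \<Longrightarrow> a < (n :: nat) \<Longrightarrow> i * n + a < m * n"
  using mult_add_less_mono[of i m n] by linarith

lemma row_bounds:
  assumes "j < length clauses" "t \<le> T w" "y < P w" "y' < P w"
  shows "nv w \<le> row w j t y y'" "row w j t y y' < rows w"
proof -
  show "nv w \<le> row w j t y y'" by (simp add: row_def)
  have "t * P w + y < (T w + 1) * P w" using assms by (intro radix_less) auto
  then have "(t * P w + y) * P w + y' < (T w + 1) * P w * P w" by (rule radix_less[OF _ assms(4)])
  then have "((t * P w + y) * P w + y') * length clauses + j < (T w + 1) * P w * P w * length clauses"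
    by (rule radix_less[OF _ assms(1)])
  then show "row w j t y y' < rows w" unfolding row_def rows_def by linarith
qed

lemma row_inj:
  assumes "row w i t1 y1 z1 = row w j t2 y2 z2" "i < length clauses" "j < length clauses"
    "y1 < P w" "z1 < P w" "y2 < P w" "z2 < P w"
  shows "i = j \<and> t1 = t2 \<and> y1 = y2 \<and> z1 = z2"
proof -
  have "((t1 * P w + y1) * P w + z1) * length clauses + i = ((t2 * P w + y2) * P w + z2) * length clauses + j"
    using assms(1) by (simp add: row_def)
  from mult_add_eq_cases[OF this assms(2,3)]
  have 1: "i = j" "(t1 * P w + y1) * P w + z1 = (t2 * P w + y2) * P w + z2" by auto
  from mult_add_eq_cases[OF 1(2) assms(5,7)]
  have 2: "z1 = z2" "t1 * P w + y1 = t2 * P w + y2" by auto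
  from mult_add_eq_cases[OF 2(2) assms(4,6)] 1 2 show ?thesis by simp
qed

lemma row_cases:
  assumes "nv w \<le> r" "r < rows w"
  obtains j t y y' where "j < length clauses" "t \<le> T w" "y < P w" "y' < P w" "r = row w j t y y'"
proof -
  let ?n = "length clauses" and ?P = "P w"
  define s where "s = r - nv w"
  have s: "s < (T w + 1) * ?P * ?P * ?n" using assms unfolding s_def rows_def by linarith
  then have "s div ?n < (T w + 1) * ?P * ?P" by (simp add: less_mult_imp_div_less)
  then have "s div ?n div ?P < (T w + 1) * ?P" by (simp add: less_mult_imp_div_less)
  then have "s div ?n div ?P div ?P < T w + 1" by (simp add: less_mult_imp_div_less)
  moreover have "0 < ?n" using s by (cases "?n = 0") auto
  moreover have "r = row w (s mod ?n) (s div ?n div ?P div ?P) (s div ?n div ?P mod ?P) (s div ?n mod ?P)"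
    using assms(1) unfolding row_def div_mult_mod_eq by (simp add: s_def)
  ultimately show thesis
    using P_bounds(1)[of w] by (intro that[of "s mod ?n" "s div ?n div ?P div ?P" "s div ?n div ?P mod ?P" "s div ?n mod ?P"]) auto
qed

lemma hits_var: "r < nv w \<Longrightarrow> hits w r c \<longleftrightarrow> c = 2 * r \<or> c = 2 * r + 1"
  unfolding hits_def row_def by auto

lemma hits_row:
  assumes "j < length clauses" "t \<le> T w" "y < P w" "y' < P w"
  shows "hits w (row w j t y y') c \<longleftrightarrow> clause_hit w t y y' (clauses ! j) c"
proof
  assume h: "hits w (row w j t y y') c"
  have "(j, clauses ! j) \<in> set (List.enumerate 0 clauses)" using assms(1) by (simp add: in_set_enumerate_eq)
  moreover have "t < T w + 1" using assms(2) by simp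
  ultimately show "clause_hit w t y y' (clauses ! j) c"
    using h assms(3,4) unfolding hits_def by (metis fst_conv snd_conv)
next
  assume c: "clause_hit w t y y' (clauses ! j) c"
  have "clause_hit w t2 y2 z2 (snd x) c"
    if "x \<in> set (List.enumerate 0 clauses)" "y2 < P w" "z2 < P w" "row w j t y y' = row w (fst x) t2 y2 z2" for x t2 y2 z2
  proof -
    have "fst x < length clauses" "snd x = clauses ! fst x" using that(1) by (auto simp: in_set_enumerate_eq)
    then show ?thesis using row_inj[OF that(4) assms(1)] that(2,3) assms(3,4) c by simp
  qed
  moreover have "\<not> row w j t y y' < nv w" using row_bounds(1)[OF assms] by simp
  ultimately show "hits w (row w j t y y') c" unfolding hits_def by blast
qed

lemma to_nat_attr_less: "a \<in> set attrs \<Longrightarrow> to_nat a < A"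
  unfolding A_def less_Suc_eq_le by (auto intro!: member_le_sum_list)

lemma idx_less: "lit_ok w t y a \<Longrightarrow> idx w t y a < nv w"
  unfolding idx_def nv_def lit_ok_def by (intro radix_less to_nat_attr_less) auto

lemma idx_decode:
  assumes "lit_ok w t y a"
  shows "idx w t y a div A div P w = t" "idx w t y a div A mod P w = y" "idx w t y a mod A = to_nat a"
  using assms to_nat_attr_less[of a] by (simp_all add: idx_def lit_ok_def)

lemma nv_pos: "0 < nv w"
  using P_bounds(1)[of w] by (simp add: nv_def A_def)

text \<open>A set of \<open>nv w\<close> elements that meets each of the \<open>nv w\<close> pairs
  \<open>2 * v\<close>, \<open>2 * v + 1\<close> meets each just once: halving maps it onto the
  variables, hence injectively. It is therefore an assignment.\<close>

lemma satisfies_if_hitting: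
  assumes X: "X \<subseteq> {..<2 * nv w}" "card X = nv w" and hit: "\<forall>r<rows w. \<exists>c\<in>X. hits w r c"
  shows "satisfies (\<lambda>t y a. 2 * idx w t y a + 1 \<in> X) w"
proof -
  have var: "2 * v \<in> X \<or> 2 * v + 1 \<in> X" if "v < nv w" for v
  proof -
    have "v < rows w" using that by (simp add: rows_def)
    then obtain c where "c \<in> X" "hits w v c" using hit by blast
    then show ?thesis unfolding hits_var[OF that] by blast
  qed
  have "(\<lambda>c. c div 2) ` X = {..<nv w}"
  proof (intro equalityI subsetI)
    fix v assume v: "v \<in> {..<nv w}"
    have "v = 2 * v div 2" "v = (2 * v + 1) div 2" by auto
    then show "v \<in> (\<lambda>c. c div 2) ` X" using var[of v] v by (metis imageI lessThan_iff)
  qed (use X(1) in auto)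
  then have inj: "inj_on (\<lambda>c. c div 2) X"
    using X finite_subset[OF X(1)] by (intro eq_card_imp_inj_on) auto
  have ne: "\<not> (2 * v \<in> X \<and> 2 * v + 1 \<in> X)" for v
  proof
    assume "2 * v \<in> X \<and> 2 * v + 1 \<in> X"
    from inj_onD[OF inj _ this[THEN conjunct1] this[THEN conjunct2]] show False by simp
  qed
  show ?thesis unfolding satisfies_def
  proof (intro ballI allI impI)
    fix C t y y' assume C: "C \<in> set clauses" and b: "t \<le> T w" "y < P w" "y' < P w"
    obtain j where j: "j < length clauses" "C = clauses ! j" using C by (metis in_set_conv_nth)
    obtain c where c: "c \<in> X" "clause_hit w t y y' C c"
      using hit row_bounds(2)[OF j(1) b] hits_row[OF j(1) b] j(2) by blast
    show "holds (\<lambda>t y a. 2 * idx w t y a + 1 \<in> X) w t y y' C"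
      unfolding holds_def
    proof
      assume "fst C w t y y'"
      then obtain l where l: "l \<in> set (snd C)" "case l of (sg, tf, pf, a) \<Rightarrow>
          lit_ok w (tf w t y y') (pf w t y y') a \<and> c = 2 * idx w (tf w t y y') (pf w t y y') a + of_bool sg"
        using c(2) unfolding clause_hit_def by blast
      obtain sg tf pf a where s: "l = (sg, tf, pf, a)" by (cases l)
      have "lit_true (\<lambda>t y a. 2 * idx w t y a + 1 \<in> X) w t y y' l"
        using l(2) c(1) ne[of "idx w (tf w t y y') (pf w t y y') a"] unfolding s by (cases sg) auto
      then show "\<exists>l \<in> set (snd C). lit_true (\<lambda>t y a. 2 * idx w t y a + 1 \<in> X) w t y y' l" using l(1) by blast
    qed
  qed
qed

lemma hitting_if_satisfies:
  assumes sat: "satisfies \<alpha> w"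
  shows "\<exists>X \<subseteq> {..<2 * nv w}. card X = nv w \<and> (\<forall>r<rows w. \<exists>c\<in>X. hits w r c)"
proof -
  \<comment> \<open>On variables without occurrences the decoded attribute is arbitrary; agreement
    with \<alpha> is required only where \<open>lit_ok\<close> holds.\<close>
  define \<beta> where "\<beta> v = \<alpha> (v div A div P w) (v div A mod P w) (from_nat (v mod A))" for v
  define code where "code v = 2 * v + of_bool (\<beta> v)" for v :: nat
  have \<beta>: "\<beta> (idx w t y a) = \<alpha> t y a" if "lit_ok w t y a" for t y a
    unfolding \<beta>_def idx_decode[OF that] by simp
  have code: "code v div 2 = v" for v by (simp add: code_def)
  have "inj_on code {..<nv w}" by (rule inj_on_inverseI[of _ "\<lambda>c. c div 2"]) (rule code)
  then have card: "card (code ` {..<nv w}) = nv w" by (simp add: card_image)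
  have sub: "code ` {..<nv w} \<subseteq> {..<2 * nv w}" by (auto simp: code_def)
  have "\<exists>c \<in> code ` {..<nv w}. hits w r c" if r: "r < rows w" for r
  proof (cases "r < nv w")
    case True
    then have "hits w r (code r)" unfolding hits_var[OF True] by (cases "\<beta> r") (simp_all add: code_def)
    then show ?thesis using True by blast
  next
    case False
    then obtain j t y y' where j: "j < length clauses" "t \<le> T w" "y < P w" "y' < P w" "r = row w j t y y'"
      using row_cases[of w r] r by (metis not_less)
    let ?C = "clauses ! j"
    have h: "holds \<alpha> w t y y' ?C" using sat j nth_mem[OF j(1)] unfolding satisfies_def by blast
    have "\<exists>c \<in> code ` {..<nv w}. clause_hit w t y y' ?C c"
    proof (cases "fst ?C w t y y'")
      case False
      then have "clause_hit w t y y' ?C (code 0)" by (simp add: clause_hit_def)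
      then show ?thesis using nv_pos by blast
    next
      case True
      then obtain l where l: "l \<in> set (snd ?C)" "lit_true \<alpha> w t y y' l" using h unfolding holds_def by blast
      obtain sg tf pf a where s: "l = (sg, tf, pf, a)" by (cases l)
      let ?v = "idx w (tf w t y y') (pf w t y y') a"
      have ok: "lit_ok w (tf w t y y') (pf w t y y') a" and sg: "\<alpha> (tf w t y y') (pf w t y y') a = sg"
        using l(2) unfolding s by simp_all
      have "clause_hit w t y y' ?C (code ?v)"
        unfolding clause_hit_def code_def \<beta>[OF ok] using l(1) ok sg s by fastforce
      then show ?thesis using idx_less[OF ok] by blast
    qed
    then show ?thesis using hits_row[OF j(1-4)] j(5) by simp
  qed
  then show ?thesis using card sub by blast
qed

section \<open>The puzzle of a word and its correctness\<close>

definition "bN w = 2 * nv w" for w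
definition "bd w = rows w + 2" for w
definition "bH w = 6 * bd w + 3" for w
definition "bW w = bN w + 1" for w
definition "bM w = bN w * bW w + 1" for w
definition "bR w = rows w * bH w + 2" for w
definition "bY w = bR w + rows w * bH w + 1" for w
definition "bZ w = bM w + bN w * bW w" for w
definition "bn w = bY w + bZ w + 1" for w

definition is_tile :: "bool list \<Rightarrow> nat \<Rightarrow> nat \<Rightarrow> bool" where
  "is_tile w = hit_tile (bN w) (rows w) (nv w) (bd w) (bH w) (bW w) (bM w) (bR w) (hits w)"

definition puzzle :: "bool list \<Rightarrow> zhed" where
  "puzzle w = ones_puzzle (bn w) (bY w, bZ w) {(y, x). is_tile w y x}"

lemma puzzle_correct: "wf_zhed (puzzle w)" "solvable (puzzle w) \<longleftrightarrow> (\<exists>\<alpha>. satisfies \<alpha> w)"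
proof -
  interpret hb: hitting_board "bN w" "rows w" "nv w" "bd w" "bH w" "bW w" "bM w" "bR w" "hits w"
    using nv_pos[of w] by unfold_locales (simp_all add: bN_def bd_def bH_def bW_def bM_def bR_def rows_def)
  have p: "puzzle w = ones_puzzle (bn w) (bR w + rows w * bH w + 1, bM w + bN w * bW w) hb.tile_set"
    unfolding puzzle_def hb.tile_set_def is_tile_def bY_def bZ_def ..
  have b: "bR w + rows w * bH w + 1 < bn w" "bM w + bN w * bW w < bn w"
    unfolding bn_def bY_def bZ_def by linarith+
  show "wf_zhed (puzzle w)" unfolding p by (rule hb.hitting_puzzle(1)[OF b])
  have "solvable (puzzle w) \<longleftrightarrow> (\<exists>X \<subseteq> {..<2 * nv w}. card X = nv w \<and> (\<forall>r<rows w. \<exists>c\<in>X. hits w r c))"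
    unfolding p hb.hitting_puzzle(2)[OF b] unfolding bN_def ..
  also have "\<dots> \<longleftrightarrow> (\<exists>\<alpha>. satisfies \<alpha> w)"
  proof
    assume "\<exists>X \<subseteq> {..<2 * nv w}. card X = nv w \<and> (\<forall>r<rows w. \<exists>c\<in>X. hits w r c)"
    then obtain X where "X \<subseteq> {..<2 * nv w}" "card X = nv w" "\<forall>r<rows w. \<exists>c\<in>X. hits w r c" by blast
    from satisfies_if_hitting[OF this] show "\<exists>\<alpha>. satisfies \<alpha> w" by blast
  qed (use hitting_if_satisfies in blast)
  finally show "solvable (puzzle w) \<longleftrightarrow> (\<exists>\<alpha>. satisfies \<alpha> w)" .
qed

section \<open>The reduction is computable in polynomial time\<close>

text \<open>Definability for functions with three further arguments, stated as closure under
  definable arguments; in this form it applies below the quantifiers over times and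
  positions.\<close>

definition okf :: "pfun \<Rightarrow> bool" where
  "okf f \<longleftrightarrow> (\<forall>a b c. definable a \<longrightarrow> definable b \<longrightarrow> definable c \<longrightarrow> definable (\<lambda>w e. f w (a w e) (b w e) (c w e)))"

definition okp :: "ppred \<Rightarrow> bool" where
  "okp f \<longleftrightarrow> (\<forall>a b c. definable a \<longrightarrow> definable b \<longrightarrow> definable c \<longrightarrow> definable_pred (\<lambda>w e. f w (a w e) (b w e) (c w e)))"

definition clause_ok :: "clause \<Rightarrow> bool" where
  "clause_ok C \<longleftrightarrow> okp (fst C) \<and> (\<forall>l \<in> set (snd C). okf (fst (snd l)) \<and> okf (fst (snd (snd l))))"

lemma definable_T: "definable (\<lambda>w e. T w)"
  unfolding T_def guess_len_def by (assumption | rule definable_intros)+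

lemma definable_guess_len: "definable (\<lambda>w e. guess_len w)"
  unfolding guess_len_def by (assumption | rule definable_intros)+

lemma definable_P: "definable (\<lambda>w e. P w)"
  unfolding P_def by (assumption | rule definable_T definable_intros)+

lemma definable_nv: "definable (\<lambda>w e. nv w)"
  unfolding nv_def by (assumption | rule definable_T definable_P definable_intros)+

lemma definable_rows: "definable (\<lambda>w e. rows w)"
  unfolding rows_def by (assumption | rule definable_T definable_P definable_nv definable_intros)+

lemma definable_fixed_sym: "definable f \<Longrightarrow> definable (\<lambda>w e. fixed_sym w (f w e))"
  unfolding fixed_sym_def by (assumption | rule definable_T definable_guess_len definable_intros)+

lemma okf_shift: "okf (shift_pos mv)"
  by (cases mv) (simp_all add: okf_def definable_diff definable_const definable_Suc)

lemma okf_intros: "okf t0" "okf tc" "okf tn" "okf mid" "okf py" "okf py'" "okf (\<lambda>w t y y'. y + 1)"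
  unfolding okf_def by (intro allI impI; (assumption | rule definable_T definable_intros)+)+

lemma okp_intros: "okp always" "okp before_end" "okp (\<lambda>w t y y'. fixed_sym w y = s)"
  "okp (\<lambda>w t y y'. t < T w \<and> y \<noteq> y')" "okp (\<lambda>w t y y'. t < T w \<and> 0 < y \<and> y + 1 < P w)"
  unfolding okp_def
  by (intro allI impI; (assumption | rule definable_T definable_P definable_fixed_sym definable_intros)+)+

lemma clauses_ok:
  assumes "C \<in> set clauses" shows "clause_ok C"
proof -
  have init: "\<forall>C \<in> set init_clauses. clause_ok C"
    unfolding init_clauses_def clause_ok_def
    by (simp only: set_append ball_Un set_map list.set ball_simps fst_conv snd_conv)
      (intro conjI ballI TrueI okf_intros okp_intros)
  have cell: "\<forall>C \<in> set (cell_clauses k s). clause_ok C" for k s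
    unfolding cell_clauses_def clause_ok_def
    by (simp only: list.set ball_simps fst_conv snd_conv) (intro conjI TrueI okf_intros okp_intros)
  have step: "\<forall>C \<in> set (step_clauses s ss). clause_ok C" for s ss
    unfolding step_clauses_def clause_ok_def premise_def
    by (simp only: set_concat set_append ball_Un set_map list.set ball_simps ball_UN fst_conv snd_conv)
      (intro conjI ballI TrueI okf_intros okf_shift okp_intros)
  have final: "\<forall>C \<in> set final_clauses. clause_ok C"
    unfolding final_clauses_def clause_ok_def
    by (simp only: set_map list.set ball_simps fst_conv snd_conv) (intro conjI ballI TrueI okf_intros okp_intros)
  show ?thesis using assms init cell step final unfolding set_clauses by blast
qed

lemma definable_clause_hit:
  assumes C: "clause_ok C" and d: "definable t" "definable y" "definable y'" "definable c"
  shows "definable_pred (\<lambda>w e. clause_hit w (t w e) (y w e) (y' w e) C (c w e))"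
  unfolding clause_hit_def
proof (intro definable_pred_imp definable_pred_bex_list)
  show "definable_pred (\<lambda>w e. fst C w (t w e) (y w e) (y' w e))"
    using C d unfolding clause_ok_def okp_def by blast
  fix l assume l: "l \<in> set (snd C)"
  obtain sg tf pf a where s: "l = (sg, tf, pf, a)" by (cases l)
  have f: "definable (\<lambda>w e. tf w (t w e) (y w e) (y' w e))" "definable (\<lambda>w e. pf w (t w e) (y w e) (y' w e))"
    using C d l unfolding clause_ok_def okf_def s by fastforce+
  show "definable_pred (\<lambda>w e. case l of (sg, tf, pf, a) \<Rightarrow>
      lit_ok w (tf w (t w e) (y w e) (y' w e)) (pf w (t w e) (y w e) (y' w e)) a \<and>
      c w e = 2 * idx w (tf w (t w e) (y w e) (y' w e)) (pf w (t w e) (y w e) (y' w e)) a + of_bool sg)"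
    unfolding s prod.case lit_ok_def idx_def
    by (rule d f | rule definable_T definable_P definable_intros)+
qed

lemma definable_hits:
  assumes "definable r" "definable c"
  shows "definable_pred (\<lambda>w e. hits w (r w e) (c w e))"
  unfolding hits_def
proof (intro definable_pred_conj definable_pred_ball_list)
  show "definable_pred (\<lambda>w e. r w e < nv w \<longrightarrow> c w e = 2 * r w e \<or> c w e = 2 * r w e + 1)"
    by (rule assms | rule definable_nv definable_intros)+
  fix x :: "nat \<times> clause" assume "x \<in> set (List.enumerate 0 clauses)"
  then have "fst x < length clauses" "snd x = clauses ! fst x" by (auto simp: in_set_enumerate_eq)
  then have ok: "clause_ok (snd x)" by (simp add: clauses_ok)
  show "definable_pred (\<lambda>w e. \<forall>t<T w + 1. \<forall>y<P w. \<forall>y'<P w.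
      r w e = row w (fst x) t y y' \<longrightarrow> clause_hit w t y y' (snd x) (c w e))"
    unfolding row_def
    by (rule ok assms definable_clause_hit definable_T definable_P definable_nv definable_intros)+
qed

lemma definable_board:
  "definable (\<lambda>w e. bN w)" "definable (\<lambda>w e. bd w)" "definable (\<lambda>w e. bH w)" "definable (\<lambda>w e. bW w)"
  "definable (\<lambda>w e. bM w)" "definable (\<lambda>w e. bR w)" "definable (\<lambda>w e. bY w)" "definable (\<lambda>w e. bZ w)"
  "definable (\<lambda>w e. bn w)"
  unfolding bn_def bY_def bZ_def bR_def bM_def bW_def bH_def bd_def bN_def
  by (rule definable_rows definable_nv definable_intros)+

lemma definable_is_tile:
  assumes "definable y" "definable x"
  shows "definable_pred (\<lambda>w e. is_tile w (y w e) (x w e))"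
  unfolding is_tile_def hit_tile_def line_need_def
  by (rule assms definable_hits definable_board definable_rows definable_nv definable_intros)+

text \<open>Row and column of the entry are searched for by bounded quantifiers, as terms offer
  neither \<open>div\<close> nor \<open>mod\<close>.\<close>

definition entry :: "bool list \<Rightarrow> nat \<Rightarrow> nat" where
  "entry w l = (if l = 0 then bn w else if l = 1 then bY w else if l = 2 then bZ w
     else of_bool (\<exists>r<bn w. \<exists>c<bn w. l = 3 + (r * bn w + c) \<and> is_tile w r c))"

lemma encode_puzzle: "encode_zhed (puzzle w) = concat (map unary (map (entry w) [0..<3 + bn w * bn w]))"
proof -
  let ?n = "bn w"
  let ?f = "\<lambda>s. if s \<in> {(y, x). is_tile w y x} then Some 1 else None :: nat option"
  have "entry w (3 + i) = cell_code (?f (i div ?n, i mod ?n))" if i: "i < ?n * ?n" for i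
  proof -
    have n: "0 < ?n" using i by (cases "?n = 0") auto
    have "(\<exists>r<?n. \<exists>c<?n. 3 + i = 3 + (r * ?n + c) \<and> is_tile w r c) \<longleftrightarrow> is_tile w (i div ?n) (i mod ?n)"
    proof
      assume "is_tile w (i div ?n) (i mod ?n)"
      moreover have "i div ?n < ?n" using i by (simp add: less_mult_imp_div_less)
      moreover have "3 + i = 3 + (i div ?n * ?n + i mod ?n)" by simp
      ultimately show "\<exists>r<?n. \<exists>c<?n. 3 + i = 3 + (r * ?n + c) \<and> is_tile w r c"
        using mod_less_divisor[OF n] by blast
    qed auto
    then show ?thesis by (simp add: entry_def cell_code_def)
  qed
  then have "map (\<lambda>i. entry w (3 + i)) [0..<?n * ?n] = map (\<lambda>i. cell_code (?f (i div ?n, i mod ?n))) [0..<?n * ?n]"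
    by simp
  moreover have "[0..<3 + ?n * ?n] = [0, 1, 2] @ map (\<lambda>i. 3 + i) [0..<?n * ?n]"
  proof -
    have "[0..<3 + ?n * ?n] = [0..<3] @ [3..<3 + ?n * ?n]" by (rule upt_add_eq_append) simp
    moreover have "[3..<3 + ?n * ?n] = map (\<lambda>i. 3 + i) [0..<?n * ?n]"
      using map_add_upt[of 3 "?n * ?n"] by (simp only: add.commute)
    moreover have "[0..<3] = [0, 1, 2 :: nat]" by (simp add: numeral_3_eq_3 numeral_2_eq_2)
    ultimately show ?thesis by simp
  qed
  moreover have "entry w 0 = ?n" "entry w 1 = bY w" "entry w 2 = bZ w" by (simp_all add: entry_def)
  ultimately have "map (entry w) [0..<3 + ?n * ?n] =
      [?n, bY w, bZ w] @ map (\<lambda>i. cell_code (?f (i div ?n, i mod ?n))) [0..<?n * ?n]"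
    by simp
  moreover have "encode_zhed (puzzle w) = concat (map unary ([?n, fst (bY w, bZ w), snd (bY w, bZ w)] @
      map (\<lambda>i. cell_code (?f (i div ?n, i mod ?n))) [0..<?n * ?n]))"
    by (rule nth_encode) (simp add: puzzle_def ones_puzzle_def)
  ultimately show ?thesis by simp
qed

lemma polytime_puzzle: "polytime_computable (\<lambda>w. encode_zhed (puzzle w))"
  unfolding encode_puzzle
proof (rule polytime_computable_definable)
  show "definable (\<lambda>w e. 3 + bn w * bn w)" by (rule definable_board definable_intros)+
  show "definable (\<lambda>w e. entry w (top_var e))"
    unfolding entry_def by (rule definable_is_tile definable_board definable_intros)+
qed

end

section \<open>One reduction for both problems\<close>

lemma NP_reduces_to_ones_puzzles:
  assumes "in_NP A"
  obtains f where "polytime_computable (\<lambda>w. encode_zhed (f w))"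
    "\<And>w. wf_zhed (f w)" "\<And>w. ran (tiles (f w)) \<subseteq> {1}" "\<And>w. w \<in> A \<longleftrightarrow> solvable (f w)"
proof -
  obtain B and p :: "nat poly" where B: "polytime_decidable B"
    and A: "\<And>w. w \<in> A \<longleftrightarrow> (\<exists>u. length u \<le> poly p (length w) \<and> pair_word w u \<in> B)"
    using assms unfolding in_NP_def by blast
  obtain M and q :: "nat poly" where M: "computes_in_time M (\<lambda>x. [x \<in> B]) (poly q)"
    using B unfolding polytime_decidable_def polytime_computable_def by blast
  interpret tm_reduction M p q using M by unfold_locales (simp add: computes_in_time_def)
  have "w \<in> A \<longleftrightarrow> solvable (puzzle w)" for w
    using A[of w] satisfies_if_accepts[OF M, of _ w] accepts_if_satisfies[OF M, of _ w]
    unfolding puzzle_correct(2) guess_len_def by blast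
  moreover have "ran (tiles (puzzle w)) \<subseteq> {1}" for w
    by (auto simp: puzzle_def ones_puzzle_def ran_def split: if_splits)
  ultimately show thesis using that[of puzzle] polytime_puzzle puzzle_correct(1) by blast
qed

theorem theorem1: "NP_complete ZHED \<and> NP_complete ZHED_ones"
proof -
  have "polytime_reducible A ZHED \<and> polytime_reducible A ZHED_ones" if A: "in_NP A" for A
  proof -
    obtain f where f: "polytime_computable (\<lambda>w. encode_zhed (f w))" "\<And>w. wf_zhed (f w)"
      "\<And>w. ran (tiles (f w)) \<subseteq> {1}" "\<And>w. w \<in> A \<longleftrightarrow> solvable (f w)"
      using NP_reduces_to_ones_puzzles[OF A] by blast
    \<comment> \<open>Membership speaks of some puzzle with this code; injectivity of the encoding
      on well-formed puzzles identifies it with \<open>f w\<close>.\<close>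
    have "encode_zhed (f w) \<in> ZHED \<longleftrightarrow> solvable (f w)" "encode_zhed (f w) \<in> ZHED_ones \<longleftrightarrow> solvable (f w)" for w
      using f(2,3)[of w] inj_onD[OF inj_on_encode_zhed, of "f w"] unfolding ZHED_def ZHED_ones_def by auto
    then show ?thesis using f(1,4) unfolding polytime_reducible_def by blast
  qed
  then show ?thesis
    using ZHED_in_NP ZHED_ones_in_NP unfolding NP_complete_def NP_hard_def by blast
qed

end
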